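(* Let $K$ be an imaginary quadratic number field with discriminant $D_K$, and let $D\in\mathbb{N}-\{0\}$. Every maximal nonelementary $\mathbb{C}$-Fuchsian subgroup of $\Gamma_K$ of discriminant $D$ is conjugate in $\mathrm{PSU}_h$ to a subgroup of $\mathrm{PSU}_h$ arising from the quaternion algebra $\left(\frac{D,\,D_K}{\mathbb{Q}}\right)$.
   Context: Let $h(z_0,z_1,z_2)=-z_0\overline{z_2}-z_2\overline{z_0}+|z_1|^2$ on $\mathbb{C}^3$, $\mathrm{SU}_h=\{g\in\mathrm{SL}_3(\mathbb{C}): h\circ g=h\}$, $\mathrm{PSU}_h=\mathrm{SU}_h/(\mathbb{U}_3\,\mathrm{Id})$ ($\mathbb{U}_3$ the cube roots of unity), acting projectively on $\mathbb{P}_2(\mathbb{C})$. $\mathbb{H}^2_\mathbb{C}=\{[z]: h(z)<0\}$. Let $K$ be an imaginary quadratic field, $\mathcal{O}_K$ its ring of integers, $D_K<0$ its discriminant, and $\Gamma_K=\mathrm{PSU}_h(\mathcal{O}_K)$ the image in $\mathrm{PSU}_h$ of the matrices of $\mathrm{SU}_h$ with entries in $\mathcal{O}_K$. A $\mathbb{C}$-Fuchsian subgroup of $\Gamma_K$ is the intersection of $\Gamma_K$ with the image of a Lie group embedding of $\mathrm{PSL}_2(\mathbb{R})$ into $\mathrm{PSU}_h$ preserving a complex projective line meeting $\mathbb{H}^2_\mathbb{C}$; nonelementary means not virtually cyclic; maximal means maximal for inclusion among nonelementary $\mathbb{C}$-Fuchsian subgroups of $\Gamma_K$. Such a nonelementary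 subgroup fixes a unique point of $\mathbb{P}_2(K)$, written $[z_0:z_1:z_2]$ with $z_0,z_1,z_2\in\mathcal{O}_K$ relatively prime; its discriminant is $h(z_0,z_1,z_2)\in\mathbb{N}-\{0\}$. For integers $a>0$, $b<0$, the quaternion algebra $A=\left(\frac{a,b}{\mathbb{Q}}\right)$ is the $4$-dimensional $\mathbb{Q}$-algebra with basis $1,i,j,k$, $i^2=a$, $j^2=b$, $ij=-ji=k$; its reduced norm is $n(x_0+x_1i+x_2j+x_3k)=x_0^2-ax_1^2-bx_2^2+abx_3^2$; $A(\mathbb{Z})=\mathbb{Z}+i\mathbb{Z}+j\mathbb{Z}+k\mathbb{Z}$ and $A(\mathbb{Z})^1$ is its group of norm-one elements. For $M=\begin{pmatrix}\alpha&\beta\\\gamma&\delta\end{pmatrix}\in M_2(\mathbb{C})$ let $E(M)=\begin{pmatrix}\alpha&0&\beta\\0&1&0\\\gamma&0&\delta\end{pmatrix}$. A subgroup of $\mathrm{PSU}_h$ arises from $A$ if there is a $\mathbb{Q}$-algebra morphism $\tau:A\to M_2(\mathbb{C})$ with $E(\tau(A(\mathbb{Z})^1))\subset\mathrm{SU}_h$ such that the subgroup is commensurable (finite-index intersection in both) with the image of $E(\tau(A(\mathbb{Z})^1))$ in $\mathrm{PSU}_h$. *)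

theory Defs
  imports
    "HOL-Analysis.Analysis"
    "HOL-Algebra.Coset"
    "HOL-Algebra.Generated_Groups"
    "HOL-Computational_Algebra.Polynomial"
begin

text \<open>The coordinates \<open>z\<^sub>0, z\<^sub>1, z\<^sub>2\<close> are \<open>z $ 1, z $ 2, z $ 3\<close>.\<close>

definition herm :: "complex^3 \<Rightarrow> real" where
  "herm z = Re (- z $ 1 * cnj (z $ 3) - z $ 3 * cnj (z $ 1)) + (cmod (z $ 2))\<^sup>2"

definition SUh :: "(complex^3^3) monoid" where
  "SUh = \<lparr>carrier = {g. det g = 1 \<and> (\<forall>z. herm (g *v z) = herm z)}, mult = (**), one = mat 1\<rparr>"

definition U3 :: "(complex^3^3) set" where
  "U3 = {mat w | w. w ^ 3 = 1}"

definition PSUh :: "(complex^3^3) set monoid" where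
  "PSUh = SUh Mod U3"

definition proj_PSUh :: "complex^3^3 \<Rightarrow> (complex^3^3) set" where
  "proj_PSUh g = U3 #>\<^bsub>SUh\<^esub> g"


text \<open>Points and lines of the projective plane are the complex linear subspaces of dimension 1
  and 2 of \<open>\<complex>\<^sup>3\<close>. All the representatives of an element of \<open>PSUh\<close> map a linear subspace to the
  same subspace, so that the union below is the image under any one of them.\<close>

definition PSUh_act :: "(complex^3^3) set \<Rightarrow> (complex^3) set \<Rightarrow> (complex^3) set" where
  "PSUh_act X W = (\<Union>g\<in>X. (*v) g ` W)"

definition complex_proj_line :: "(complex^3) set \<Rightarrow> bool" where
  "complex_proj_line W \<longleftrightarrow> vec.subspace W \<and> vec.dim W = 2"

definition H2C :: "(complex^3) set set" where
  "H2C = {vec.span {z} | z. herm z < 0}"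


definition imaginary_quadratic_field :: "complex set \<Rightarrow> bool" where
  "imaginary_quadratic_field K \<longleftrightarrow>
     0 \<in> K \<and> 1 \<in> K \<and>
     (\<forall>x\<in>K. \<forall>y\<in>K. x + y \<in> K \<and> x * y \<in> K) \<and>
     (\<forall>x\<in>K. - x \<in> K \<and> inverse x \<in> K) \<and>
     vector_space.dim (\<lambda>(q::rat) (x::complex). of_rat q * x) K = 2 \<and>
     \<not> K \<subseteq> \<real>"

definition ring_of_integers :: "complex set \<Rightarrow> complex set" where
  "ring_of_integers K = {x \<in> K. algebraic_int x}"

text \<open>The squared determinant of the matrix \<open>(\<sigma>\<^sub>i(w\<^sub>j))\<close> for a \<open>\<int>\<close>-basis \<open>w\<^sub>1, w\<^sub>2\<close> of the ring of
  integers, where \<open>\<sigma>\<^sub>1, \<sigma>\<^sub>2\<close> are the identity and the complex conjugation. It is the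
  discriminant for imaginary quadratic \<open>K\<close> only.\<close>

definition field_disc :: "complex set \<Rightarrow> int" where
  "field_disc K = (THE d. \<exists>w1 w2.
     ring_of_integers K = {of_int m * w1 + of_int n * w2 | m n. True} \<and>
     of_int d = (w1 * cnj w2 - w2 * cnj w1)\<^sup>2)"

definition Gamma :: "complex set \<Rightarrow> (complex^3^3) set set" where
  "Gamma K = proj_PSUh ` {g \<in> carrier SUh. \<forall>i j. g $ i $ j \<in> ring_of_integers K}"


definition SL2R :: "(real^2^2) monoid" where
  "SL2R = \<lparr>carrier = {g. det g = 1}, mult = (**), one = mat 1\<rparr>"

definition PSL2R :: "(real^2^2) set monoid" where
  "PSL2R = SL2R Mod {mat 1, mat (- 1)}"

definition quotient_top :: "('a::topological_space, 'b) monoid_scheme \<Rightarrow> 'a set \<Rightarrow> 'a set topology" where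
  "quotient_top G N = topology (\<lambda>U. U \<subseteq> rcosets\<^bsub>G\<^esub> N \<and>
     openin (top_of_set (carrier G)) {g \<in> carrier G. N #>\<^bsub>G\<^esub> g \<in> U})"

lemma openin_quotient_top:
  "openin (quotient_top G N) U \<longleftrightarrow> U \<subseteq> rcosets\<^bsub>G\<^esub> N \<and>
     openin (top_of_set (carrier G)) {g \<in> carrier G. N #>\<^bsub>G\<^esub> g \<in> U}"
proof -
  have "istopology (\<lambda>U. U \<subseteq> rcosets\<^bsub>G\<^esub> N \<and>
     openin (top_of_set (carrier G)) {g \<in> carrier G. N #>\<^bsub>G\<^esub> g \<in> U})"
    unfolding istopology_def
  proof (intro conjI allI impI; (elim conjE)?)
    fix S T assume "openin (top_of_set (carrier G)) {g \<in> carrier G. N #>\<^bsub>G\<^esub> g \<in> S}"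
      "openin (top_of_set (carrier G)) {g \<in> carrier G. N #>\<^bsub>G\<^esub> g \<in> T}"
    then have "openin (top_of_set (carrier G))
      ({g \<in> carrier G. N #>\<^bsub>G\<^esub> g \<in> S} \<inter> {g \<in> carrier G. N #>\<^bsub>G\<^esub> g \<in> T})"
      by (rule openin_Int)
    moreover have "{g \<in> carrier G. N #>\<^bsub>G\<^esub> g \<in> S} \<inter> {g \<in> carrier G. N #>\<^bsub>G\<^esub> g \<in> T}
      = {g \<in> carrier G. N #>\<^bsub>G\<^esub> g \<in> S \<inter> T}" by auto
    ultimately show "openin (top_of_set (carrier G)) {g \<in> carrier G. N #>\<^bsub>G\<^esub> g \<in> S \<inter> T}"
      by simp
  next
    fix \<K> assume *: "\<forall>S\<in>\<K>. S \<subseteq> rcosets\<^bsub>G\<^esub> N \<and>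
      openin (top_of_set (carrier G)) {g \<in> carrier G. N #>\<^bsub>G\<^esub> g \<in> S}"
    have "openin (top_of_set (carrier G)) (\<Union>S\<in>\<K>. {g \<in> carrier G. N #>\<^bsub>G\<^esub> g \<in> S})"
      using * by (intro openin_Union) auto
    moreover have "(\<Union>S\<in>\<K>. {g \<in> carrier G. N #>\<^bsub>G\<^esub> g \<in> S}) = {g \<in> carrier G. N #>\<^bsub>G\<^esub> g \<in> \<Union>\<K>}"
      by auto
    ultimately show "openin (top_of_set (carrier G)) {g \<in> carrier G. N #>\<^bsub>G\<^esub> g \<in> \<Union>\<K>}"
      by simp
  qed blast+
  then show ?thesis
    unfolding quotient_top_def by (simp add: topology_inverse')
qed

text \<open>A Lie group morphism is a continuous homomorphism between Lie groups (its smoothness is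
  automatic), and it is an embedding iff it is moreover a homeomorphism onto its image.\<close>

definition Lie_group_embedding ::
  "('a, 'c) monoid_scheme \<Rightarrow> 'a topology \<Rightarrow> ('b, 'd) monoid_scheme \<Rightarrow> 'b topology \<Rightarrow> ('a \<Rightarrow> 'b) \<Rightarrow> bool"
  where
  "Lie_group_embedding G S H T \<phi> \<longleftrightarrow> \<phi> \<in> hom G H \<and> embedding_map S T \<phi>"

text \<open>The stabiliser in \<open>PSUh\<close> of a complex projective line meeting \<open>H2C\<close> is isomorphic to
  \<open>U(1,1)\<close>, whose derived subgroup \<open>SU(1,1)\<close> is isomorphic to \<open>SL\<^sub>2(\<real>)\<close> and contains a single
  element of order 2. Hence it contains the faithful image of \<open>SL\<^sub>2(\<real>)\<close>, but no faithful image
  of \<open>PSL\<^sub>2(\<real>)\<close>: the group acting as \<open>PSL\<^sub>2(\<real>)\<close> on the line is embedded together with its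
  central element, the reflection of order 2 fixing the line pointwise. The usual phrase
  ``embedding of \<open>PSL\<^sub>2(\<real>)\<close>'' is therefore read up to the centre of \<open>SL\<^sub>2(\<real>)\<close>, by allowing
  \<open>SL\<^sub>2(\<real>)\<close> besides \<open>PSL\<^sub>2(\<real>)\<close>; with \<open>PSL\<^sub>2(\<real>)\<close> alone there would be no such subgroup.\<close>

definition embedded_PSL2R_or_SL2R :: "(complex^3^3) set set \<Rightarrow> bool" where
  "embedded_PSL2R_or_SL2R R \<longleftrightarrow>
     (\<exists>\<phi>. Lie_group_embedding PSL2R (quotient_top SL2R {mat 1, mat (- 1)})
            PSUh (quotient_top SUh U3) \<phi> \<and> R = \<phi> ` carrier PSL2R) \<or>
     (\<exists>\<phi>. Lie_group_embedding SL2R (top_of_set (carrier SL2R))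
            PSUh (quotient_top SUh U3) \<phi> \<and> R = \<phi> ` carrier SL2R)"

definition C_Fuchsian :: "complex set \<Rightarrow> (complex^3^3) set set \<Rightarrow> bool" where
  "C_Fuchsian K F \<longleftrightarrow> (\<exists>R L. embedded_PSL2R_or_SL2R R \<and>
     complex_proj_line L \<and> (\<exists>p\<in>H2C. p \<subseteq> L) \<and> (\<forall>X\<in>R. PSUh_act X L = L) \<and>
     F = Gamma K \<inter> R)"

definition finite_index :: "('a, 'b) monoid_scheme \<Rightarrow> 'a set \<Rightarrow> 'a set \<Rightarrow> bool" where
  "finite_index G A B \<longleftrightarrow> subgroup A G \<and> subgroup B G \<and> B \<subseteq> A \<and>
     finite (rcosets\<^bsub>G\<lparr>carrier := A\<rparr>\<^esub> B)"

definition virtually_cyclic :: "('a, 'b) monoid_scheme \<Rightarrow> 'a set \<Rightarrow> bool" where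
  "virtually_cyclic G A \<longleftrightarrow> (\<exists>a\<in>A. finite_index G A (generate G {a}))"

definition nonelementary_C_Fuchsian :: "complex set \<Rightarrow> (complex^3^3) set set \<Rightarrow> bool" where
  "nonelementary_C_Fuchsian K F \<longleftrightarrow> C_Fuchsian K F \<and> \<not> virtually_cyclic PSUh F"

definition maximal_nonelementary_C_Fuchsian :: "complex set \<Rightarrow> (complex^3^3) set set \<Rightarrow> bool" where
  "maximal_nonelementary_C_Fuchsian K F \<longleftrightarrow> nonelementary_C_Fuchsian K F \<and>
     (\<forall>F'. nonelementary_C_Fuchsian K F' \<and> F \<subseteq> F' \<longrightarrow> F' = F)"

definition relatively_prime3 :: "complex set \<Rightarrow> complex^3 \<Rightarrow> bool" where
  "relatively_prime3 R z \<longleftrightarrow> (\<forall>d\<in>R. (\<forall>i. \<exists>c\<in>R. z $ i = d * c) \<longrightarrow> (\<exists>u\<in>R. d * u = 1))"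

text \<open>When \<open>K\<close> has class number greater than 1, relatively prime coordinates of a point are not
  unique up to units; \<open>D\<close> may then come from any choice of them.\<close>

definition has_discriminant :: "complex set \<Rightarrow> (complex^3^3) set set \<Rightarrow> nat \<Rightarrow> bool" where
  "has_discriminant K F D \<longleftrightarrow> (\<exists>z. z \<noteq> 0 \<and> (\<forall>i. z $ i \<in> ring_of_integers K) \<and>
     relatively_prime3 (ring_of_integers K) z \<and>
     (\<forall>X\<in>F. PSUh_act X (vec.span {z}) = vec.span {z}) \<and>
     herm z = real D)"


text \<open>The tuple \<open>(x0, x1, x2, x3)\<close> is the element \<open>x0 + x1 i + x2 j + x3 k\<close> of the quaternion
  algebra over the rationals with \<open>i\<^sup>2 = a\<close> and \<open>j\<^sup>2 = b\<close>; addition is componentwise.\<close>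

type_synonym quat = "rat \<times> rat \<times> rat \<times> rat"

fun quat_mult :: "int \<Rightarrow> int \<Rightarrow> quat \<Rightarrow> quat \<Rightarrow> quat" where
  "quat_mult a b (x0, x1, x2, x3) (y0, y1, y2, y3) =
    (x0 * y0 + of_int a * x1 * y1 + of_int b * x2 * y2 - of_int a * of_int b * x3 * y3,
     x0 * y1 + x1 * y0 - of_int b * x2 * y3 + of_int b * x3 * y2,
     x0 * y2 + x2 * y0 + of_int a * x1 * y3 - of_int a * x3 * y1,
     x0 * y3 + x3 * y0 + x1 * y2 - x2 * y1)"

fun quat_scale :: "rat \<Rightarrow> quat \<Rightarrow> quat" where
  "quat_scale q (x0, x1, x2, x3) = (q * x0, q * x1, q * x2, q * x3)"

fun quat_norm :: "int \<Rightarrow> int \<Rightarrow> quat \<Rightarrow> rat" where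
  "quat_norm a b (x0, x1, x2, x3) =
     x0\<^sup>2 - of_int a * x1\<^sup>2 - of_int b * x2\<^sup>2 + of_int a * of_int b * x3\<^sup>2"

definition quat_order_norm1 :: "int \<Rightarrow> int \<Rightarrow> quat set" where
  "quat_order_norm1 a b = {x \<in> \<int> \<times> \<int> \<times> \<int> \<times> \<int>. quat_norm a b x = 1}"

definition quat_algebra_morphism :: "int \<Rightarrow> int \<Rightarrow> (quat \<Rightarrow> complex^2^2) \<Rightarrow> bool" where
  "quat_algebra_morphism a b \<tau> \<longleftrightarrow>
     (\<forall>x y. \<tau> (x + y) = \<tau> x + \<tau> y) \<and>
     (\<forall>q x. \<tau> (quat_scale q x) = (\<chi> i j. of_rat q * \<tau> x $ i $ j)) \<and>
     (\<forall>x y. \<tau> (quat_mult a b x y) = \<tau> x ** \<tau> y) \<and>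
     \<tau> (1, 0, 0, 0) = mat 1"

definition E_emb :: "complex^2^2 \<Rightarrow> complex^3^3" where
  "E_emb M = vector [vector [M $ 1 $ 1, 0, M $ 1 $ 2],
                     vector [0, 1, 0],
                     vector [M $ 2 $ 1, 0, M $ 2 $ 2]]"

definition commensurable :: "('a, 'b) monoid_scheme \<Rightarrow> 'a set \<Rightarrow> 'a set \<Rightarrow> bool" where
  "commensurable G A B \<longleftrightarrow> finite_index G A (A \<inter> B) \<and> finite_index G B (A \<inter> B)"

definition arises_from_quaternion_algebra :: "int \<Rightarrow> int \<Rightarrow> (complex^3^3) set set \<Rightarrow> bool" where
  "arises_from_quaternion_algebra a b H \<longleftrightarrow> subgroup H PSUh \<and>
     (\<exists>\<tau>. quat_algebra_morphism a b \<tau> \<and>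
        E_emb ` \<tau> ` quat_order_norm1 a b \<subseteq> carrier SUh \<and>
        commensurable PSUh H (proj_PSUh ` E_emb ` \<tau> ` quat_order_norm1 a b))"

definition conjugate_subgroups :: "('a, 'b) monoid_scheme \<Rightarrow> 'a set \<Rightarrow> 'a set \<Rightarrow> bool" where
  "conjugate_subgroups G A B \<longleftrightarrow>
     (\<exists>x\<in>carrier G. B = (\<lambda>y. x \<otimes>\<^bsub>G\<^esub> y \<otimes>\<^bsub>G\<^esub> inv\<^bsub>G\<^esub> x) ` A)"

end

theory Submission
  imports Defs
begin

text \<open>Let \<open>v\<close> span the orthogonal complement of the line preserved by an embedded copy \<open>R\<close> of
  \<open>PSL\<^sub>2(\<real>)\<close> or \<open>SL\<^sub>2(\<real>)\<close>. Since \<open>SL\<^sub>2(\<real>)\<close> has no nontrivial character, the cube of the eigenvalue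
  at \<open>v\<close> is trivial on \<open>R\<close>, so every element of \<open>R\<close> lifts to a matrix fixing \<open>v\<close>. If the integral
  vector \<open>z\<close> defining the discriminant were not proportional to \<open>v\<close>, discreteness would make the
  group finite or infinite cyclic. Hence \<open>z\<close> and \<open>v\<close> are proportional. The full
  stabiliser of \<open>z\<close> is itself an embedded \<open>SL\<^sub>2(\<real>)\<close>, and maximality identifies the Fuchsian group
  with the image of the integral matrices fixing \<open>z\<close>.

  Completing \<open>z\<close> to an integral orthogonal basis \<open>u, w, z\<close>, where \<open>w\<close> is the Hermitian cross
  product of \<open>z\<close> and \<open>u\<close> and so has norm \<open>- h(z) h(u)\<close>, turns the special unitary group of the
  complement of \<open>z\<close> over \<open>K\<close> into the norm one group of the quaternion algebra. A congruence
  argument compares the two integral structures.\<close>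

section \<open>Integers of an imaginary quadratic field\<close>

text \<open>The algebra is (D, D_K) because u and w have norms h(u) and -D h(u): up to the common
  factor h(u), the form on the complement of z is |a|^2 - D |b|^2 on K^2. Its special unitary
  matrices correspond to the pairs a, b in K with |a|^2 - D |b|^2 = 1, and expanding a and b in the
  basis 1, sqrt(D_K) gives the reduced norm. The frame u, w, z is integral, but its inverse has
  denominator n = D h(u), and Z + Z sqrt(D_K) contains 2 D_K O_K without being all of O_K in
  general. These two defects give the moduli n and 2 n D_K. If z and v are orthogonal, the group
  acts on an orthogonal basis by numbers of modulus 1, so integral lifts have bounded entries. If
  they are independent and not orthogonal, their eigenvalues agree and the group lies in a unipotent
  one-parameter group, whose integral points have discrete parameters. A recurring obstacle: an
  element of PSU_h has three lifts, and the integral one may differ from the one fixing a vector by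
  a cube root of unity. Where this matters, that root is shown to lie in K by its action on an
  integral vector.\<close>

lemma rat_power_bounded_denominator_int:
  fixes r :: rat and M :: int
  assumes "M > 0" and "\<And>k. of_int M * r ^ k \<in> \<int>"
  shows "r \<in> \<int>"
proof -
  obtain p q where pq: "quotient_of r = (p, q)" by force
  have r: "r = of_int p / of_int q" and q0: "q > 0" and cop: "coprime p q"
    using pq quotient_of_div quotient_of_denom_pos quotient_of_coprime by auto
  \<comment> \<open>Being coprime to \<open>p ^ k\<close>, the power \<open>q ^ k\<close> of the
    denominator must divide \<open>M\<close>, for every k. The exponent \<open>nat M\<close> then
    excludes \<open>q\<close> at least 2.\<close>
  have "q ^ k \<le> M" for k
  proof -
    obtain m where "of_int M * r ^ k = (of_int m :: rat)"
      using assms(2)[of k] by (auto elim: Ints_cases)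
    then have "of_int M * of_int p ^ k = (of_int m * of_int q ^ k :: rat)"
      using q0 by (simp add: r field_simps)
    then have "M * p ^ k = m * q ^ k"
      by (metis of_int_eq_iff of_int_mult of_int_power)
    then have "q ^ k dvd M * p ^ k" by simp
    moreover have "coprime (q ^ k) (p ^ k)" using cop by (simp add: coprime_commute)
    ultimately have "q ^ k dvd M" by (simp add: coprime_dvd_mult_left_iff)
    then show ?thesis using assms(1) by (simp add: zdvd_imp_le)
  qed
  then have "q < 2"
  proof -
    { assume "q \<ge> 2"
      then have "2 ^ nat M \<le> q ^ nat M" by (simp add: power_mono)
      also have "\<dots> \<le> M" by fact
      finally have "2 ^ nat M \<le> M" .
      moreover have "int (nat M) < int (2 ^ nat M)"
        by (subst of_nat_less_iff) (rule less_exp)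
      ultimately have False using assms(1) by simp }
    then show ?thesis by force
  qed
  with q0 have "q = 1" by simp
  then show ?thesis by (simp add: r)
qed

lemma rat_denominator:
  obtains N :: int where "N > 0" "of_int N * (q :: rat) \<in> \<int>"
proof -
  obtain a b where "quotient_of q = (a, b)" by force
  then have "b > 0" "q = of_int a / of_int b"
    using quotient_of_div quotient_of_denom_pos by auto
  then show thesis using that[of b] by simp
qed

lemma rats_denominator:
  assumes "finite (S :: rat set)"
  shows "\<exists>N::int. N > 0 \<and> (\<forall>q\<in>S. of_int N * q \<in> \<int>)"
  using assms
proof (induction S rule: finite_induct)
  case empty
  show ?case by (intro exI[of _ 1]) auto
next
  case (insert q S)
  then obtain N where N: "N > 0" "\<And>x. x \<in> S \<Longrightarrow> of_int N * x \<in> \<int>" by auto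
  obtain M :: int where M: "M > 0" "of_int M * q \<in> \<int>" by (rule rat_denominator)
  have "of_int (N * M) * x \<in> \<int>" if "x \<in> insert q S" for x
  proof (cases "x = q")
    case True
    then show ?thesis using Ints_mult[OF _ M(2), of "of_int N"] by (simp add: mult.assoc)
  next
    case False
    then show ?thesis using that Ints_mult[OF _ N(2), of "of_int M" x] by (simp add: mult_ac)
  qed
  then show ?case using N(1) M(1) by (intro exI[of _ "N * M"]) auto
qed

text \<open>The generator is a positive element \<open>t\<close> within \<open>e\<close> of the
  infimum \<open>i\<close> of the positive elements. A nonzero remainder \<open>r\<close> of
  division by \<open>t\<close> would satisfy \<open>r\<close> at least \<open>i\<close> and
  \<open>t - r\<close> at least \<open>e\<close>, which contradicts the choice of \<open>t\<close>.
  It is applied to imaginary parts of integers, to exponents in a cyclic group and to parameters of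
  unipotents.\<close>

lemma discrete_subgroup_real_cyclic:
  fixes T :: "real set"
  assumes "0 \<in> T" and diff: "\<And>x y. x \<in> T \<Longrightarrow> y \<in> T \<Longrightarrow> x - y \<in> T"
    and "e > 0" and e: "\<And>x. x \<in> T \<Longrightarrow> x \<noteq> 0 \<Longrightarrow> e \<le> \<bar>x\<bar>"
  obtains t where "t \<in> T" "T = {of_int k * t | k. True}"
proof (cases "T = {0}")
  case True
  then show thesis using that[of 0] by auto
next
  case False
  have neg: "- x \<in> T" if "x \<in> T" for x using diff[OF assms(1) that] by simp
  have add: "x + y \<in> T" if "x \<in> T" "y \<in> T" for x y using diff[OF that(1) neg[OF that(2)]] by simp
  have natmul: "of_nat k * x \<in> T" if "x \<in> T" for x k
    by (induction k) (use assms(1) add that in \<open>auto simp: algebra_simps\<close>)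
  have intmul: "of_int k * x \<in> T" if "x \<in> T" for x k
    using natmul[OF that, of "nat k"] natmul[OF neg[OF that], of "nat (- k)"]
    by (cases "k \<ge> 0") auto
  define P where "P = {x \<in> T. x > 0}"
  obtain x0 where "x0 \<in> T" "x0 \<noteq> 0" using False assms(1) by auto
  then have "P \<noteq> {}" using neg[of x0] unfolding P_def by (cases "x0 > 0") (auto intro: exI[of _ x0] exI[of _ "- x0"])
  define i where "i = Inf P"
  have bdd: "bdd_below P" by (rule bdd_belowI[of _ 0]) (auto simp: P_def)
  have "e \<le> i" unfolding i_def using \<open>P \<noteq> {}\<close> e by (intro cInf_greatest) (force simp: P_def)+
  obtain t where t: "t \<in> P" "t < i + e"
    using cInf_less_iff[OF \<open>P \<noteq> {}\<close> bdd, of "i + e"] assms(3) by (auto simp: i_def)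
  have "\<exists>k. x = of_int k * t" if "x \<in> T" for x
  proof -
    define k where "k = \<lfloor>x / t\<rfloor>"
    define r where "r = x - of_int k * t"
    have "t > 0" "t \<in> T" using t by (auto simp: P_def)
    have "of_int k \<le> x / t" "x / t < of_int k + 1" unfolding k_def by linarith+
    then have r: "0 \<le> r" "r < t" using \<open>t > 0\<close> by (simp_all add: r_def field_simps)
    have rT: "r \<in> T" unfolding r_def using that intmul \<open>t \<in> T\<close> diff by blast
    have "r = 0"
    proof (rule ccontr)
      assume "r \<noteq> 0"
      then have "r \<in> P" "t - r \<in> P" using r rT diff[OF \<open>t \<in> T\<close> rT] by (auto simp: P_def)
      then have "i \<le> r" "e \<le> t - r" using cInf_lower[OF _ bdd] e[of "t - r"] by (auto simp: i_def P_def)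
      then show False using t(2) by simp
    qed
    then show ?thesis by (auto simp: r_def)
  qed
  then have "T = {of_int k * t | k. True}" using intmul t(1) by (auto simp: P_def)
  then show thesis using that[of t] t(1) by (simp add: P_def)
qed

lemma of_real_of_rat_complex: "of_real (of_rat q) = (of_rat q :: complex)"
proof -
  obtain a b where "quotient_of q = (a, b)" by force
  then have "q = of_int a / of_int b" using quotient_of_div by auto
  then show ?thesis by (simp add: of_rat_divide)
qed

section \<open>The field: rational coordinates, traces and norms\<close>

locale imag_quad =
  fixes K :: "complex set"
  assumes K: "imaginary_quadratic_field K"
begin

abbreviation OK where "OK \<equiv> ring_of_integers K"

lemma K_0: "0 \<in> K" and K_1: "1 \<in> K"
  and K_add: "x \<in> K \<Longrightarrow> y \<in> K \<Longrightarrow> x + y \<in> K"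
  and K_mult: "x \<in> K \<Longrightarrow> y \<in> K \<Longrightarrow> x * y \<in> K"
  and K_uminus: "x \<in> K \<Longrightarrow> - x \<in> K"
  and K_inverse: "x \<in> K \<Longrightarrow> inverse x \<in> K"
  using K unfolding imaginary_quadratic_field_def by auto

lemma K_diff: "x \<in> K \<Longrightarrow> y \<in> K \<Longrightarrow> x - y \<in> K"
  using K_add[of x "- y"] K_uminus by simp

lemma K_divide: "x \<in> K \<Longrightarrow> y \<in> K \<Longrightarrow> x / y \<in> K"
  using K_mult[of x "inverse y"] K_inverse by (simp add: divide_inverse)

lemma K_int: "of_int n \<in> K"
proof -
  have nat: "of_nat m \<in> K" for m by (induction m) (auto simp: K_0 K_1 K_add)
  show ?thesis using nat[of "nat n"] K_uminus[OF nat[of "nat (- n)"]]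
    by (cases "n \<ge> 0") auto
qed

lemma K_rat: "of_rat q \<in> K"
proof -
  obtain a b where "quotient_of q = (a, b)" by force
  then have "q = of_int a / of_int b" using quotient_of_div by auto
  then show ?thesis using K_divide[OF K_int K_int, of a b] by (simp add: of_rat_divide)
qed

lemma K_nonreal: obtains w where "w \<in> K" "w \<notin> \<real>"
  using K unfolding imaginary_quadratic_field_def by auto

lemma K_rat_basis:
  assumes w: "w \<in> K" "w \<notin> \<real>" and x: "x \<in> K"
  obtains p q :: rat where "x = of_rat p + of_rat q * w"
proof -
  let ?sc = "\<lambda>(q::rat) (x::complex). of_rat q * x"
  interpret V: vector_space ?sc
    by unfold_locales (auto simp: algebra_simps of_rat_add of_rat_mult)
  have dim: "V.dim K = 2" using K unfolding imaginary_quadratic_field_def by blast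
  obtain B where B: "B \<subseteq> K" "V.independent B" "K \<subseteq> V.span B" "card B = V.dim K"
    by (rule V.basis_exists)
  then have fB: "finite B" using dim by (metis card.infinite zero_neq_numeral)
  have "w \<noteq> 1" using w(2) by auto
  have ind: "V.independent {1, w}"
  proof -
    have "w \<notin> V.span {1}"
    proof
      assume "w \<in> V.span {1}"
      then obtain k where "w = of_rat k" by (auto simp: V.span_singleton)
      then show False using w(2) by (metis Reals_of_real of_real_of_rat_complex)
    qed
    then have "V.independent (insert w {1})"
      by (intro V.independent_insertI) (auto simp: V.independent_empty)
    then show ?thesis by (simp add: insert_commute)
  qed
  have "x \<in> V.span {1, w}"
  proof (rule ccontr)
    assume nx: "x \<notin> V.span {1, w}"
    then have "V.independent (insert x {1, w})" using ind by (rule V.independent_insertI)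
    moreover have "insert x {1, w} \<subseteq> V.span B" using B(3) K_1 w(1) x by auto
    ultimately have "card (insert x {1, w}) \<le> card B"
      using V.independent_span_bound[OF fB] by blast
    moreover have "x \<noteq> 1" "x \<noteq> w" using nx V.span_base by auto
    ultimately show False using B(4) dim \<open>w \<noteq> 1\<close> by auto
  qed
  then obtain p where "x - of_rat p * 1 \<in> V.span {w}" by (auto simp: V.span_insert)
  then obtain q where "x - of_rat p * 1 = of_rat q * w" by (auto simp: V.span_singleton)
  then show thesis using that[of p q] by (simp add: algebra_simps)
qed

text \<open>A nonreal \<open>x\<close> forms a rational basis together with 1, so
  \<open>x * x\<close> is a rational combination of 1 and \<open>x\<close>; the imaginary part of
  this relation gives the trace and its real part the norm. A real \<open>x\<close> is
  rational.\<close>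

lemma K_trace_norm_rat:
  assumes "x \<in> K"
  shows "\<exists>t n :: rat. 2 * Re x = of_rat t \<and> (cmod x)\<^sup>2 = of_rat n"
proof (cases "x \<in> \<real>")
  case True
  obtain w where w: "w \<in> K" "w \<notin> \<real>" by (rule K_nonreal)
  obtain p q :: rat where pq: "x = of_rat p + of_rat q * w" by (rule K_rat_basis[OF w assms])
  have pq: "x = of_real (of_rat p) + of_real (of_rat q) * w" using pq by (simp only: of_real_of_rat_complex)
  have "Im x = 0" using True by (simp add: complex_is_Real_iff)
  moreover have "Im x = of_rat q * Im w"
    unfolding pq by simp
  moreover have "Im w \<noteq> 0" using w(2) by (simp add: complex_is_Real_iff)
  ultimately have "q = 0" by simp
  then have "x = of_real (of_rat p)" using pq by simp
  then have "2 * Re x = of_rat (2 * p)" "(cmod x)\<^sup>2 = of_rat (p\<^sup>2)"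
    by (simp add: of_rat_mult) (metis \<open>x = of_real (of_rat p)\<close> norm_of_real of_rat_power power2_abs)
  then show ?thesis by blast
next
  case False
  obtain p q :: rat where "x * x = of_rat p + of_rat q * x"
    by (rule K_rat_basis[OF assms False K_mult[OF assms assms]])
  then have pq: "x * x = of_real (of_rat p) + of_real (of_rat q) * x" by (simp only: of_real_of_rat_complex)
  have im: "Im x \<noteq> 0" using False by (simp add: complex_is_Real_iff)
  have "Im (x * x) = of_rat q * Im x" "Re (x * x) = of_rat p + of_rat q * Re x"
    unfolding pq by simp_all
  then have "2 * Re x * Im x = of_rat q * Im x" and re: "Re x * Re x - Im x * Im x = of_rat p + of_rat q * Re x"
    by (simp_all add: algebra_simps)
  then have t: "2 * Re x = of_rat q" using im by simp
  have "(cmod x)\<^sup>2 = of_rat (- p)"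
    unfolding cmod_power2 using re t[symmetric] by (simp add: power2_eq_square of_rat_minus algebra_simps)
  with t show ?thesis by blast
qed

lemma K_cnj: assumes "x \<in> K" shows "cnj x \<in> K"
proof -
  obtain t where "2 * Re x = of_rat t" using K_trace_norm_rat[OF assms] by blast
  then have "cnj x = of_rat t - x"
    by (metis add_diff_cancel_left' complex_add_cnj of_real_of_rat_complex)
  then show ?thesis using K_diff K_rat assms by simp
qed

text \<open>All powers of \<open>x\<close> lie in (Z + Z x) / N for one N: clear the denominators of
  the powers below the degree of the monic \<open>p\<close> and extend by the recursion that
  \<open>p\<close> gives. With N x^k = i + j x, the norm i^2 + i j t + j^2 n shows that M N^2 n^k is
  an integer for every k, where M clears the denominators of the trace t and the norm n. Bounded
  denominators of all powers force n to be an integer.\<close>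

lemma algebraic_int_norm_int:
  assumes x: "x \<in> K" "algebraic_int x" "x \<notin> \<real>"
  shows "(cmod x)\<^sup>2 \<in> \<int>"
proof -
  obtain t n :: rat where t: "2 * Re x = of_rat t" and n: "(cmod x)\<^sup>2 = of_rat n"
    using K_trace_norm_rat[OF x(1)] by blast
  have xx: "x * x = of_rat t * x - of_rat n"
  proof -
    have "x + cnj x = of_rat t" "x * cnj x = of_rat n"
      by (metis complex_add_cnj of_real_of_rat_complex t) (metis complex_norm_square of_real_of_rat_complex n)
    moreover have "x * x = (x + cnj x) * x - x * cnj x" by (simp add: algebra_simps)
    ultimately show ?thesis by simp
  qed
  obtain p where p: "lead_coeff p = 1" "\<forall>i. coeff p i \<in> \<int>" "poly p x = 0"
    using x(2) by (rule algebraic_int.cases) blast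
  define m where "m = degree p"
  have "\<exists>a b :: rat. x ^ k = of_rat a + of_rat b * x" for k
  proof (induction k)
    case 0 show ?case by (intro exI[of _ 1] exI[of _ 0]) auto
  next
    case (Suc k)
    then obtain a b :: rat where ab: "x ^ k = of_rat a + of_rat b * x" by blast
    have "x ^ Suc k = of_rat a * x + of_rat b * (x * x)" by (simp add: ab algebra_simps)
    also have "\<dots> = of_rat (- b * n) + of_rat (a + b * t) * x"
      by (simp add: xx algebra_simps of_rat_add of_rat_mult of_rat_minus)
    finally show ?case by blast
  qed
  then obtain a b :: "nat \<Rightarrow> rat" where ab: "\<And>k. x ^ k = of_rat (a k) + of_rat (b k) * x" by metis
  obtain N :: int where N: "N > 0" "\<And>q. q \<in> a ` {..<m} \<union> b ` {..<m} \<Longrightarrow> of_int N * q \<in> \<int>"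
    using rats_denominator[of "a ` {..<m} \<union> b ` {..<m}"] by auto
  have comb: "\<exists>i j :: int. of_int N * x ^ k = of_int i + of_int j * x" for k
  proof (induction k rule: less_induct)
    case (less k)
    show ?case
    proof (cases "k < m")
      case True
      then obtain i j where "of_int N * a k = of_int i" "of_int N * b k = of_int j"
        using N(2)[of "a k"] N(2)[of "b k"] by (auto elim!: Ints_cases)
      then have "of_int N * of_rat (a k) = (of_int i :: complex)" "of_int N * of_rat (b k) = (of_int j :: complex)"
        by (metis of_rat_mult of_rat_of_int_eq)+
      then have "of_int N * x ^ k = of_int i + of_int j * x"
        by (simp add: ab distrib_left flip: mult.assoc)
      then show ?thesis by blast
    next
      case False
      have "0 = (\<Sum>i\<le>m. coeff p i * x ^ i)" using p(3) by (simp add: poly_altdef m_def)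
      also have "\<dots> = (\<Sum>i<m. coeff p i * x ^ i) + x ^ m"
        using p(1) by (simp add: m_def flip: lessThan_Suc_atMost)
      finally have "x ^ m = - (\<Sum>i<m. coeff p i * x ^ i)" by (simp add: eq_neg_iff_add_eq_0 add.commute)
      then have "x ^ k = - (\<Sum>i<m. coeff p i * x ^ i) * x ^ (k - m)"
        using False by (metis le_add_diff_inverse not_less power_add)
      then have eq: "of_int N * x ^ k = - (\<Sum>i<m. coeff p i * (of_int N * x ^ (i + (k - m))))"
        by (simp add: sum_distrib_left sum_distrib_right power_add mult_ac)
      have "\<exists>u v :: int. coeff p i * (of_int N * x ^ (i + (k - m))) = of_int u + of_int v * x" if "i < m" for i
      proof -
        have "i + (k - m) < k" using that False by simp
        then obtain u v :: int where "of_int N * x ^ (i + (k - m)) = of_int u + of_int v * x"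
          using less by blast
        moreover obtain c where "coeff p i = of_int c" using p(2) by (meson Ints_cases)
        ultimately have "coeff p i * (of_int N * x ^ (i + (k - m))) = of_int (c * u) + of_int (c * v) * x"
          by (simp add: algebra_simps)
        then show ?thesis by blast
      qed
      then obtain u v :: "nat \<Rightarrow> int" where
        "\<And>i. i < m \<Longrightarrow> coeff p i * (of_int N * x ^ (i + (k - m))) = of_int (u i) + of_int (v i) * x"
        by metis
      then have "of_int N * x ^ k = of_int (- (\<Sum>i<m. u i)) + of_int (- (\<Sum>i<m. v i)) * x"
        unfolding eq by (simp add: sum.distrib sum_distrib_left algebra_simps)
      then show ?thesis by blast
    qed
  qed
  obtain M :: int where M: "M > 0" "of_int M * t \<in> \<int>" "of_int M * n \<in> \<int>"
    using rats_denominator[of "{t, n}"] by auto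
  obtain Mt Mn where Mt: "of_int M * t = of_int Mt" and Mn: "of_int M * n = of_int Mn"
    using M(2,3) by (auto elim!: Ints_cases)
  have "of_int (M * N\<^sup>2) * n ^ k \<in> \<int>" for k
  proof -
    obtain i j :: int where ij: "of_int N * x ^ k = of_int i + of_int j * x" using comb by blast
    have "of_int (N\<^sup>2) * of_rat n ^ k = (cmod (of_int N * x ^ k))\<^sup>2"
      by (simp add: norm_mult norm_power power_mult_distrib flip: n) (metis mult.commute power_mult)
    also have "\<dots> = (of_int i + of_int j * Re x)\<^sup>2 + (of_int j * Im x)\<^sup>2"
      unfolding ij by (simp add: cmod_power2)
    also have "\<dots> = of_int i ^ 2 + of_int i * of_int j * (2 * Re x) + of_int j ^ 2 * (cmod x)\<^sup>2"
      unfolding cmod_power2[of x] by (simp add: power2_eq_square algebra_simps)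
    also have "\<dots> = of_rat (of_int i ^ 2 + of_int i * of_int j * t + of_int j ^ 2 * n)"
      by (simp add: t n of_rat_add of_rat_mult of_rat_power)
    finally have "of_rat (of_int (N\<^sup>2) * n ^ k) = (of_rat (of_int i ^ 2 + of_int i * of_int j * t + of_int j ^ 2 * n) :: real)"
      by (simp add: of_rat_mult of_rat_power)
    then have "of_int (N\<^sup>2) * n ^ k = of_int i ^ 2 + of_int i * of_int j * t + of_int j ^ 2 * n"
      by (simp only: of_rat_eq_iff)
    then have "of_int (M * N\<^sup>2) * n ^ k = of_int M * (of_int i ^ 2 + of_int i * of_int j * t + of_int j ^ 2 * n)"
      by simp
    also have "\<dots> = of_int M * of_int i ^ 2 + of_int i * of_int j * (of_int M * t) + of_int j ^ 2 * (of_int M * n)"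
      by (simp add: algebra_simps)
    also have "\<dots> = of_int (M * i ^ 2 + i * j * Mt + j ^ 2 * Mn)" unfolding Mt Mn by simp
    finally show ?thesis by simp
  qed
  then have "n \<in> \<int>" using rat_power_bounded_denominator_int[of "M * N\<^sup>2" n] M(1) N(1) by simp
  then show ?thesis unfolding n by (auto elim!: Ints_cases)
qed

lemma algebraic_int_real_int:
  assumes x: "x \<in> K" "algebraic_int x" "x \<in> \<real>"
  shows "x \<in> \<int>"
proof -
  obtain t where "2 * Re x = of_rat t" using K_trace_norm_rat[OF x(1)] by blast
  then have "Re x = of_rat (t / 2)" by (simp add: of_rat_divide)
  moreover have "x = of_real (Re x)" using x(3) by simp
  ultimately have "x = of_rat (t / 2)" by (metis of_real_of_rat_complex)
  then have "x \<in> \<rat>" by simp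
  then show ?thesis using x(2) rational_algebraic_int_is_int by blast
qed

text \<open>The one sum needed before closure of \<open>OK\<close> under addition is known: it turns
  integrality of norms into integrality of the trace.\<close>

lemma algebraic_int_shift:
  assumes "algebraic_int (x :: complex)"
  shows "algebraic_int (x + 1)"
proof -
  obtain p where p: "\<forall>i. coeff p i \<in> \<int>" "lead_coeff p = 1" "poly p x = 0"
    using assms by (rule algebraic_int.cases) blast
  define q where "q = pcompose p [:-1, 1:]"
  have "poly q (x + 1) = 0" by (simp add: q_def poly_pcompose p(3))
  moreover have "lead_coeff q = 1" unfolding q_def by (subst lead_coeff_comp) (auto simp: p(2))
  moreover have "coeff q i \<in> \<int>" for i
    unfolding q_def by (rule coeff_pcompose_semiring_closed) (auto simp: p(1) coeff_pCons split: nat.splits)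
  ultimately show ?thesis by (intro algebraic_int.intros[of q]) auto
qed

text \<open>The trace is recovered from two norms, as |x + 1|^2 - |x|^2 - 1 = 2 Re x. Conversely,
  integral trace and norm are the coefficients of a monic quadratic polynomial with root
  \<open>x\<close>. The ring structure of \<open>OK\<close> is derived from this criterion.\<close>

lemma OK_iff: "x \<in> OK \<longleftrightarrow> x \<in> K \<and> 2 * Re x \<in> \<int> \<and> (cmod x)\<^sup>2 \<in> \<int>"
proof
  assume "x \<in> OK"
  then have x: "x \<in> K" "algebraic_int x" by (auto simp: ring_of_integers_def)
  show "x \<in> K \<and> 2 * Re x \<in> \<int> \<and> (cmod x)\<^sup>2 \<in> \<int>"
  proof (cases "x \<in> \<real>")
    case True
    then have "x \<in> \<int>" using algebraic_int_real_int x by blast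
    then show ?thesis using x(1) by (auto elim!: Ints_cases)
  next
    case False
    have n: "(cmod x)\<^sup>2 \<in> \<int>" by (rule algebraic_int_norm_int[OF x False])
    have "(cmod (x + 1))\<^sup>2 \<in> \<int>"
      using False by (intro algebraic_int_norm_int algebraic_int_shift K_add K_1 x)
        (simp add: complex_is_Real_iff)
    then have "(cmod (x + 1))\<^sup>2 - (cmod x)\<^sup>2 - 1 \<in> \<int>" using n by auto
    moreover have "(cmod (x + 1))\<^sup>2 - (cmod x)\<^sup>2 - 1 = 2 * Re x"
      unfolding cmod_power2 by (simp add: power2_eq_square algebra_simps)
    ultimately show ?thesis using n x(1) by simp
  qed
next
  assume x: "x \<in> K \<and> 2 * Re x \<in> \<int> \<and> (cmod x)\<^sup>2 \<in> \<int>"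
  then obtain t n where t: "2 * Re x = of_int t" and n: "(cmod x)\<^sup>2 = of_int n"
    by (auto elim!: Ints_cases)
  have "x + cnj x = of_int t" "x * cnj x = of_int n"
    by (metis complex_add_cnj of_real_of_int_eq t) (metis complex_norm_square of_real_of_int_eq n)
  moreover have "x * x = (x + cnj x) * x - x * cnj x" by (simp add: algebra_simps)
  ultimately have "poly [:of_int n, - of_int t, 1:] x = 0" by (simp add: algebra_simps)
  then have "algebraic_int x"
    by (intro algebraic_int.intros[of "[:of_int n, - of_int t, 1:]"])
       (auto simp: coeff_pCons split: nat.splits)
  then show "x \<in> OK" using x by (simp add: ring_of_integers_def)
qed

lemma OK_K: "x \<in> OK \<Longrightarrow> x \<in> K"
  by (simp add: ring_of_integers_def)

lemma OK_real_int: "x \<in> OK \<Longrightarrow> x \<in> \<real> \<Longrightarrow> x \<in> \<int>"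
  using algebraic_int_real_int by (simp add: ring_of_integers_def)

lemma OK_int [simp]: "of_int n \<in> OK"
  by (auto simp: OK_iff K_int)

lemma OK_0 [simp]: "0 \<in> OK" and OK_1 [simp]: "1 \<in> OK"
  using OK_int[of 0] OK_int[of 1] by simp_all

lemma OK_uminus: "x \<in> OK \<Longrightarrow> - x \<in> OK"
  by (auto simp: OK_iff K_uminus)

lemma OK_cnj: "x \<in> OK \<Longrightarrow> cnj x \<in> OK"
  by (auto simp: OK_iff K_cnj)

text \<open>The trace of x times the conjugate of y is \<open>T\<close>, and \<open>T'\<close> is
  the trace of x y. Their sum and product are integral polynomials in the traces and norms of x and
  y, so \<open>T\<close> is a root of a monic integral quadratic; being real and in K, it is an
  integer. This is the cross term in the norm of a sum and the trace of a product.\<close>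

lemma OK_trace_pairing:
  assumes "x \<in> OK" "y \<in> OK"
  shows "2 * Re (x * cnj y) \<in> \<int>"
proof -
  have xK: "x \<in> K" and yK: "y \<in> K" using assms by (auto simp: OK_iff)
  obtain t n where t: "2 * Re x = of_int t" and n: "(cmod x)\<^sup>2 = of_int n"
    using assms(1) by (auto simp: OK_iff elim!: Ints_cases)
  obtain t' n' where t': "2 * Re y = of_int t'" and n': "(cmod y)\<^sup>2 = of_int n'"
    using assms(2) by (auto simp: OK_iff elim!: Ints_cases)
  have xc: "x + cnj x = of_int t" "x * cnj x = of_int n"
    by (metis complex_add_cnj of_real_of_int_eq t) (metis complex_norm_square of_real_of_int_eq n)
  have yc: "y + cnj y = of_int t'" "y * cnj y = of_int n'"
    by (metis complex_add_cnj of_real_of_int_eq t') (metis complex_norm_square of_real_of_int_eq n')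
  define T where "T = x * cnj y + cnj x * y"
  define T' where "T' = x * y + cnj x * cnj y"
  define e where "e = n' * (t\<^sup>2 - 2 * n) + n * (t'\<^sup>2 - 2 * n')"
  have "T + T' = (x + cnj x) * (y + cnj y)" by (simp add: T_def T'_def algebra_simps)
  then have s: "T + T' = of_int (t * t')" by (simp add: xc yc)
  have "T * T' = (y * cnj y) * ((x + cnj x)\<^sup>2 - 2 * (x * cnj x)) + (x * cnj x) * ((y + cnj y)\<^sup>2 - 2 * (y * cnj y))"
    by (simp add: T_def T'_def power2_eq_square algebra_simps)
  then have p: "T * T' = of_int e" by (simp add: xc yc e_def)
  have "T * T = of_int (t * t') * T - of_int e"
    using s p by (metis add_diff_cancel_right' distrib_left mult.commute)
  then have "poly [:of_int e, - of_int (t * t'), 1:] T = 0" by (simp add: algebra_simps)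
  then have "algebraic_int T"
    by (intro algebraic_int.intros[of "[:of_int e, - of_int (t * t'), 1:]"])
       (auto simp: coeff_pCons split: nat.splits)
  moreover have "T \<in> K" unfolding T_def by (intro K_add K_mult K_cnj xK yK)
  moreover have T: "T = of_real (2 * Re (x * cnj y))"
    unfolding T_def by (simp add: complex_eq_iff)
  then have "T \<in> \<real>" by simp
  ultimately have "T \<in> \<int>" using algebraic_int_real_int by blast
  then show ?thesis unfolding T by (metis Ints_cases Ints_of_int of_real_eq_iff of_real_of_int_eq)
qed

lemma OK_add: assumes "x \<in> OK" "y \<in> OK" shows "x + y \<in> OK"
proof -
  have "(cmod (x + y))\<^sup>2 = (cmod x)\<^sup>2 + (cmod y)\<^sup>2 + 2 * Re (x * cnj y)"
    unfolding cmod_power2 by (simp add: power2_eq_square algebra_simps)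
  moreover have "2 * Re (x + y) = 2 * Re x + 2 * Re y" by simp
  ultimately show ?thesis using assms OK_trace_pairing[OF assms]
    unfolding OK_iff by (simp only: K_add Ints_add)
qed

lemma OK_mult: assumes "x \<in> OK" "y \<in> OK" shows "x * y \<in> OK"
proof -
  have "(cmod (x * y))\<^sup>2 = (cmod x)\<^sup>2 * (cmod y)\<^sup>2" by (simp add: norm_mult power_mult_distrib)
  moreover have "2 * Re (x * y) \<in> \<int>" using OK_trace_pairing[OF assms(1) OK_cnj[OF assms(2)]] by simp
  ultimately show ?thesis using assms unfolding OK_iff by (simp only: K_mult Ints_mult)
qed

lemma OK_diff: "x \<in> OK \<Longrightarrow> y \<in> OK \<Longrightarrow> x - y \<in> OK"
  using OK_add[of x "- y"] OK_uminus by simp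

lemma OK_norm_ge_1: assumes "x \<in> OK" "x \<noteq> 0" shows "cmod x \<ge> 1"
proof -
  obtain n where n: "(cmod x)\<^sup>2 = of_int n" using assms(1) by (auto simp: OK_iff elim!: Ints_cases)
  then have "n > 0" using assms(2) by (metis of_int_0_less_iff zero_less_norm_iff zero_less_power)
  then have "1 \<le> (cmod x)\<^sup>2" unfolding n by simp
  then show ?thesis using power2_le_imp_le[of 1 "cmod x"] by simp
qed

text \<open>A bound on |x| leaves finitely many integral traces and norms, and each such pair is
  shared by the roots of one quadratic polynomial.\<close>

lemma OK_bounded_finite: "finite {x \<in> OK. cmod x \<le> B}"
proof -
  define S where "S = {z :: int. \<bar>of_int z\<bar> \<le> 2 * \<bar>B\<bar>} \<times> {z :: int. \<bar>of_int z\<bar> \<le> B\<^sup>2}"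
  have fin: "finite {z :: int. \<bar>of_int z :: real\<bar> \<le> c}" for c
    by (rule finite_subset[of _ "{- \<lceil>c\<rceil> .. \<lceil>c\<rceil>}"]) (auto, linarith+)
  have finr: "finite {x :: complex. 2 * Re x = of_int a \<and> (cmod x)\<^sup>2 = of_int b}" for a b
  proof (rule finite_subset)
    show "{x :: complex. 2 * Re x = of_int a \<and> (cmod x)\<^sup>2 = of_int b} \<subseteq>
      {x. poly [:of_int b, - of_int a, 1:] x = 0}"
    proof (intro subsetI CollectI, elim CollectE conjE)
      fix x :: complex assume t: "2 * Re x = of_int a" and n: "(cmod x)\<^sup>2 = of_int b"
      have "x + cnj x = of_int a" "x * cnj x = of_int b"
        by (metis complex_add_cnj of_real_of_int_eq t) (metis complex_norm_square of_real_of_int_eq n)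
      moreover have "x * x = (x + cnj x) * x - x * cnj x" by (simp add: algebra_simps)
      ultimately show "poly [:of_int b, - of_int a, 1:] x = 0" by (simp add: algebra_simps)
    qed
    show "finite {x :: complex. poly [:of_int b, - of_int a, 1:] x = 0}"
      by (rule poly_roots_finite) simp
  qed
  have "{x \<in> OK. cmod x \<le> B} \<subseteq> (\<Union>(a, b)\<in>S. {x. 2 * Re x = of_int a \<and> (cmod x)\<^sup>2 = of_int b})"
  proof
    fix x assume "x \<in> {x \<in> OK. cmod x \<le> B}"
    then have x: "x \<in> OK" "cmod x \<le> B" by auto
    obtain t n where t: "2 * Re x = of_int t" and n: "(cmod x)\<^sup>2 = of_int n"
      using x(1) by (auto simp: OK_iff elim!: Ints_cases)
    have "\<bar>of_int t\<bar> \<le> 2 * \<bar>B\<bar>" unfolding t[symmetric] using abs_Re_le_cmod[of x] x(2) by linarith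
    moreover have "\<bar>of_int n\<bar> \<le> B\<^sup>2" unfolding n[symmetric] using x(2) by (simp add: power_mono)
    ultimately have "(t, n) \<in> S" by (simp add: S_def)
    then show "x \<in> (\<Union>(a, b)\<in>S. {x. 2 * Re x = of_int a \<and> (cmod x)\<^sup>2 = of_int b})" using t n by blast
  qed
  moreover have "finite (\<Union>(a, b)\<in>S. {x :: complex. 2 * Re x = of_int a \<and> (cmod x)\<^sup>2 = of_int b})"
    using finr fin by (auto simp: S_def)
  ultimately show ?thesis by (rule finite_subset)
qed

lemma OK_nonreal: obtains w where "w \<in> OK" "Im w \<noteq> 0"
proof -
  obtain w where w: "w \<in> K" "w \<notin> \<real>" by (rule K_nonreal)
  obtain t n :: rat where t: "2 * Re w = of_rat t" and n: "(cmod w)\<^sup>2 = of_rat n"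
    using K_trace_norm_rat[OF w(1)] by blast
  obtain N :: int where N: "N > 0" "of_int N * t \<in> \<int>" "of_int N * n \<in> \<int>"
    using rats_denominator[of "{t, n}"] by auto
  obtain a b where a: "of_int N * t = of_int a" and b: "of_int N * n = of_int b"
    using N(2,3) by (auto elim!: Ints_cases)
  have "2 * Re (of_int N * w) = of_rat (of_int N * t)" by (simp add: t[symmetric] of_rat_mult)
  then have 1: "2 * Re (of_int N * w) \<in> \<int>" unfolding a by simp
  have "(cmod (of_int N * w))\<^sup>2 = of_rat (of_int N * (of_int N * n))"
    by (simp add: n[symmetric] of_rat_mult norm_mult power_mult_distrib power2_eq_square)
  then have 2: "(cmod (of_int N * w))\<^sup>2 \<in> \<int>" unfolding b by (simp add: of_rat_mult)
  have "of_int N * w \<in> OK" using 1 2 K_mult[OF K_int w(1)] by (simp add: OK_iff)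
  moreover have "Im (of_int N * w) \<noteq> 0" using w(2) N(1) by (simp add: complex_is_Real_iff)
  ultimately show thesis by (rule that)
qed

text \<open>Taking imaginary parts maps \<open>OK\<close> onto a subgroup of the reals with kernel
  Z. It is discrete with gap 1/2, because \<open>x - cnj x\<close> is an integer of K of modulus 2
  |Im x|, hence of modulus at least 1 if nonzero.\<close>

lemma OK_basis:
  obtains w where "w \<in> OK" "Im w \<noteq> 0" "OK = {of_int m * 1 + of_int n * w | m n. True}"
proof -
  define T where "T = Im ` OK"
  have "0 \<in> T" unfolding T_def by (rule image_eqI[of _ _ 0]) auto
  moreover have "x - y \<in> T" if "x \<in> T" "y \<in> T" for x y
    using that OK_diff unfolding T_def by (force simp flip: minus_complex.simps(2))
  moreover have "1 / 2 \<le> \<bar>y\<bar>" if y: "y \<in> T" "y \<noteq> 0" for y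
  proof -
    obtain x where x: "x \<in> OK" "y = Im x" using y(1) by (auto simp: T_def)
    have s: "x - cnj x \<in> OK" using x(1) by (intro OK_diff OK_cnj)
    have "x - cnj x \<noteq> 0" using x y by (auto simp: complex_eq_iff)
    then have "1 \<le> cmod (x - cnj x)" using OK_norm_ge_1[OF s] by simp
    then show ?thesis by (simp add: x(2) complex_diff_cnj norm_mult)
  qed
  ultimately obtain t where t: "t \<in> T" "T = {of_int k * t | k. True}"
    using discrete_subgroup_real_cyclic[of T "1/2"] by force
  obtain w where w: "w \<in> OK" "t = Im w" using t(1) by (auto simp: T_def)
  have "Im w \<noteq> 0"
  proof
    assume "Im w = 0"
    then have "T = {0}" using t w(2) by auto
    moreover obtain u where "u \<in> OK" "Im u \<noteq> 0" by (rule OK_nonreal)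
    ultimately show False by (auto simp: T_def)
  qed
  moreover have "OK = {of_int m * 1 + of_int n * w | m n. True}"
  proof (intro Set.set_eqI iffI)
    fix x assume x: "x \<in> OK"
    then have "Im x \<in> T" by (auto simp: T_def)
    then obtain k where k: "Im x = of_int k * Im w" using t(2) w(2) by auto
    have "x - of_int k * w \<in> OK" using x w(1) by (intro OK_diff OK_mult) auto
    moreover have "x - of_int k * w \<in> \<real>" using k by (simp add: complex_is_Real_iff)
    ultimately have "x - of_int k * w \<in> \<int>" by (rule OK_real_int)
    then obtain m where "x - of_int k * w = of_int m" by (auto elim: Ints_cases)
    then have "x = of_int m * 1 + of_int k * w" by (simp add: algebra_simps)
    then show "x \<in> {of_int m * 1 + of_int n * w | m n. True}" by blast
  next
    fix x assume "x \<in> {of_int m * 1 + of_int n * w | m n. True}"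
    then show "x \<in> OK" using w(1) by (auto intro!: OK_add OK_mult)
  qed
  ultimately show thesis using that w(1) by blast
qed

text \<open>Well-definedness of the description in \<open>field_disc\<close>: the two bases are
  related by integral matrices of determinants p and q with q p = 1, and squaring removes the
  sign.\<close>

lemma basis_disc_unique:
  assumes v: "OK = {of_int m * v1 + of_int n * v2 | m n. True}"
    and w: "OK = {of_int m * w1 + of_int n * w2 | m n. True}"
    and nz: "w1 * cnj w2 - w2 * cnj w1 \<noteq> 0"
  shows "(v1 * cnj v2 - v2 * cnj v1)\<^sup>2 = (w1 * cnj w2 - w2 * cnj w1)\<^sup>2"
proof -
  have mem: "x1 \<in> OK \<and> x2 \<in> OK" if "OK = {of_int m * x1 + of_int n * x2 | m n. True}" for x1 x2
  proof -
    have "x1 = of_int 1 * x1 + of_int 0 * x2" "x2 = of_int 0 * x1 + of_int 1 * x2" by simp_all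
    then show ?thesis using that by blast
  qed
  have ex: "\<exists>a b c e :: int. x1 = of_int a * y1 + of_int b * y2 \<and> x2 = of_int c * y1 + of_int e * y2"
    if "OK = {of_int m * x1 + of_int n * x2 | m n. True}" "OK = {of_int m * y1 + of_int n * y2 | m n. True}"
    for x1 x2 y1 y2
    using mem[OF that(1)] that(2) by blast
  have dt: "x1 * cnj x2 - x2 * cnj x1 = of_int (a * e - b * c) * (y1 * cnj y2 - y2 * cnj y1)"
    if "x1 = of_int a * y1 + of_int b * y2" "x2 = of_int c * y1 + of_int e * y2" for x1 x2 y1 y2 and a b c e :: int
    unfolding that by (simp add: algebra_simps)
  obtain p :: int where p: "v1 * cnj v2 - v2 * cnj v1 = of_int p * (w1 * cnj w2 - w2 * cnj w1)"
    using ex[OF v w] dt by blast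
  obtain q :: int where q: "w1 * cnj w2 - w2 * cnj w1 = of_int q * (v1 * cnj v2 - v2 * cnj v1)"
    using ex[OF w v] dt by blast
  have "of_int (q * p) * (w1 * cnj w2 - w2 * cnj w1) = 1 * (w1 * cnj w2 - w2 * cnj w1)"
    using p q by (metis mult.assoc mult_1 of_int_mult)
  then have "of_int (q * p) = (1 :: complex)" using nz by (metis mult_right_cancel)
  then have "q * p = 1" by (simp only: of_int_eq_1_iff)
  then have "p\<^sup>2 = 1" by (metis dvd_triv_right power2_eq_1_iff zdvd1_eq abs_eq_iff abs_one)
  then show ?thesis unfolding p by (simp add: power_mult_distrib flip: of_int_power)
qed

text \<open>With basis 1, w the root is s = cnj w - w. The last clause is the identity 2 d x = d (x
  + cnj x) + ((x - cnj x) s) s, in which both coefficients are integers. It measures how far Z + Z s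
  is from \<open>OK\<close> and is the source of the factor 2 d in the congruence modulus.\<close>

lemma sqrt_field_disc:
  obtains s where "s \<in> OK" "Re s = 0" "s\<^sup>2 = of_int (field_disc K)" "field_disc K < 0"
    "\<And>x. x \<in> OK \<Longrightarrow> \<exists>a b. of_int (2 * field_disc K) * x = of_int a + of_int b * s"
proof -
  obtain w where w: "w \<in> OK" "Im w \<noteq> 0" "OK = {of_int m * 1 + of_int n * w | m n. True}"
    by (rule OK_basis)
  define s where "s = 1 * cnj w - w * cnj 1"
  have s: "s \<in> OK" unfolding s_def using w(1) by (intro OK_diff OK_mult OK_cnj) auto
  have re: "Re s = 0" and im: "Im s \<noteq> 0" using w(2) by (simp_all add: s_def)
  have ss: "s\<^sup>2 = of_real (- ((Im s)\<^sup>2))" using re by (simp add: complex_eq_iff power2_eq_square)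
  have "s\<^sup>2 \<in> OK" unfolding power2_eq_square by (rule OK_mult[OF s s])
  moreover have "s\<^sup>2 \<in> \<real>" unfolding ss by simp
  ultimately have "s\<^sup>2 \<in> \<int>" by (rule OK_real_int)
  then obtain d where d: "s\<^sup>2 = of_int d" by (auto elim: Ints_cases)
  have fd: "field_disc K = d"
    unfolding field_disc_def
  proof (rule the_equality)
    show "\<exists>w1 w2. OK = {of_int m * w1 + of_int n * w2 | m n. True} \<and>
      of_int d = (w1 * cnj w2 - w2 * cnj w1)\<^sup>2"
      using w(3) d unfolding s_def by metis
  next
    fix d' assume "\<exists>w1 w2. OK = {of_int m * w1 + of_int n * w2 | m n. True} \<and>
      of_int d' = (w1 * cnj w2 - w2 * cnj w1)\<^sup>2"
    then obtain w1 w2 where "OK = {of_int m * w1 + of_int n * w2 | m n. True}"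
      "of_int d' = (w1 * cnj w2 - w2 * cnj w1)\<^sup>2" by blast
    moreover have "1 * cnj w - w * cnj 1 \<noteq> 0" using im unfolding s_def by (metis zero_complex.simps(2))
    ultimately have "of_int d' = s\<^sup>2" using basis_disc_unique[OF _ w(3)] unfolding s_def by metis
    then show "d' = d" using d by simp
  qed
  have "real_of_int d = - ((Im s)\<^sup>2)" using d ss by (metis of_real_eq_iff of_real_of_int_eq)
  then have "d < 0" using im by (metis neg_less_0_iff_less of_int_less_0_iff zero_less_power2)
  moreover have "\<exists>a b. of_int (2 * d) * x = of_int a + of_int b * s" if x: "x \<in> OK" for x
  proof -
    obtain t where t: "2 * Re x = of_int t" using x by (auto simp: OK_iff elim!: Ints_cases)
    have xc: "x + cnj x = of_int t" by (metis complex_add_cnj of_real_of_int_eq t)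
    have "(x - cnj x) * s \<in> OK" using x s by (intro OK_mult OK_diff OK_cnj)
    moreover have "(x - cnj x) * s \<in> \<real>" using re by (simp add: complex_is_Real_iff)
    ultimately have "(x - cnj x) * s \<in> \<int>" by (rule OK_real_int)
    then obtain b where b: "(x - cnj x) * s = of_int b" by (auto elim: Ints_cases)
    have "of_int (2 * d) * x = of_int d * (x + cnj x) + (x - cnj x) * s\<^sup>2"
      unfolding d by (simp add: algebra_simps)
    also have "\<dots> = of_int (d * t) + of_int b * s"
      unfolding xc b[symmetric] by (simp add: power2_eq_square)
    finally show ?thesis by blast
  qed
  ultimately show thesis using that[of s] s re d unfolding fd by blast
qed

end

section \<open>The special unitary group\<close>

definition hip :: "complex^3 \<Rightarrow> complex^3 \<Rightarrow> complex" where
  "hip x y = - x $ 1 * cnj (y $ 3) - x $ 3 * cnj (y $ 1) + x $ 2 * cnj (y $ 2)"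

lemma herm_eq_Re_hip: "herm x = Re (hip x x)"
  by (simp add: herm_def hip_def cmod_power2) (simp add: power2_eq_square)

lemma hip_self: "hip x x = of_real (herm x)"
  unfolding herm_eq_Re_hip by (simp add: complex_eq_iff hip_def)

lemma hip_commute: "hip y x = cnj (hip x y)"
  by (simp add: hip_def)

lemma hip_add_left: "hip (x + y) a = hip x a + hip y a"
  and hip_add_right: "hip a (x + y) = hip a x + hip a y"
  and hip_diff_left: "hip (x - y) a = hip x a - hip y a"
  and hip_diff_right: "hip a (x - y) = hip a x - hip a y"
  and hip_scale_left: "hip (c *s x) a = c * hip x a"
  and hip_scale_right: "hip a (c *s x) = cnj c * hip a x"
  by (simp_all add: hip_def algebra_simps)

lemmas hip_linear = hip_add_left hip_add_right hip_diff_left hip_diff_right hip_scale_left hip_scale_right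

lemma hip_zero [simp]: "hip 0 a = 0" "hip a 0 = 0"
  by (simp_all add: hip_def)

lemma herm_scale: "herm (c *s x) = (cmod c)\<^sup>2 * herm x"
proof -
  have "of_real (herm (c *s x)) = (of_real ((cmod c)\<^sup>2 * herm x) :: complex)"
    unfolding of_real_mult hip_self[symmetric]
    by (simp add: hip_linear complex_norm_square del: of_real_power)
  then show ?thesis by (simp only: of_real_eq_iff)
qed

lemma hip_nondegenerate: assumes "\<And>x. hip x a = hip x b" shows "a = b"
proof -
  have "hip (axis i 1) a = hip (axis i 1) b" for i by (rule assms)
  from this[of 1] this[of 2] this[of 3] show ?thesis
    by (simp add: hip_def axis_def vec_eq_iff forall_3)
qed

lemma hip_polarization:
  "4 * hip x y = of_real (herm (x + y)) - of_real (herm (x - y))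
     + \<i> * of_real (herm (x + \<i> *s y)) - \<i> * of_real (herm (x - \<i> *s y))"
  unfolding hip_self[symmetric] by (simp add: hip_linear algebra_simps)

text \<open>The adjoint for \<open>hip\<close>: the conjugate transpose of g, multiplied on both
  sides by the antidiagonal Gram matrix with entries -1, 1, -1. It serves as an explicit inverse on
  \<open>SUh\<close> that visibly preserves integrality.\<close>

definition hadj :: "complex^3^3 \<Rightarrow> complex^3^3" where
  "hadj g = vector [vector [cnj (g $ 3 $ 3), - cnj (g $ 2 $ 3), cnj (g $ 1 $ 3)],
                    vector [- cnj (g $ 3 $ 2), cnj (g $ 2 $ 2), - cnj (g $ 1 $ 2)],
                    vector [cnj (g $ 3 $ 1), - cnj (g $ 2 $ 1), cnj (g $ 1 $ 1)]]"

lemma hip_hadj: "hip (g *v x) y = hip x (hadj g *v y)"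
  by (simp add: hip_def hadj_def matrix_vector_mult_def sum_3 algebra_simps)

lemma hadj_hadj [simp]: "hadj (hadj g) = g"
  by (simp add: hadj_def vec_eq_iff forall_3)

lemma hadj_mult: "hadj (A ** B) = hadj B ** hadj A"
proof -
  have "hadj (A ** B) *v y = (hadj B ** hadj A) *v y" for y
    by (rule hip_nondegenerate) (metis hip_hadj matrix_vector_mul_assoc)
  then show ?thesis by (simp add: matrix_eq)
qed

lemma det_hadj: "det (hadj g) = cnj (det g)"
  by (simp add: det_3 hadj_def algebra_simps)

lemma hadj_mat: "hadj (mat c) = mat (cnj c)"
  by (simp add: hadj_def vec_eq_iff forall_3 mat_def)

text \<open>Polarisation upgrades invariance of \<open>herm\<close> to invariance of
  \<open>hip\<close>, which nondegeneracy turns into a matrix identity.\<close>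

lemma SUh_iff: "g \<in> carrier SUh \<longleftrightarrow> det g = 1 \<and> hadj g ** g = mat 1"
proof
  assume "g \<in> carrier SUh"
  then have det: "det g = 1" and h: "\<And>z. herm (g *v z) = herm z" by (auto simp: SUh_def)
  have hip: "hip (g *v x) (g *v y) = hip x y" for x y
  proof -
    have "4 * hip (g *v x) (g *v y) = 4 * hip x y"
      unfolding hip_polarization
      by (simp add: h flip: matrix_vector_right_distrib matrix_vector_mult_diff_distrib vector_scalar_commute)
    then show ?thesis by simp
  qed
  have "(hadj g ** g) *v y = mat 1 *v y" for y
    by (rule hip_nondegenerate) (metis hip hip_hadj matrix_vector_mul_assoc matrix_vector_mul_lid)
  then show "det g = 1 \<and> hadj g ** g = mat 1" using det by (simp add: matrix_eq)
next
  assume *: "det g = 1 \<and> hadj g ** g = mat 1"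
  then have "hip (g *v x) (g *v x) = hip x x" for x
    by (simp add: hip_hadj matrix_vector_mul_assoc)
  then show "g \<in> carrier SUh" using * by (simp add: SUh_def herm_eq_Re_hip)
qed

lemma SUh_det: "g \<in> carrier SUh \<Longrightarrow> det g = 1"
  and SUh_hadj_mult: "g \<in> carrier SUh \<Longrightarrow> hadj g ** g = mat 1"
  by (simp_all add: SUh_iff)

lemma SUh_mult_hadj: "g \<in> carrier SUh \<Longrightarrow> g ** hadj g = mat 1"
  using matrix_left_right_inverse SUh_hadj_mult by blast

lemma SUh_hip: "g \<in> carrier SUh \<Longrightarrow> hip (g *v x) (g *v y) = hip x y"
  by (simp add: hip_hadj matrix_vector_mul_assoc SUh_hadj_mult)

lemma SUh_hadj: "g \<in> carrier SUh \<Longrightarrow> hadj g \<in> carrier SUh"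
  by (simp add: SUh_iff[of "hadj g"] SUh_mult_hadj det_hadj SUh_det)

lemma mult_SUh [simp]: "x \<otimes>\<^bsub>SUh\<^esub> y = x ** y" and one_SUh [simp]: "\<one>\<^bsub>SUh\<^esub> = mat 1"
  by (simp_all add: SUh_def)

lemma SUh_mult: "g \<in> carrier SUh \<Longrightarrow> h \<in> carrier SUh \<Longrightarrow> g ** h \<in> carrier SUh"
  unfolding SUh_iff hadj_mult det_mul by (metis matrix_mul_assoc matrix_mul_lid mult_1)

lemma SUh_one: "mat 1 \<in> carrier SUh"
  by (simp add: SUh_iff hadj_mat)

lemma group_SUh: "group SUh"
  by (rule groupI) (auto simp: SUh_one SUh_mult matrix_mul_assoc intro: SUh_hadj SUh_hadj_mult bexI[of _ "hadj _"])

interpretation SUh: group SUh by (rule group_SUh)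

lemma inv_SUh: "g \<in> carrier SUh \<Longrightarrow> inv\<^bsub>SUh\<^esub> g = hadj g"
  by (rule SUh.inv_equality) (auto simp: SUh_hadj SUh_hadj_mult)

lemma matrix_mult_mat_scalar:
  fixes A :: "complex^3^3"
  shows "mat c ** A = (\<chi> i j. c * A $ i $ j)" "A ** mat c = (\<chi> i j. c * A $ i $ j)"
  by (simp_all add: vec_eq_iff forall_3 matrix_matrix_mult_def sum_3 mat_def mult.commute)

lemma mat_commute: "mat c ** A = A ** mat (c :: complex)" for A :: "complex^3^3"
  by (simp add: matrix_mult_mat_scalar)

lemma mat_mult_vec: "mat c *v (x :: complex^3) = c *s x"
  by (simp add: vec_eq_iff forall_3 matrix_vector_mult_def sum_3 mat_def)

lemma mat_mult_mat: "mat a ** mat b = (mat (a * b) :: complex^3^3)"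
  by (simp add: vec_eq_iff forall_3 matrix_matrix_mult_def sum_3 mat_def)

lemma cube_root_unity_cnj: assumes "w ^ 3 = (1 :: complex)" shows "w * cnj w = 1"
proof -
  have "cmod w ^ 3 = 1" using assms by (metis norm_one norm_power)
  then have "cmod w = 1" using power_eq_imp_eq_base[of "cmod w" 3 1] by simp
  then show ?thesis using complex_norm_square[of w] by simp
qed

lemma det_mat_3: "det (mat w :: complex^3^3) = w ^ 3"
  by (simp add: det_3 mat_def power3_eq_cube)

lemma U3_SUh: "mat w \<in> carrier SUh" if "w ^ 3 = 1"
  using cube_root_unity_cnj[OF that] that
  by (simp add: SUh_iff hadj_mat mat_mult_mat mult.commute det_mat_3)

lemma normal_U3: "U3 \<lhd> SUh"
proof (rule SUh.normalI)
  show "subgroup U3 SUh"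
  proof (rule SUh.subgroupI)
    show "U3 \<subseteq> carrier SUh" using U3_SUh by (auto simp: U3_def)
    show "U3 \<noteq> {}" by (auto simp: U3_def intro: exI[of _ 1])
  next
    fix a assume "a \<in> U3"
    then obtain w where "a = mat w" "w ^ 3 = 1" by (auto simp: U3_def)
    then show "inv\<^bsub>SUh\<^esub> a \<in> U3" using U3_SUh
      by (auto simp: inv_SUh hadj_mat U3_def intro!: exI[of _ "cnj w"] simp flip: complex_cnj_power)
  next
    fix a b assume "a \<in> U3" "b \<in> U3"
    then show "a \<otimes>\<^bsub>SUh\<^esub> b \<in> U3" by (auto simp: U3_def mat_mult_mat power_mult_distrib)
  qed
  show "\<forall>x\<in>carrier SUh. U3 #>\<^bsub>SUh\<^esub> x = x <#\<^bsub>SUh\<^esub> U3"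
    by (auto simp: r_coset_def l_coset_def U3_def matrix_mult_mat_scalar)
qed

interpretation U3: normal U3 SUh by (rule normal_U3)

lemma group_PSUh: "group PSUh"
  unfolding PSUh_def by (rule U3.factorgroup_is_group)

interpretation PSUh: group PSUh by (rule group_PSUh)

lemma carrier_PSUh: "carrier PSUh = proj_PSUh ` carrier SUh"
  by (auto simp: PSUh_def FactGroup_def RCOSETS_def proj_PSUh_def)

lemma proj_hom: "proj_PSUh \<in> hom SUh PSUh"
  using U3.r_coset_hom_Mod unfolding PSUh_def proj_PSUh_def by simp

interpretation proj: group_hom SUh PSUh proj_PSUh
  by unfold_locales (rule proj_hom)

lemma proj_mult: "g \<in> carrier SUh \<Longrightarrow> h \<in> carrier SUh \<Longrightarrow> proj_PSUh (g ** h) = proj_PSUh g \<otimes>\<^bsub>PSUh\<^esub> proj_PSUh h"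
  using proj.hom_mult by simp

lemma proj_inv: "g \<in> carrier SUh \<Longrightarrow> inv\<^bsub>PSUh\<^esub> (proj_PSUh g) = proj_PSUh (hadj g)"
  using proj.hom_inv by (simp add: inv_SUh)

lemma proj_one: "proj_PSUh (mat 1) = \<one>\<^bsub>PSUh\<^esub>"
  using proj.hom_one by simp

lemma mem_proj_iff: "h \<in> proj_PSUh g \<longleftrightarrow> (\<exists>w. w ^ 3 = 1 \<and> h = mat w ** g)"
  by (auto simp: proj_PSUh_def r_coset_def U3_def)

lemma self_mem_proj: "g \<in> proj_PSUh g"
  unfolding mem_proj_iff by (intro exI[of _ 1]) simp

lemma proj_eqD:
  assumes "proj_PSUh g = proj_PSUh h"
  obtains w where "w ^ 3 = 1" "g = mat w ** h"
  using assms self_mem_proj[of g] mem_proj_iff by auto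

lemma proj_scale:
  assumes "w ^ 3 = 1" shows "proj_PSUh (mat w ** g) = proj_PSUh g"
proof -
  have "h \<in> proj_PSUh (mat w ** g) \<longleftrightarrow> h \<in> proj_PSUh g" for h
  proof
    assume "h \<in> proj_PSUh (mat w ** g)"
    then obtain v where "v ^ 3 = 1" "h = mat v ** (mat w ** g)" by (auto simp: mem_proj_iff)
    then show "h \<in> proj_PSUh g" unfolding mem_proj_iff using assms
      by (intro exI[of _ "v * w"]) (simp add: matrix_mul_assoc mat_mult_mat power_mult_distrib)
  next
    assume "h \<in> proj_PSUh g"
    then obtain v where v: "v ^ 3 = 1" "h = mat v ** g" by (auto simp: mem_proj_iff)
    have "v * cnj w * w = v" using cube_root_unity_cnj[OF assms] by (metis mult.assoc mult.commute mult.right_neutral)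
    then show "h \<in> proj_PSUh (mat w ** g)" unfolding mem_proj_iff using v assms
      by (intro exI[of _ "v * cnj w"])
         (simp only: matrix_mul_assoc mat_mult_mat power_mult_distrib complex_cnj_power[symmetric], simp)
  qed
  then show ?thesis by blast
qed

lemma subgroup_proj_image: "subgroup S SUh \<Longrightarrow> subgroup (proj_PSUh ` S) PSUh"
  by (rule proj.subgroup_img_is_subgroup)

section \<open>Orthogonal frames\<close>

text \<open>The usual cross product, conjugated and multiplied by the Gram matrix of
  \<open>hip\<close>, so that \<open>hip a (hcross x y)\<close> is the determinant of a, x, y. No
  division occurs, which keeps integral vectors integral.\<close>

definition hcross :: "complex^3 \<Rightarrow> complex^3 \<Rightarrow> complex^3" where
  "hcross x y = vector [- cnj (x $ 1 * y $ 2 - x $ 2 * y $ 1), cnj (x $ 3 * y $ 1 - x $ 1 * y $ 3),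
     - cnj (x $ 2 * y $ 3 - x $ 3 * y $ 2)]"

lemma hip_hcross_self: "hip x (hcross x y) = 0" "hip y (hcross x y) = 0"
  by (simp_all add: hip_def hcross_def algebra_simps)

lemma hip_hcross_self': "hip (hcross x y) x = 0" "hip (hcross x y) y = 0"
  by (metis hip_commute hip_hcross_self(1) complex_cnj_zero) (metis hip_commute hip_hcross_self(2) complex_cnj_zero)

text \<open>Lagrange's identity with the opposite sign, because the Gram matrix of
  \<open>hip\<close> has determinant -1. This is why the third frame vector is negative when the two
  others are positive.\<close>

lemma hip_hcross_hcross:
  "hip (hcross x y) (hcross x y) = hip x y * hip y x - hip x x * hip y y"
  by (simp add: hip_def hcross_def algebra_simps)

definition mat_cols :: "complex^3 \<Rightarrow> complex^3 \<Rightarrow> complex^3 \<Rightarrow> complex^3^3" where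
  "mat_cols a b c = (\<chi> i. vector [a $ i, b $ i, c $ i])"

lemma mat_cols_mult_vec: "mat_cols a b c *v x = x $ 1 *s a + x $ 2 *s b + x $ 3 *s c"
  by (simp add: mat_cols_def vec_eq_iff matrix_vector_mult_def sum_3 mult.commute)

lemma det_mat_cols: "det (mat_cols a b c) = hip a (hcross b c)"
  by (simp add: det_3 mat_cols_def hip_def hcross_def algebra_simps)

lemma hip_hcross_rotate: "hip b (hcross c a) = hip a (hcross b c)"
  by (simp add: hip_def hcross_def algebra_simps)

text \<open>As a row vector it represents the functional \<open>\<lambda>y. hip y a\<close>.\<close>

definition hdual :: "complex^3 \<Rightarrow> complex^3" where
  "hdual a = vector [- cnj (a $ 3), cnj (a $ 2), - cnj (a $ 1)]"

definition frame_mat :: "complex^3 \<Rightarrow> complex^3 \<Rightarrow> complex^3^3" where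
  "frame_mat z u = mat_cols u (hcross z u) z"

text \<open>The inverse of \<open>frame_mat\<close> cleared of denominators: coordinates in an
  orthogonal basis are the quotients hip y e / hip e e, here multiplied by
  \<open>herm z * herm u\<close>. The minus sign comes from the negative norm of
  \<open>hcross z u\<close>.\<close>

definition frame_dual :: "complex^3 \<Rightarrow> complex^3 \<Rightarrow> complex^3^3" where
  "frame_dual z u = vector [hip z z *s hdual u, - hdual (hcross z u), hip u u *s hdual z]"

lemma frame_dual_mult_vec:
  "frame_dual z u *v y = vector [hip z z * hip y u, - hip y (hcross z u), hip u u * hip y z]"
  by (simp add: frame_dual_def hdual_def vec_eq_iff forall_3 matrix_vector_mult_def sum_3 hip_def
      algebra_simps)

text \<open>Coordinates in the frame u, w, z of a basis with the same Gram matrix as the standard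
  one. The vectors u and w are scaled to norms 1/2 and -1/2; w + u and w - u, so scaled, are
  isotropic with product -1, and z is scaled to norm 1. All irrationality of
  \<open>frame_iso\<close> for integral u and z is confined to this factor.\<close>

definition frame_trans :: "real \<Rightarrow> real \<Rightarrow> complex^3^3" where
  "frame_trans D c = vector [vector [of_real (1 / sqrt (2 * c)), 0, - of_real (1 / sqrt (2 * c))],
     vector [of_real (1 / sqrt (2 * D * c)), 0, of_real (1 / sqrt (2 * D * c))],
     vector [0, of_real (1 / sqrt D), 0]]"

definition frame_iso :: "complex^3 \<Rightarrow> complex^3 \<Rightarrow> complex^3^3" where
  "frame_iso z u = frame_mat z u ** frame_trans (herm z) (herm u)"

lemma matrix_eqI3:
  assumes "\<And>i. A *v axis i 1 = B *v axis i 1"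
  shows "A = (B :: complex^3^3)"
  using assms[of 1] assms[of 2] assms[of 3]
  by (simp add: vec_eq_iff forall_3 matrix_vector_mult_def sum_3 axis_def)

context
  fixes z u :: "complex^3"
  assumes orth: "hip u z = 0" and z_pos: "herm z > 0" and u_pos: "herm u > 0"
begin

lemma orth': "hip z u = 0"
  using orth hip_commute[of z u] by simp

lemma herm_w: "herm (hcross z u) = - (herm z * herm u)"
proof -
  have "hip (hcross z u) (hcross z u) = - of_real (herm z * herm u)"
    unfolding hip_hcross_hcross orth orth' by (simp add: hip_self)
  then show ?thesis unfolding herm_eq_Re_hip[of "hcross z u"] by simp
qed

lemma frame_dual_frame_mat: "frame_dual z u ** frame_mat z u = mat (of_real (herm z * herm u))"
proof (rule matrix_eqI3)
  fix i :: 3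
  show "(frame_dual z u ** frame_mat z u) *v axis i 1 = mat (of_real (herm z * herm u)) *v axis i 1"
    using exhaust_3[of i]
    by (auto simp: matrix_vector_mul_assoc[symmetric] frame_mat_def mat_cols_mult_vec frame_dual_mult_vec
        mat_mult_vec vec_eq_iff forall_3 axis_def hip_linear orth orth' herm_w hip_hcross_self hip_hcross_self'
        hip_self)
qed

lemma frame_mat_frame_dual: "frame_mat z u ** frame_dual z u = mat (of_real (herm z * herm u))"
proof -
  let ?k = "of_real (1 / (herm z * herm u)) :: complex"
  have k: "?k * of_real (herm z * herm u) = 1" using z_pos u_pos by (simp flip: of_real_mult)
  have "(mat ?k ** frame_dual z u) ** frame_mat z u = mat 1"
    by (simp only: matrix_mul_assoc[symmetric] frame_dual_frame_mat mat_mult_mat k)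
  then have *: "frame_mat z u ** (mat ?k ** frame_dual z u) = mat 1"
    using matrix_left_right_inverse by blast
  have "frame_mat z u ** frame_dual z u = mat (of_real (herm z * herm u) * ?k) ** (frame_mat z u ** frame_dual z u)"
    using k by (simp add: mult.commute)
  also have "\<dots> = mat (of_real (herm z * herm u)) ** (frame_mat z u ** (mat ?k ** frame_dual z u))"
    by (metis mat_mult_mat mat_commute matrix_mul_assoc)
  finally show ?thesis by (simp only: * matrix_mul_rid)
qed

lemma frame_iso_SUh: "frame_iso z u \<in> carrier SUh"
proof -
  let ?a = "1 / sqrt (2 * herm u)" and ?b = "1 / sqrt (2 * herm z * herm u)" and ?d = "1 / sqrt (herm z)"
  define a b d where "a = ?a" and "b = ?b" and "d = ?d"
  have a: "a * a * herm u = 1 / 2" and b: "b * b * (herm z * herm u) = 1 / 2" and d: "d * d * herm z = 1"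
    using z_pos u_pos by (simp_all add: a_def b_def d_def)
  \<comment> \<open>This normalises the determinant, which is the product of -2 a b d from
    \<open>frame_trans\<close> and \<open>- (herm z * herm u)\<close>, the norm of
    \<open>hcross z u\<close>, from \<open>frame_mat\<close>.\<close>
  have abd: "2 * a * b * d * (herm z * herm u) = 1"
  proof -
    have "2 * herm u * (2 * herm z * herm u) * herm z = (2 * (herm z * herm u))\<^sup>2" by (simp add: power2_eq_square)
    then have "sqrt (2 * herm u) * sqrt (2 * herm z * herm u) * sqrt (herm z) = 2 * (herm z * herm u)"
      unfolding real_sqrt_mult[symmetric] using z_pos u_pos by (simp only: real_sqrt_abs) simp
    then show ?thesis using z_pos u_pos by (simp add: a_def b_def d_def field_simps)
  qed
  define f1 f3 where "f1 = of_real a *s u + of_real b *s hcross z u" and "f3 = of_real b *s hcross z u - of_real a *s u"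
  define z' where "z' = of_real d *s z"
  have iso: "frame_iso z u = mat_cols f1 z' f3"
    unfolding frame_iso_def frame_mat_def frame_trans_def a_def[symmetric] b_def[symmetric] d_def[symmetric]
    by (simp add: vec_eq_iff forall_3 matrix_matrix_mult_def sum_3 mat_cols_def f1_def f3_def z'_def)
  have ca: "of_real a * (of_real a * of_real (herm u)) = (1/2 :: complex)"
    "of_real b * (of_real b * (of_real (herm z) * of_real (herm u))) = (1/2 :: complex)"
    "of_real d * (of_real d * of_real (herm z)) = (1 :: complex)"
    using arg_cong[OF a, of complex_of_real] arg_cong[OF b, of complex_of_real] arg_cong[OF d, of complex_of_real]
    by (simp_all add: mult.assoc)
  have t: "hip u u = of_real (herm u)" "hip (hcross z u) (hcross z u) = - (of_real (herm z) * of_real (herm u))" "hip z z = of_real (herm z)"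
    "hip u (hcross z u) = 0" "hip (hcross z u) u = 0" "hip z (hcross z u) = 0" "hip (hcross z u) z = 0"
    by (simp_all add: hip_self herm_w hip_hcross_self hip_hcross_self')
  have "hip f1 f1 = of_real a * (of_real a * of_real (herm u)) - of_real b * (of_real b * (of_real (herm z) * of_real (herm u)))"
    "hip f1 f3 = - (of_real a * (of_real a * of_real (herm u))) - of_real b * (of_real b * (of_real (herm z) * of_real (herm u)))"
    "hip f3 f3 = of_real a * (of_real a * of_real (herm u)) - of_real b * (of_real b * (of_real (herm z) * of_real (herm u)))"
    "hip z' z' = of_real d * (of_real d * of_real (herm z))"
    "hip f1 z' = 0" "hip z' f3 = 0"
    unfolding f1_def f3_def z'_def hip_linear t orth orth' by simp_all
  then have h: "hip f1 f1 = 0" "hip f1 z' = 0" "hip f1 f3 = -1" "hip z' z' = 1" "hip z' f3 = 0" "hip f3 f3 = 0"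
    unfolding ca by simp_all
  have h': "hip z' f1 = 0" "hip f3 f1 = -1" "hip f3 z' = 0"
    using h hip_commute[of z' f1] hip_commute[of f3 f1] hip_commute[of f3 z'] by simp_all
  have "hip (frame_iso z u *v x) (frame_iso z u *v y) = hip x y" for x y
    unfolding iso mat_cols_mult_vec by (simp add: hip_linear h h' hip_def[of x y] algebra_simps)
  then have "herm (frame_iso z u *v x) = herm x" for x by (simp add: herm_eq_Re_hip)
  moreover have "det (frame_iso z u) = 1"
  proof -
    have "det (frame_mat z u) = - of_real (herm z * herm u)"
      unfolding frame_mat_def det_mat_cols using hip_hcross_rotate[of "hcross z u" z u] hip_hcross_rotate[of u "hcross z u" z] by (simp add: hip_self herm_w)
    moreover have "det (frame_trans (herm z) (herm u)) = - of_real (2 * a * b * d)"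
      unfolding frame_trans_def a_def b_def d_def by (simp add: det_3)
    ultimately have "det (frame_iso z u) = of_real (2 * a * b * d * (herm z * herm u))"
      unfolding frame_iso_def det_mul by (simp add: mult_ac)
    then show ?thesis unfolding abd by simp
  qed
  ultimately show ?thesis by (simp add: SUh_def)
qed

lemma frame_iso_axis: "frame_iso z u *v axis 2 1 = of_real (1 / sqrt (herm z)) *s z"
  unfolding frame_iso_def frame_mat_def frame_trans_def
  by (simp add: vec_eq_iff forall_3 matrix_matrix_mult_def sum_3 mat_cols_def matrix_vector_mult_def axis_def)

lemma frame_expansion:
  "of_real (herm z * herm u) *s y = (of_real (herm z) * hip y u) *s u - hip y (hcross z u) *s hcross z u + (of_real (herm u) * hip y z) *s z"
proof -
  have "of_real (herm z * herm u) *s y = frame_mat z u *v (frame_dual z u *v y)"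
    by (simp only: matrix_vector_mul_assoc frame_mat_frame_dual mat_mult_vec)
  then show ?thesis by (simp add: frame_mat_def frame_dual_mult_vec mat_cols_mult_vec hip_self)
qed

end

section \<open>Stabilisers of positive vectors\<close>

lemma E_emb_mult: "E_emb (A ** B) = E_emb A ** E_emb B"
  by (simp add: E_emb_def vec_eq_iff forall_3 matrix_matrix_mult_def sum_3 sum_2)

lemma E_emb_one: "E_emb (mat 1) = mat 1"
  by (simp add: E_emb_def vec_eq_iff forall_3 mat_def)

lemma det_E_emb: "det (E_emb A) = det A"
  by (simp add: E_emb_def det_3 det_2)

lemma E_emb_axis: "E_emb A *v axis 2 1 = axis 2 1"
  by (simp add: E_emb_def vec_eq_iff forall_3 matrix_vector_mult_def sum_3 axis_def)

lemma E_emb_SUh: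
  assumes "Im (A $ 1 $ 1) = 0" "Im (A $ 2 $ 2) = 0" "Re (A $ 1 $ 2) = 0" "Re (A $ 2 $ 1) = 0" "det A = 1"
  shows "E_emb A \<in> carrier SUh"
proof -
  have c: "cnj (A $ 1 $ 1) = A $ 1 $ 1" "cnj (A $ 2 $ 2) = A $ 2 $ 2"
    "cnj (A $ 1 $ 2) = - A $ 1 $ 2" "cnj (A $ 2 $ 1) = - A $ 2 $ 1"
    using assms by (simp_all add: complex_eq_iff)
  have d: "A $ 1 $ 1 * A $ 2 $ 2 - A $ 1 $ 2 * A $ 2 $ 1 = 1" using assms(5) by (simp add: det_2)
  have "hadj (E_emb A) ** E_emb A = mat 1"
    using d by (simp add: E_emb_def hadj_def vec_eq_iff forall_3 matrix_matrix_mult_def sum_3 mat_def c algebra_simps)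
  then show ?thesis using assms(5) by (simp add: SUh_iff det_E_emb)
qed

text \<open>Conjugation by diag(1, -i). It carries real matrices of determinant 1 to those
  preserving the restriction of \<open>hip\<close> to the plane of the first and third coordinates,
  where both basis vectors are isotropic.\<close>

definition sl2_twist :: "real^2^2 \<Rightarrow> complex^2^2" where
  "sl2_twist M = vector [vector [of_real (M $ 1 $ 1), \<i> * of_real (M $ 1 $ 2)],
     vector [- \<i> * of_real (M $ 2 $ 1), of_real (M $ 2 $ 2)]]"

lemma sl2_twist_mult: "sl2_twist (A ** B) = sl2_twist A ** sl2_twist B"
  by (simp add: sl2_twist_def vec_eq_iff forall_2 matrix_matrix_mult_def sum_2 algebra_simps)

lemma sl2_twist_one: "sl2_twist (mat 1) = mat 1"
  by (simp add: sl2_twist_def vec_eq_iff forall_2 mat_def)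

lemma det_sl2_twist: "det (sl2_twist M) = of_real (det M)"
  by (simp add: det_2 sl2_twist_def complex_eq_iff)

definition su11 :: "real^2^2 \<Rightarrow> complex^3^3" where
  "su11 M = E_emb (sl2_twist M)"

lemma su11_mult: "su11 (A ** B) = su11 A ** su11 B"
  by (simp add: su11_def sl2_twist_mult E_emb_mult)

lemma su11_one: "su11 (mat 1) = mat 1"
  by (simp add: su11_def sl2_twist_one E_emb_one)

lemma su11_SUh: "det M = 1 \<Longrightarrow> su11 M \<in> carrier SUh"
  unfolding su11_def by (rule E_emb_SUh) (simp_all add: det_sl2_twist, simp_all add: sl2_twist_def)

text \<open>The adjoint fixes the axis too, so g splits as a block matrix. Its adjoint must equal
  the explicit inverse of the 2 by 2 block; comparing entries makes the diagonal real and the rest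
  imaginary.\<close>

lemma SUh_fixes_axis:
  assumes g: "g \<in> carrier SUh" "g *v axis 2 1 = axis 2 1"
  obtains M where "det M = 1" "g = su11 M"
proof -
  have "hadj g *v axis 2 1 = axis 2 1"
    using arg_cong[OF g(2), of "(*v) (hadj g)"] SUh_hadj_mult[OF g(1)]
    by (simp add: matrix_vector_mul_assoc)
  then have z1: "g $ 2 $ 1 = 0" "g $ 2 $ 3 = 0"
    by (simp_all add: hadj_def vec_eq_iff forall_3 matrix_vector_mult_def sum_3 axis_def)
  have z2: "g $ 1 $ 2 = 0" "g $ 2 $ 2 = 1" "g $ 3 $ 2 = 0"
    using g(2) by (simp_all add: vec_eq_iff forall_3 matrix_vector_mult_def sum_3 axis_def)
  define h :: "complex^3^3" where "h = vector [vector [g $ 3 $ 3, 0, - g $ 1 $ 3], vector [0, 1, 0],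
    vector [- g $ 3 $ 1, 0, g $ 1 $ 1]]"
  have d: "g $ 1 $ 1 * g $ 3 $ 3 - g $ 1 $ 3 * g $ 3 $ 1 = 1"
    using SUh_det[OF g(1)] by (simp add: det_3 z1 z2)
  have "g ** h = mat 1"
    using d by (simp add: h_def vec_eq_iff forall_3 matrix_matrix_mult_def sum_3 mat_def z1 z2 algebra_simps)
  then have "hadj g = h"
    by (metis SUh_hadj_mult[OF g(1)] matrix_mul_assoc matrix_mul_lid matrix_mul_rid)
  then have "cnj (g $ 3 $ 3) = g $ 3 $ 3" "cnj (g $ 1 $ 3) = - g $ 1 $ 3"
    "cnj (g $ 3 $ 1) = - g $ 3 $ 1" "cnj (g $ 1 $ 1) = g $ 1 $ 1"
    by (simp_all add: hadj_def h_def vec_eq_iff forall_3)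
  then have r: "Im (g $ 3 $ 3) = 0" "Re (g $ 1 $ 3) = 0" "Re (g $ 3 $ 1) = 0" "Im (g $ 1 $ 1) = 0"
    by (simp_all add: complex_eq_iff)
  define M :: "real^2^2" where "M = vector [vector [Re (g $ 1 $ 1), Im (g $ 1 $ 3)],
    vector [- Im (g $ 3 $ 1), Re (g $ 3 $ 3)]]"
  have gM: "g = su11 M"
    using r by (simp add: su11_def E_emb_def sl2_twist_def M_def vec_eq_iff forall_3 z1 z2 complex_eq_iff)
  moreover have "det M = 1"
    using SUh_det[OF g(1)] unfolding gM su11_def det_E_emb det_sl2_twist by simp
  ultimately show thesis using that by blast
qed

text \<open>The lifts fix the vector and not just its line. This selects a copy of SU(1,1), whereas
  the stabiliser of the projective point would be a copy of U(1,1).\<close>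

definition stab :: "complex^3 \<Rightarrow> (complex^3^3) set set" where
  "stab v = proj_PSUh ` {g \<in> carrier SUh. g *v v = v}"

lemma subgroup_fixing: "subgroup {g \<in> carrier SUh. g *v v = v} SUh"
proof (rule SUh.subgroupI)
  show "{g \<in> carrier SUh. g *v v = v} \<noteq> {}" using SUh_one by force
next
  fix g assume g: "g \<in> {g \<in> carrier SUh. g *v v = v}"
  then have "hadj g *v (g *v v) = v" unfolding matrix_vector_mul_assoc by (simp add: SUh_hadj_mult)
  then have "hadj g *v v = v" using g by simp
  then show "inv\<^bsub>SUh\<^esub> g \<in> {g \<in> carrier SUh. g *v v = v}" using g by (simp add: inv_SUh SUh_hadj)
next
  fix g h assume "g \<in> {g \<in> carrier SUh. g *v v = v}" "h \<in> {g \<in> carrier SUh. g *v v = v}"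
  then show "g \<otimes>\<^bsub>SUh\<^esub> h \<in> {g \<in> carrier SUh. g *v v = v}"
    by (simp add: SUh_mult flip: matrix_vector_mul_assoc)
qed auto

lemma subgroup_stab: "subgroup (stab v) PSUh"
  unfolding stab_def by (rule subgroup_proj_image[OF subgroup_fixing])

lemma stab_scale: "c \<noteq> 0 \<Longrightarrow> stab (c *s v) = stab v"
  by (simp add: stab_def vector_scalar_commute)

definition conj_su11 :: "complex^3^3 \<Rightarrow> real^2^2 \<Rightarrow> complex^3^3" where
  "conj_su11 \<gamma> M = \<gamma> ** su11 M ** hadj \<gamma>"

context
  fixes v :: "complex^3" and \<gamma> :: "complex^3^3" and k :: complex
  assumes \<gamma>: "\<gamma> \<in> carrier SUh" and axis: "\<gamma> *v axis 2 1 = k *s v" and k: "k \<noteq> 0"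
begin

lemma conj_su11_SUh: "det M = 1 \<Longrightarrow> conj_su11 \<gamma> M \<in> carrier SUh"
  unfolding conj_su11_def by (intro SUh_mult su11_SUh \<gamma> SUh_hadj)

lemma conj_su11_fixes: "conj_su11 \<gamma> M *v v = v"
proof -
  have "hadj \<gamma> *v (k *s v) = axis 2 1"
    unfolding axis[symmetric] by (simp add: matrix_vector_mul_assoc SUh_hadj_mult[OF \<gamma>])
  then have "conj_su11 \<gamma> M *v (k *s v) = k *s v"
    unfolding conj_su11_def by (simp add: matrix_vector_mul_assoc[symmetric] su11_def E_emb_axis axis)
  then have "k *s (conj_su11 \<gamma> M *v v) = k *s v" by (simp add: vector_scalar_commute)
  then show ?thesis using k by simp
qed

lemma conj_su11_mult: "conj_su11 \<gamma> (A ** B) = conj_su11 \<gamma> A ** conj_su11 \<gamma> B"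
proof -
  have "conj_su11 \<gamma> A ** conj_su11 \<gamma> B = \<gamma> ** su11 A ** (hadj \<gamma> ** \<gamma>) ** su11 B ** hadj \<gamma>"
    by (simp add: conj_su11_def matrix_mul_assoc)
  then show ?thesis by (simp add: conj_su11_def su11_mult SUh_hadj_mult[OF \<gamma>] matrix_mul_assoc)
qed

lemma conj_su11_one: "conj_su11 \<gamma> (mat 1) = mat 1"
  unfolding conj_su11_def su11_one by (simp add: SUh_mult_hadj[OF \<gamma>])

lemma fixing_conj_su11:
  assumes g: "g \<in> carrier SUh" "g *v v = v"
  obtains M where "det M = 1" "g = conj_su11 \<gamma> M"
proof -
  define h where "h = hadj \<gamma> ** g ** \<gamma>"
  have "h \<in> carrier SUh" unfolding h_def by (intro SUh_mult SUh_hadj \<gamma> g)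
  moreover have "h *v axis 2 1 = axis 2 1"
  proof -
    have "h *v axis 2 1 = hadj \<gamma> *v (g *v (k *s v))"
      by (simp add: h_def axis flip: matrix_vector_mul_assoc)
    also have "\<dots> = hadj \<gamma> *v (\<gamma> *v axis 2 1)" by (simp add: axis g(2) vector_scalar_commute)
    finally show ?thesis by (simp add: matrix_vector_mul_assoc SUh_hadj_mult[OF \<gamma>])
  qed
  ultimately obtain M where M: "det M = 1" "h = su11 M" by (rule SUh_fixes_axis)
  have "g = conj_su11 \<gamma> M"
    unfolding conj_su11_def M(2)[symmetric] h_def
    by (metis SUh_mult_hadj[OF \<gamma>] matrix_mul_assoc matrix_mul_lid matrix_mul_rid)
  then show thesis using that M(1) by blast
qed

lemma stab_eq_conj_su11: "stab v = (\<lambda>M. proj_PSUh (conj_su11 \<gamma> M)) ` {M. det M = 1}"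
proof
  show "stab v \<subseteq> (\<lambda>M. proj_PSUh (conj_su11 \<gamma> M)) ` {M. det M = 1}"
    unfolding stab_def by (auto elim!: fixing_conj_su11)
  show "(\<lambda>M. proj_PSUh (conj_su11 \<gamma> M)) ` {M. det M = 1} \<subseteq> stab v"
    unfolding stab_def by (auto intro!: imageI conj_su11_SUh conj_su11_fixes)
qed

end

text \<open>Formed from the coordinates of z by conjugation alone, so it is integral when z is. In
  the first two cases one isotropic coordinate vanishes and the norm is the squared modulus of the
  middle coordinate; in the last case it is 2.\<close>

definition pos_orth :: "complex^3 \<Rightarrow> complex^3" where
  "pos_orth z = (if z $ 3 \<noteq> 0 then vector [cnj (z $ 2), cnj (z $ 3), 0]
     else if z $ 1 \<noteq> 0 then vector [0, cnj (z $ 1), cnj (z $ 2)] else vector [1, 0, -1])"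

lemma pos_orth: "hip (pos_orth z) z = 0" "herm (pos_orth z) > 0"
  by (simp_all add: pos_orth_def hip_def herm_def)

lemma positive_vector_frame:
  assumes "herm v > 0"
  obtains \<gamma> k where "\<gamma> \<in> carrier SUh" "\<gamma> *v axis 2 1 = k *s v" "k \<noteq> 0"
proof -
  have "of_real (1 / sqrt (herm v)) \<noteq> (0 :: complex)" using assms by simp
  then show thesis
    using that[of "frame_iso v (pos_orth v)"] frame_iso_SUh[OF pos_orth(1) assms pos_orth(2)]
      frame_iso_axis[OF pos_orth(1) assms pos_orth(2)] by blast
qed

text \<open>A left inverse of \<open>conj_su11\<close> given by a formula for all matrices, hence
  continuous. The factor \<open>cnj (h $ 2 $ 2)\<close> is 1 on the image of
  \<open>conj_su11\<close> and cancels the cube root of unity by which other representatives of a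
  class differ.\<close>

definition su11_coord :: "complex^3^3 \<Rightarrow> complex^3^3 \<Rightarrow> real^2^2" where
  "su11_coord \<gamma> g = (let h = hadj \<gamma> ** g ** \<gamma> in
     vector [vector [Re (cnj (h $ 2 $ 2) * h $ 1 $ 1), Im (cnj (h $ 2 $ 2) * h $ 1 $ 3)],
       vector [- Im (cnj (h $ 2 $ 2) * h $ 3 $ 1), Re (cnj (h $ 2 $ 2) * h $ 3 $ 3)]])"

lemma su11_coord_scale:
  assumes "w ^ 3 = 1" shows "su11_coord \<gamma> (mat w ** g) = su11_coord \<gamma> g"
proof -
  define h where "h = hadj \<gamma> ** g ** \<gamma>"
  have *: "hadj \<gamma> ** (mat w ** g) ** \<gamma> = mat w ** h"
    unfolding h_def by (metis mat_commute matrix_mul_assoc)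
  have "cnj (w * h $ 2 $ 2) * (w * h $ i $ j) = cnj (h $ 2 $ 2) * h $ i $ j" for i j
  proof -
    have "cnj (w * h $ 2 $ 2) * (w * h $ i $ j) = (w * cnj w) * (cnj (h $ 2 $ 2) * h $ i $ j)"
      by (simp add: mult_ac)
    then show ?thesis by (simp add: cube_root_unity_cnj[OF assms])
  qed
  moreover have "(mat w ** h) $ i $ j = w * h $ i $ j" for i j by (simp add: matrix_mult_mat_scalar)
  ultimately show ?thesis by (simp only: su11_coord_def Let_def * h_def[symmetric])
qed

lemma su11_coord_conj:
  assumes "\<gamma> \<in> carrier SUh" shows "su11_coord \<gamma> (conj_su11 \<gamma> M) = M"
proof -
  have "hadj \<gamma> ** conj_su11 \<gamma> M ** \<gamma> = su11 M"
    unfolding conj_su11_def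
    by (metis SUh_hadj_mult[OF assms] matrix_mul_assoc matrix_mul_lid matrix_mul_rid)
  then show ?thesis
    by (simp add: su11_coord_def Let_def su11_def E_emb_def sl2_twist_def vec_eq_iff forall_2)
qed

lemma su11_coord_some_proj: "su11_coord \<gamma> (SOME h. h \<in> proj_PSUh g) = su11_coord \<gamma> g"
proof -
  have "(SOME h. h \<in> proj_PSUh g) \<in> proj_PSUh g" using self_mem_proj by (rule someI)
  then show ?thesis by (auto simp: mem_proj_iff su11_coord_scale)
qed

section \<open>Continuity of the embedding of SL_2(R) and of its inverse\<close>

lemma continuous_on_vector2:
  fixes f :: "'a::topological_space \<Rightarrow> 'b::{topological_space, zero}"
  assumes "continuous_on S f" "continuous_on S g"
  shows "continuous_on S (\<lambda>x. vector [f x, g x] :: 'b^2)"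
proof -
  have "continuous_on S (\<lambda>x. \<chi> i. (vector [f x, g x] :: 'b^2) $ i)"
  proof (rule continuous_on_vec_lambda)
    fix i :: 2 show "continuous_on S (\<lambda>x. (vector [f x, g x] :: 'b^2) $ i)"
      using assms exhaust_2[of i] by auto
  qed
  then show ?thesis by simp
qed

lemma continuous_on_vector3:
  fixes f :: "'a::topological_space \<Rightarrow> 'b::{topological_space, zero}"
  assumes "continuous_on S f" "continuous_on S g" "continuous_on S h"
  shows "continuous_on S (\<lambda>x. vector [f x, g x, h x] :: 'b^3)"
proof -
  have "continuous_on S (\<lambda>x. \<chi> i. (vector [f x, g x, h x] :: 'b^3) $ i)"
  proof (rule continuous_on_vec_lambda)
    fix i :: 3 show "continuous_on S (\<lambda>x. (vector [f x, g x, h x] :: 'b^3) $ i)"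
      using assms exhaust_3[of i] by auto
  qed
  then show ?thesis by simp
qed

lemma continuous_on_matrix_mult:
  fixes f :: "'a::topological_space \<Rightarrow> complex^3^3"
  assumes "continuous_on S f" "continuous_on S g"
  shows "continuous_on S (\<lambda>x. f x ** g x)"
  unfolding matrix_matrix_mult_def sum_3 using assms
  by (intro continuous_on_vec_lambda continuous_intros)

lemma continuous_on_conj_su11: "continuous_on S (conj_su11 \<gamma>)"
proof -
  have "su11 M = vector [vector [of_real (M $ 1 $ 1), 0, \<i> * of_real (M $ 1 $ 2)], vector [0, 1, 0],
    vector [- \<i> * of_real (M $ 2 $ 1), 0, of_real (M $ 2 $ 2)]]" for M
    by (simp add: su11_def E_emb_def sl2_twist_def)
  then have "continuous_on S (\<lambda>M. \<gamma> ** su11 M ** hadj \<gamma>)"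
    by (simp only:) (intro continuous_on_matrix_mult continuous_on_vector3 continuous_intros)
  then show ?thesis by (simp add: conj_su11_def[abs_def])
qed

lemma continuous_on_su11_coord: "continuous_on S (su11_coord \<gamma>)"
proof -
  have "continuous_on S (\<lambda>g. hadj \<gamma> ** g ** \<gamma>)"
    by (intro continuous_on_matrix_mult continuous_intros)
  then have *: "continuous_on S (\<lambda>g. (hadj \<gamma> ** g ** \<gamma>) $ i $ j)" for i j
    by (intro continuous_intros)
  show ?thesis unfolding su11_coord_def[abs_def] Let_def
    by (intro continuous_on_vector2 continuous_on_Re continuous_on_Im continuous_on_mult
        continuous_on_cnj continuous_on_minus *)
qed

lemma topspace_quotient_SUh: "topspace (quotient_top SUh U3) = carrier PSUh"
proof -
  have c: "rcosets\<^bsub>SUh\<^esub> U3 = carrier PSUh" by (simp add: PSUh_def FactGroup_def)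
  have "{g \<in> carrier SUh. U3 #>\<^bsub>SUh\<^esub> g \<in> carrier PSUh} = carrier SUh"
    using carrier_PSUh by (auto simp: proj_PSUh_def)
  then have "openin (quotient_top SUh U3) (carrier PSUh)"
    unfolding openin_quotient_top c by simp
  then have "carrier PSUh \<subseteq> topspace (quotient_top SUh U3)" by (rule openin_subset)
  moreover have "topspace (quotient_top SUh U3) \<subseteq> carrier PSUh"
    using openin_topspace[of "quotient_top SUh U3"] unfolding openin_quotient_top c by (rule conjunct1)
  ultimately show ?thesis by (rule subset_antisym[rotated])
qed

lemma openin_quotient_SUh:
  "openin (quotient_top SUh U3) U \<longleftrightarrow>
     U \<subseteq> carrier PSUh \<and> openin (top_of_set (carrier SUh)) {g \<in> carrier SUh. proj_PSUh g \<in> U}"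
  by (simp add: openin_quotient_top PSUh_def FactGroup_def proj_PSUh_def)

lemma carrier_SL2R: "carrier SL2R = {M. det M = 1}" and mult_SL2R: "x \<otimes>\<^bsub>SL2R\<^esub> y = x ** y"
  and one_SL2R: "\<one>\<^bsub>SL2R\<^esub> = mat 1"
  by (simp_all add: SL2R_def)

text \<open>The inverse map is induced by \<open>su11_coord\<close>, which is constant on classes
  modulo \<open>U3\<close> and therefore descends to a continuous map on the quotient.\<close>

lemma embedded_stab:
  assumes "herm v > 0"
  shows "embedded_PSL2R_or_SL2R (stab v)"
proof -
  obtain \<gamma> k where \<gamma>: "\<gamma> \<in> carrier SUh" "\<gamma> *v axis 2 1 = k *s v" "k \<noteq> 0"
    by (rule positive_vector_frame[OF assms])
  define f where "f M = proj_PSUh (conj_su11 \<gamma> M)" for M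
  define G where "G C = su11_coord \<gamma> (SOME h. h \<in> C)" for C
  let ?X = "top_of_set (carrier SL2R)" and ?Y = "quotient_top SUh U3"
  have st: "f ` carrier SL2R = stab v"
    unfolding f_def[abs_def] carrier_SL2R by (rule stab_eq_conj_su11[OF \<gamma>, symmetric])
  have SU: "conj_su11 \<gamma> M \<in> carrier SUh" if "M \<in> carrier SL2R" for M
    using that conj_su11_SUh[OF \<gamma>] by (simp add: carrier_SL2R)
  have hom: "f \<in> hom SL2R PSUh"
  proof (rule homI)
    fix A B assume "A \<in> carrier SL2R" "B \<in> carrier SL2R"
    then show "f (A \<otimes>\<^bsub>SL2R\<^esub> B) = f A \<otimes>\<^bsub>PSUh\<^esub> f B"
      using SU by (simp add: f_def mult_SL2R conj_su11_mult[OF \<gamma>] proj_mult)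
  qed (use SU in \<open>auto simp: f_def carrier_PSUh\<close>)
  have Gproj: "G (proj_PSUh g) = su11_coord \<gamma> g" for g
    by (simp add: G_def su11_coord_some_proj)
  have Gf: "G (f M) = M" for M
    by (simp add: f_def Gproj su11_coord_conj[OF \<gamma>(1)])
  have cf: "continuous_map ?X ?Y f"
    unfolding continuous_map_def
  proof (intro conjI allI impI)
    show "f \<in> topspace ?X \<rightarrow> topspace ?Y"
      using SU by (auto simp: topspace_quotient_SUh f_def carrier_PSUh)
    fix U assume "openin ?Y U"
    then have "openin (top_of_set (carrier SUh)) {g \<in> carrier SUh. proj_PSUh g \<in> U}"
      by (simp add: openin_quotient_SUh)
    then have "openin ?X (carrier SL2R \<inter> conj_su11 \<gamma> -` {g \<in> carrier SUh. proj_PSUh g \<in> U})"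
      by (intro continuous_openin_preimage[OF continuous_on_conj_su11]) (use SU in auto)
    moreover have "carrier SL2R \<inter> conj_su11 \<gamma> -` {g \<in> carrier SUh. proj_PSUh g \<in> U} = {x \<in> topspace ?X. f x \<in> U}"
      using SU by (auto simp: f_def)
    ultimately show "openin ?X {x \<in> topspace ?X. f x \<in> U}" by simp
  qed
  have cG: "continuous_map (subtopology ?Y (stab v)) ?X G"
    unfolding continuous_map_def
  proof (intro conjI allI impI)
    have ts: "topspace (subtopology ?Y (stab v)) = stab v"
      using subgroup.subset[OF subgroup_stab] by (auto simp: topspace_quotient_SUh)
    show "G \<in> topspace (subtopology ?Y (stab v)) \<rightarrow> topspace ?X"
      unfolding ts st[symmetric] by (auto simp: Gf)
    fix U assume "openin ?X U"
    then obtain U' where U': "open U'" "U = carrier SL2R \<inter> U'" by (auto simp: openin_open)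
    \<comment> \<open>An open subset of the quotient whose trace on \<open>stab v\<close> is the
      required preimage. Its full preimage in \<open>SUh\<close> is just the preimage of
      \<open>U'\<close> under \<open>su11_coord\<close>, again by constancy on classes.\<close>
    define W where "W = proj_PSUh ` {g \<in> carrier SUh. su11_coord \<gamma> g \<in> U'}"
    have "{g \<in> carrier SUh. proj_PSUh g \<in> W} = carrier SUh \<inter> su11_coord \<gamma> -` U'"
    proof
      show "{g \<in> carrier SUh. proj_PSUh g \<in> W} \<subseteq> carrier SUh \<inter> su11_coord \<gamma> -` U'"
      proof
        fix g assume "g \<in> {g \<in> carrier SUh. proj_PSUh g \<in> W}"
        then obtain h where "g \<in> carrier SUh" "proj_PSUh g = proj_PSUh h" "su11_coord \<gamma> h \<in> U'"
          by (auto simp: W_def)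
        then show "g \<in> carrier SUh \<inter> su11_coord \<gamma> -` U'" by (metis Gproj IntI vimageI2)
      qed
    qed (auto simp: W_def)
    then have "openin ?Y W"
      unfolding openin_quotient_SUh
      using continuous_openin_preimage_gen[OF continuous_on_su11_coord U'(1)] by (auto simp: W_def carrier_PSUh)
    moreover have "{x \<in> stab v. G x \<in> U} = W \<inter> stab v"
    proof -
      have "G C \<in> U \<longleftrightarrow> C \<in> W" if "C \<in> stab v" for C
      proof -
        obtain M where M: "M \<in> carrier SL2R" "C = f M" using \<open>C \<in> stab v\<close> st by blast
        have "C \<in> W \<longleftrightarrow> M \<in> U'"
        proof
          assume "C \<in> W"
          then obtain g where g: "C = proj_PSUh g" "su11_coord \<gamma> g \<in> U'" by (auto simp: W_def)
          then show "M \<in> U'" using Gf[of M] M(2) Gproj by metis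
        next
          assume "M \<in> U'"
          then show "C \<in> W" unfolding W_def M(2) f_def
            using SU[OF M(1)] su11_coord_conj[OF \<gamma>(1)] by auto
        qed
        then show ?thesis using M by (simp add: Gf U'(2))
      qed
      then show ?thesis by blast
    qed
    ultimately show "openin (subtopology ?Y (stab v)) {x \<in> topspace (subtopology ?Y (stab v)). G x \<in> U}"
      unfolding ts by (auto simp: openin_subtopology)
  qed
  have "homeomorphic_maps ?X (subtopology ?Y (stab v)) f G"
    unfolding homeomorphic_maps_def
  proof (intro conjI ballI)
    show "continuous_map ?X (subtopology ?Y (stab v)) f"
      using cf st by (auto simp: continuous_map_in_subtopology)
  next
    fix y assume "y \<in> topspace (subtopology ?Y (stab v))"
    then have "y \<in> f ` carrier SL2R" using st by simp
    then show "f (G y) = y" by (auto simp: Gf)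
  qed (use cG Gf in auto)
  then have "embedding_map ?X ?Y f"
    unfolding embedding_map_def using st by (auto simp: homeomorphic_map_maps)
  then show ?thesis
    unfolding embedded_PSL2R_or_SL2R_def Lie_group_embedding_def using hom st by blast
qed

section \<open>Embedded copies preserving a line\<close>

lemma hdual_hdual [simp]: "hdual (hdual y) = y"
  by (simp add: hdual_def vec_eq_iff forall_3)

lemma hip_hdual: "hip a (hdual y) = a $ 1 * y $ 1 + a $ 2 * y $ 2 + a $ 3 * y $ 3"
  by (simp add: hip_def hdual_def)

lemma ex_orthogonal_pair:
  obtains v where "v \<noteq> 0" "hip a v = 0" "hip b v = 0"
proof -
  define A :: "complex^3^3" where "A = vector [a, b, 0]"
  have "\<not> (\<exists>B. B ** A = mat 1)"
  proof
    assume "\<exists>B. B ** A = mat 1"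
    then obtain B where B: "B ** A = mat 1" by blast
    have "det A = 0" by (simp add: A_def det_3)
    then have "det (B ** A) = 0" by (simp add: det_mul)
    then show False using B by simp
  qed
  then obtain y where y: "A *v y = 0" "y \<noteq> 0" unfolding matrix_left_invertible_ker by blast
  have "hip a (hdual y) = 0" "hip b (hdual y) = 0"
    using y(1) by (simp_all add: hip_hdual A_def vec_eq_iff forall_3 matrix_vector_mult_def sum_3)
  moreover have "hdual y \<noteq> 0" using y(2) hdual_hdual[of y] by (auto simp: hdual_def vec_eq_iff forall_3)
  ultimately show thesis using that by blast
qed

lemma two_herm: "2 * herm x = (cmod (x $ 1 - x $ 3))\<^sup>2 + 2 * (cmod (x $ 2))\<^sup>2 - (cmod (x $ 1 + x $ 3))\<^sup>2"
  unfolding herm_def cmod_power2 by (simp add: power2_eq_square algebra_simps)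

text \<open>Reverse Cauchy-Schwarz in the diagonal coordinates of \<open>two_herm\<close>, where the
  signature (2, 1) is visible. Orthogonality expresses the negative coordinates through the positive
  ones, the weighted Cauchy-Schwarz inequality bounds them, and negativity of p makes the bound
  strict.\<close>

lemma orthogonal_to_negative_pos:
  assumes p: "herm p < 0" and "hip p v = 0" "v \<noteq> 0"
  shows "herm v > 0"
proof -
  define A B C where "A = cmod (p $ 1 - p $ 3)" and "B = cmod (p $ 2)" and "C = cmod (p $ 1 + p $ 3)"
  define a b c where "a = cmod (v $ 1 - v $ 3)" and "b = cmod (v $ 2)" and "c = cmod (v $ 1 + v $ 3)"
  have nn: "A \<ge> 0" "B \<ge> 0" "C \<ge> 0" "a \<ge> 0" "b \<ge> 0" "c \<ge> 0" by (simp_all add: A_def B_def C_def a_def b_def c_def)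
  have lt: "A\<^sup>2 + 2 * B\<^sup>2 < C\<^sup>2" using p two_herm[of p] by (simp add: A_def B_def C_def)
  have hv: "2 * herm v = a\<^sup>2 + 2 * b\<^sup>2 - c\<^sup>2" using two_herm[of v] by (simp add: a_def b_def c_def)
  have "(p $ 1 + p $ 3) * cnj (v $ 1 + v $ 3) = (p $ 1 - p $ 3) * cnj (v $ 1 - v $ 3) + 2 * (p $ 2 * cnj (v $ 2)) - 2 * hip p v"
    by (simp add: hip_def algebra_simps)
  then have "C * c = cmod ((p $ 1 - p $ 3) * cnj (v $ 1 - v $ 3) + 2 * (p $ 2 * cnj (v $ 2)))"
    using assms(2) by (metis C_def c_def complex_mod_cnj diff_zero mult_zero_right norm_mult)
  also have "\<dots> \<le> A * a + 2 * (B * b)"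
    using norm_triangle_ineq[of "(p $ 1 - p $ 3) * cnj (v $ 1 - v $ 3)" "2 * (p $ 2 * cnj (v $ 2))"]
    by (simp only: norm_mult complex_mod_cnj norm_numeral A_def B_def a_def b_def)
  finally have le: "C * c \<le> A * a + 2 * (B * b)" .
  have "(C * c)\<^sup>2 \<le> (A * a + 2 * (B * b))\<^sup>2" using le nn by (intro power_mono) auto
  also have "\<dots> = (A\<^sup>2 + 2 * B\<^sup>2) * (a\<^sup>2 + 2 * b\<^sup>2) - 2 * (A * b - B * a)\<^sup>2"
    by (simp add: power2_eq_square algebra_simps)
  finally have le2: "C\<^sup>2 * c\<^sup>2 \<le> (A\<^sup>2 + 2 * B\<^sup>2) * (a\<^sup>2 + 2 * b\<^sup>2)"
    using zero_le_power2[of "A * b - B * a"] unfolding power_mult_distrib[of C c] by linarith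
  have C: "C\<^sup>2 > 0" using lt by (smt (verit) zero_le_power2)
  show ?thesis
  proof (cases "a\<^sup>2 + 2 * b\<^sup>2 > 0")
    case True
    then have "(A\<^sup>2 + 2 * B\<^sup>2) * (a\<^sup>2 + 2 * b\<^sup>2) < C\<^sup>2 * (a\<^sup>2 + 2 * b\<^sup>2)" using lt by simp
    then have "C\<^sup>2 * c\<^sup>2 < C\<^sup>2 * (a\<^sup>2 + 2 * b\<^sup>2)" using le2 by linarith
    then have "c\<^sup>2 < a\<^sup>2 + 2 * b\<^sup>2" using C by simp
    then show ?thesis using hv by linarith
  next
    case False
    then have "a\<^sup>2 + 2 * b\<^sup>2 = 0" by (smt (verit) zero_le_power2)
    then have "a = 0" "b = 0" by (smt (verit) zero_le_power2 zero_eq_power2)+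
    moreover have "C\<^sup>2 * c\<^sup>2 \<le> 0" using le2 \<open>a\<^sup>2 + 2 * b\<^sup>2 = 0\<close> by simp
    then have "c = 0" using C by (simp add: mult_le_0_iff)
    ultimately have "v = 0" by (simp add: a_def b_def c_def vec_eq_iff forall_3)
    then show ?thesis using assms(3) by simp
  qed
qed

text \<open>A vector v orthogonal to a basis of L is orthogonal to the negative vector in L, hence
  positive. So it is not orthogonal to itself, and its orthogonal complement has dimension at most
  2, the dimension of L.\<close>

lemma proj_line_polar:
  assumes L: "complex_proj_line L" and p: "p \<in> H2C" "p \<subseteq> L"
  obtains v where "herm v > 0" "L = {y. hip y v = 0}"
proof -
  have sub: "vec.subspace L" and dim: "vec.dim L = 2" using L by (auto simp: complex_proj_line_def)
  obtain B where B: "B \<subseteq> L" "vec.independent B" "L \<subseteq> vec.span B" "card B = vec.dim L"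
    by (rule vec.basis_exists)
  then obtain a b where ab: "B = {a, b}" using dim by (metis card_2_iff)
  obtain v where v: "v \<noteq> 0" "hip a v = 0" "hip b v = 0" by (rule ex_orthogonal_pair)
  have subv: "vec.subspace {y. hip y v = 0}"
    by (auto simp: vec.subspace_def hip_linear)
  then have "vec.span B \<subseteq> {y. hip y v = 0}" using v ab by (intro vec.span_minimal) auto
  then have Lv: "L \<subseteq> {y. hip y v = 0}" using B(3) by blast
  obtain q where q: "p = vec.span {q}" "herm q < 0" using p(1) by (auto simp: H2C_def)
  then have "q \<in> L" using p(2) vec.span_base by blast
  then have "herm v > 0" using orthogonal_to_negative_pos[OF q(2) _ v(1)] Lv by blast
  moreover have "vec.dim {y. hip y v = 0} \<le> 2"
  proof -
    have "vec.dim {y. hip y v = 0} \<le> CARD(3)" by (rule dim_subset_UNIV_cart_gen)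
    moreover have "vec.dim {y. hip y v = 0} \<noteq> CARD(3)"
    proof
      assume "vec.dim {y. hip y v = 0} = CARD(3)"
      then have "vec.dim {y. hip y v = 0} = vec.dimension TYPE(complex) TYPE(3)" using vec_dim_card 
        by (metis vec.dim_UNIV vec.dimension_def)
      then have "vec.span {y. hip y v = 0} = UNIV" using vec.dim_eq_full by blast
      then have "{y. hip y v = 0} = UNIV" using vec.span_eq_iff[of "{y. hip y v = 0}"] subv by simp
      then have "hip v v = 0" by blast
      then show False using \<open>herm v > 0\<close> by (simp add: hip_self)
    qed
    ultimately show ?thesis by simp
  qed
  then have "L = {y. hip y v = 0}" using vec.subspace_dim_equal[OF sub subv Lv] dim by simp
  ultimately show thesis using that by blast
qed

text \<open>Conjugation by diag(2, 1/2) or its inverse multiplies a unipotent parameter by 4, so the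
  value at 4 s equals the value at s; additivity makes it the value at 3 s times that at s. Hence
  the character is trivial on unipotents. Three of them give any matrix with nonzero lower left
  entry, and one more factor reduces the remaining matrices to these.\<close>

lemma SL2R_character_trivial:
  fixes f :: "real^2^2 \<Rightarrow> complex"
  assumes mult: "\<And>A B. det A = 1 \<Longrightarrow> det B = 1 \<Longrightarrow> f (A ** B) = f A * f B"
    and one: "f (mat 1) = 1" and A: "det A = 1"
  shows "f A = 1"
proof -
  define up lo where "up t = (vector [vector [1, t], vector [0, 1]] :: real^2^2)"
    and "lo t = (vector [vector [1, 0], vector [t, 1]] :: real^2^2)" for t
  define d e where "d = (vector [vector [2, 0], vector [0, 1/2]] :: real^2^2)"
    and "e = (vector [vector [1/2, 0], vector [0, 2]] :: real^2^2)"
  note defs = up_def lo_def d_def e_def det_2 vec_eq_iff forall_2 matrix_matrix_mult_def sum_2 mat_def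
  have det: "det (up t) = 1" "det (lo t) = 1" "det d = 1" "det e = 1" for t
    by (simp_all add: defs)
  have de: "f d * f e = 1"
  proof -
    have "d ** e = mat 1" by (simp add: defs)
    then show ?thesis using mult[OF det(3,4)] one by simp
  qed
  have nz: "f B \<noteq> 0" if "det B = 1" for B
  proof -
    define B' where "B' = (vector [vector [B $ 2 $ 2, - B $ 1 $ 2], vector [- B $ 2 $ 1, B $ 1 $ 1]] :: real^2^2)"
    have "B ** B' = mat 1" "det B' = 1" using that by (simp_all add: B'_def defs algebra_simps)
    then show ?thesis using mult[OF that, of B'] one by auto
  qed
  have up: "f (up t) = 1" for t
  proof -
    have "up (4 * s) = d ** up s ** e" "up (4 * s) = up (3 * s) ** up s" for s
      by (simp_all add: defs)
    then have "f d * f (up s) * f e = f (up (3 * s)) * f (up s)" for s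
      by (metis mult det det_mul mult_1)
    then have "f (up s) = f (up (3 * s)) * f (up s)" for s using de by (metis mult.commute mult.left_commute mult.right_neutral)
    then have "f (up (3 * s)) = 1" for s using nz[OF det(1)] by (metis mult_cancel_right2)
    from this[of "t / 3"] show ?thesis by simp
  qed
  have lo: "f (lo t) = 1" for t
  proof -
    have "lo (4 * s) = e ** lo s ** d" "lo (4 * s) = lo (3 * s) ** lo s" for s
      by (simp_all add: defs)
    then have "f e * f (lo s) * f d = f (lo (3 * s)) * f (lo s)" for s
      by (metis mult det det_mul mult_1)
    then have "f (lo s) = f (lo (3 * s)) * f (lo s)" for s using de by (metis mult.commute mult.left_commute mult.right_neutral)
    then have "f (lo (3 * s)) = 1" for s using nz[OF det(2)] by (metis mult_cancel_right2)
    from this[of "t / 3"] show ?thesis by simp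
  qed
  have gen: "f B = 1" if B: "det B = 1" "B $ 2 $ 1 \<noteq> 0" for B
  proof -
    define c where "c = B $ 2 $ 1"
    have "c \<noteq> 0" using B by (simp add: c_def)
    have "B = up ((B $ 1 $ 1 - 1) / c) ** lo c ** up ((B $ 2 $ 2 - 1) / c)"
      using B(1) \<open>c \<noteq> 0\<close> by (simp add: defs field_simps flip: c_def)
    then show ?thesis using mult det up lo by (metis det_mul mult_1)
  qed
  show ?thesis
  proof (cases "A $ 2 $ 1 = 0")
    case True
    then have "A $ 2 $ 2 \<noteq> 0" using A by (auto simp: det_2)
    then have "(A ** lo 1) $ 2 $ 1 \<noteq> 0" using True by (simp add: defs)
    then have "f (A ** lo 1) = 1" using gen A det(2)[of 1] by (simp add: det_mul)
    then show ?thesis using mult[OF A det(2)] lo by simp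
  qed (use gen A in auto)
qed

text \<open>Every vector orthogonal to v is the image of such a vector, so g v is orthogonal to all
  of them. Its component \<open>r\<close> off v is then orthogonal to the whole space.\<close>

lemma invariant_line_eigenvector:
  assumes v: "herm v > 0" and g: "g \<in> carrier SUh"
    and inv: "\<And>y. hip y v = 0 \<Longrightarrow> \<exists>x. hip x v = 0 \<and> y = g *v x"
  obtains l where "g *v v = l *s v"
proof -
  have nz: "hip v v \<noteq> 0" using v by (simp add: hip_self)
  define l where "l = hip (g *v v) v / hip v v"
  define r where "r = g *v v - l *s v"
  have rv: "hip r v = 0" using nz by (simp add: r_def hip_linear l_def)
  have perp: "hip r y = 0" if y: "hip y v = 0" for y
  proof -
    obtain x where x: "hip x v = 0" "y = g *v x" using inv[OF y] by blast
    have "hip (g *v v) y = hip v x" unfolding x(2) by (rule SUh_hip[OF g])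
    then have "hip (g *v v) y = 0" "hip v y = 0"
      using x(1) y by (metis complex_cnj_zero hip_commute)+
    then show ?thesis by (simp add: r_def hip_linear)
  qed
  have "hip y r = hip y 0" for y
  proof -
    define k where "k = hip y v / hip v v"
    have "hip (y - k *s v) v = 0" using nz by (simp add: hip_linear k_def)
    then have "hip r (y - k *s v) = 0" by (rule perp)
    then have "hip r y = 0" using rv by (simp add: hip_linear)
    then show ?thesis by (metis complex_cnj_zero hip_commute hip_zero(2))
  qed
  then have "r = 0" by (rule hip_nondegenerate)
  then show thesis using that[of l] by (simp add: r_def)
qed

lemma hom_image_subset_stab:
  assumes v: "herm v > 0" and \<phi>: "\<phi> \<in> hom SL2R PSUh"
    and inv: "\<And>M. M \<in> carrier SL2R \<Longrightarrow> PSUh_act (\<phi> M) {y. hip y v = 0} = {y. hip y v = 0}"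
  shows "\<phi> ` carrier SL2R \<subseteq> stab v"
proof -
  \<comment> \<open>The cube of the eigenvalue at v. Cubing removes the dependence on the chosen
    representative, so that a character of \<open>SL2R\<close> results.\<close>
  define ch where "ch X = (hip ((SOME g. g \<in> X) *v v) v / hip v v) ^ 3" for X
  have nz: "hip v v \<noteq> 0" using v by (simp add: hip_self)
  have ex: "\<exists>g l. g \<in> carrier SUh \<and> \<phi> M = proj_PSUh g \<and> g *v v = l *s v" if M: "M \<in> carrier SL2R" for M
  proof -
    have "\<phi> M \<in> carrier PSUh" using \<phi> M by (auto simp: hom_def)
    then obtain g where g: "g \<in> carrier SUh" "\<phi> M = proj_PSUh g" by (auto simp: carrier_PSUh)
    have "\<exists>x. hip x v = 0 \<and> y = g *v x" if "hip y v = 0" for y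
    proof -
      have "y \<in> PSUh_act (\<phi> M) {y. hip y v = 0}" using inv[OF M] that by simp
      then obtain h x where "h \<in> proj_PSUh g" "hip x v = 0" "y = h *v x"
        by (auto simp: PSUh_act_def g(2))
      then obtain w where "h = mat w ** g" by (auto simp: mem_proj_iff)
      then have "y = g *v (w *s x)" using \<open>y = h *v x\<close>
        by (simp add: mat_mult_vec vector_scalar_commute flip: matrix_vector_mul_assoc)
      then show ?thesis using \<open>hip x v = 0\<close> by (intro exI[of _ "w *s x"]) (simp add: hip_linear)
    qed
    then obtain l where "g *v v = l *s v" by (rule invariant_line_eigenvector[OF v g(1)])
    then show ?thesis using g by blast
  qed
  have ch: "ch (proj_PSUh g) = l ^ 3" if "g *v v = l *s v" for g l
  proof -
    have "(SOME h. h \<in> proj_PSUh g) \<in> proj_PSUh g" using self_mem_proj by (rule someI)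
    then obtain w where w: "w ^ 3 = 1" "(SOME h. h \<in> proj_PSUh g) = mat w ** g"
      by (auto simp: mem_proj_iff)
    then show ?thesis using nz that
      by (simp add: ch_def mat_mult_vec hip_linear power_mult_distrib flip: matrix_vector_mul_assoc)
  qed
  have "ch (\<phi> M) = 1" if "det M = 1" for M
  proof (rule SL2R_character_trivial[OF _ _ that])
    fix A B :: "real^2^2" assume "det A = 1" "det B = 1"
    then have AB: "A \<in> carrier SL2R" "B \<in> carrier SL2R" by (simp_all add: carrier_SL2R)
    obtain g l where g: "g \<in> carrier SUh" "\<phi> A = proj_PSUh g" "g *v v = l *s v" using ex[OF AB(1)] by blast
    obtain h m where h: "h \<in> carrier SUh" "\<phi> B = proj_PSUh h" "h *v v = m *s v" using ex[OF AB(2)] by blast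
    have "\<phi> (A ** B) = proj_PSUh (g ** h)"
      using hom_mult[OF \<phi> AB] g h by (simp add: mult_SL2R proj_mult)
    moreover have "(g ** h) *v v = (l * m) *s v"
      using g h by (simp add: vector_scalar_commute mult.commute flip: matrix_vector_mul_assoc)
    ultimately show "ch (\<phi> (A ** B)) = ch (\<phi> A) * ch (\<phi> B)"
      using ch[OF g(3)] ch[OF h(3)] ch[of "g ** h" "l * m"] g(2) h(2) by (simp add: power_mult_distrib)
  next
    have one: "mat 1 \<in> carrier SL2R" by (simp add: carrier_SL2R)
    have "\<phi> (mat 1) \<otimes>\<^bsub>PSUh\<^esub> \<phi> (mat 1) = \<phi> (mat 1)"
      using hom_mult[OF \<phi> one one] by (simp add: mult_SL2R)
    moreover have "\<phi> (mat 1) \<in> carrier PSUh" using \<phi> one by (auto simp: hom_def)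
    ultimately have "\<phi> (mat 1) = \<one>\<^bsub>PSUh\<^esub>" by (metis PSUh.l_cancel_one)
    then have "\<phi> (mat 1) = proj_PSUh (mat 1)" by (simp add: proj_one)
    then show "ch (\<phi> (mat 1)) = 1" using ch[of "mat 1" 1] by simp
  qed
  then show ?thesis
  proof (intro subsetI, elim imageE)
    fix X M assume X: "X = \<phi> M" "M \<in> carrier SL2R" and "\<And>M. det M = 1 \<Longrightarrow> ch (\<phi> M) = 1"
    then have 1: "ch X = 1" by (simp add: carrier_SL2R)
    obtain g l where g: "g \<in> carrier SUh" "X = proj_PSUh g" "g *v v = l *s v" using ex[OF X(2)] X(1) by blast
    have l: "l ^ 3 = 1" using 1 ch[OF g(3)] g(2) by simp
    then have cl: "cnj l ^ 3 = 1" by (metis complex_cnj_one complex_cnj_power)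
    have "(mat (cnj l) ** g) *v v = v"
      using g(3) cube_root_unity_cnj[OF l] by (simp add: mat_mult_vec mult.commute flip: matrix_vector_mul_assoc)
    moreover have "mat (cnj l) ** g \<in> carrier SUh" using U3_SUh[OF cl] g(1) by (rule SUh_mult)
    moreover have "X = proj_PSUh (mat (cnj l) ** g)" using proj_scale[OF cl] g(2) by simp
    ultimately show "X \<in> stab v" unfolding stab_def by blast
  qed
qed

lemma group_SL2R: "group SL2R"
proof (rule groupI)
  fix A assume A: "A \<in> carrier SL2R"
  define B where "B = (vector [vector [A $ 2 $ 2, - A $ 1 $ 2], vector [- A $ 2 $ 1, A $ 1 $ 1]] :: real^2^2)"
  have "B ** A = mat 1" "det B = 1" using A unfolding carrier_SL2R
    by (simp_all add: B_def det_2 vec_eq_iff forall_2 matrix_matrix_mult_def sum_2 mat_def algebra_simps)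
  then show "\<exists>B\<in>carrier SL2R. B \<otimes>\<^bsub>SL2R\<^esub> A = \<one>\<^bsub>SL2R\<^esub>" by (auto simp: carrier_SL2R mult_SL2R one_SL2R)
qed (auto simp: carrier_SL2R mult_SL2R one_SL2R det_mul matrix_mul_assoc)

lemma normal_pm1: "{mat 1, mat (- 1)} \<lhd> SL2R"
proof -
  interpret SL2R: group SL2R by (rule group_SL2R)
  have m: "mat (- 1) ** A = - A" "A ** mat (- 1) = - A" for A :: "real^2^2"
    by (simp_all add: vec_eq_iff forall_2 matrix_matrix_mult_def sum_2 mat_def)
  have d: "det (mat (- 1) :: real^2^2) = 1" by (simp add: det_2 mat_def)
  have mm: "mat (- 1) ** mat (- 1) = (mat 1 :: real^2^2)"
    by (simp add: vec_eq_iff forall_2 matrix_matrix_mult_def sum_2 mat_def)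
  have inv: "inv\<^bsub>SL2R\<^esub> mat (- 1) = mat (- 1)" "inv\<^bsub>SL2R\<^esub> mat 1 = mat 1"
    by (rule SL2R.inv_equality; simp add: carrier_SL2R mult_SL2R one_SL2R d mm)+
  show ?thesis
  proof (rule SL2R.normalI)
    show "subgroup {mat 1, mat (- 1)} SL2R"
      by (rule SL2R.subgroupI) (auto simp: carrier_SL2R mult_SL2R d mm inv)
  qed (auto simp: r_coset_def l_coset_def mult_SL2R m)
qed

text \<open>A homomorphism from \<open>PSL2R\<close> is pulled back along the quotient map, so both
  kinds of embedded group become images of homomorphisms from \<open>SL2R\<close>.\<close>

lemma embedded_preserving_line:
  assumes v: "herm v > 0" and R: "embedded_PSL2R_or_SL2R R"
    and inv: "\<And>X. X \<in> R \<Longrightarrow> PSUh_act X {y. hip y v = 0} = {y. hip y v = 0}"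
  shows "R \<subseteq> stab v" and "subgroup R PSUh"
proof -
  have "\<exists>\<phi> \<in> hom SL2R PSUh. R = \<phi> ` carrier SL2R"
    using R unfolding embedded_PSL2R_or_SL2R_def Lie_group_embedding_def
  proof (elim disjE exE conjE)
    fix \<phi> assume \<phi>: "\<phi> \<in> hom PSL2R PSUh" and R: "R = \<phi> ` carrier PSL2R"
    let ?q = "\<lambda>M. {mat 1, mat (- 1)} #>\<^bsub>SL2R\<^esub> M"
    have "?q \<in> hom SL2R PSL2R"
      unfolding PSL2R_def by (rule normal.r_coset_hom_Mod[OF normal_pm1])
    then have "\<phi> \<circ> ?q \<in> hom SL2R PSUh" using \<phi> by (rule hom_compose)
    moreover have "R = (\<phi> \<circ> ?q) ` carrier SL2R"
      unfolding R PSL2R_def by (auto simp: FactGroup_def RCOSETS_def)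
    ultimately show ?thesis by blast
  qed blast
  then obtain \<phi> where \<phi>: "\<phi> \<in> hom SL2R PSUh" "R = \<phi> ` carrier SL2R" by blast
  show "R \<subseteq> stab v" unfolding \<phi>(2)
    by (rule hom_image_subset_stab[OF v \<phi>(1)]) (use inv \<phi>(2) in blast)
  interpret group_hom SL2R PSUh \<phi>
    using group_SL2R group_PSUh \<phi>(1) by (simp add: group_hom_def group_hom_axioms_def)
  show "subgroup R PSUh" unfolding \<phi>(2) by (rule img_is_subgroup)
qed

lemma stab_preserves_line:
  assumes "X \<in> stab v"
  shows "PSUh_act X {y. hip y v = 0} = {y. hip y v = 0}"
proof -
  obtain g where g: "g \<in> carrier SUh" "g *v v = v" "X = proj_PSUh g" using assms by (auto simp: stab_def)
  have gy: "hip (g *v y) v = hip y v" for y using SUh_hip[OF g(1), of y v] g(2) by simp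
  show ?thesis
  proof
    show "PSUh_act X {y. hip y v = 0} \<subseteq> {y. hip y v = 0}"
      unfolding PSUh_act_def g(3)
      by (auto simp: mem_proj_iff mat_mult_vec hip_linear gy simp flip: matrix_vector_mul_assoc)
    show "{y. hip y v = 0} \<subseteq> PSUh_act X {y. hip y v = 0}"
    proof
      fix y assume y: "y \<in> {y. hip y v = 0}"
      have e: "g *v (hadj g *v y) = y" by (simp add: matrix_vector_mul_assoc SUh_mult_hadj[OF g(1)])
      then have "hadj g *v y \<in> {y. hip y v = 0}" using gy[of "hadj g *v y"] y by simp
      then show "y \<in> PSUh_act X {y. hip y v = 0}"
        unfolding PSUh_act_def g(3) using self_mem_proj[of g] e by (metis UN_I imageI)
    qed
  qed
qed

section \<open>Finite index and virtually cyclic subgroups\<close>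

context group
begin

text \<open>The criterion behind the finite index proofs: \<open>f\<close> parametrises A, and
  \<open>c\<close> is a label with finitely many values, such as a residue class, whose equality
  forces equality of cosets.\<close>

lemma finite_rcosets_image:
  assumes A: "subgroup A G" and B: "subgroup B G" "B \<subseteq> A" and f: "A = f ` S"
    and fin: "finite (c ` S)" and eq: "\<And>x y. x \<in> S \<Longrightarrow> y \<in> S \<Longrightarrow> c x = c y \<Longrightarrow> f x \<otimes> inv (f y) \<in> B"
  shows "finite_index G A B"
proof -
  define h where "h x = B #> f x" for x
  have carr: "f x \<in> carrier G" if "x \<in> S" for x using subgroup.subset[OF A] f that by blast
  have "rcosets\<^bsub>G\<lparr>carrier := A\<rparr>\<^esub> B = h ` S"
    by (auto simp: RCOSETS_def r_coset_def h_def f)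
  moreover have hc: "h x = h y" if "x \<in> S" "y \<in> S" "c x = c y" for x y
  proof -
    have "f x = (f x \<otimes> inv (f y)) \<otimes> f y" using carr that by (simp add: m_assoc)
    then have "f x \<in> B #> f y" using eq[OF that] by (auto simp: r_coset_def)
    then show ?thesis unfolding h_def using repr_independence[OF _ carr[OF that(2)] B(1)] by simp
  qed
  have "h ` S \<subseteq> (\<lambda>t. h (inv_into S c t)) ` (c ` S)"
  proof (intro image_subsetI)
    fix x assume x: "x \<in> S"
    then have "c x \<in> c ` S" by blast
    then have "h x = h (inv_into S c (c x))"
      by (intro hc x inv_into_into) (simp_all add: f_inv_into_f)
    then show "h x \<in> (\<lambda>t. h (inv_into S c t)) ` (c ` S)" using x by blast
  qed
  then have "finite (h ` S)" using fin by (meson finite_imageI finite_subset)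
  ultimately show ?thesis using A B by (simp add: finite_index_def)
qed

lemma virtually_cyclic_finite:
  assumes "subgroup A G" "finite A" shows "virtually_cyclic G A"
proof -
  have "subgroup (generate G {\<one>}) G" by (rule generate_is_subgroup) simp
  moreover have "generate G {\<one>} \<subseteq> A"
    using assms(1) by (intro generate_subgroup_incl) (auto simp: subgroup.one_closed)
  ultimately have "finite_index G A (generate G {\<one>})"
    using assms subgroup.subset[OF assms(1)]
    by (intro finite_rcosets_image[where f = id and S = A and c = id])
       (auto simp: subgroup.one_closed r_inv subset_eq intro: generate.one)
  then show ?thesis unfolding virtually_cyclic_def using subgroup.one_closed[OF assms(1)] by blast
qed

lemma virtually_cyclic_generated:
  assumes "subgroup A G" "a \<in> A" "A \<subseteq> generate G {a}" shows "virtually_cyclic G A"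
proof -
  have "generate G {a} \<subseteq> A" using assms(1,2) by (intro generate_subgroup_incl) auto
  then have A: "generate G {a} = A" using assms(3) by blast
  have "finite_index G A A"
    using assms(1) by (intro finite_rcosets_image[where f = id and S = A and c = "\<lambda>_. ()"])
      (auto simp: subgroup.m_closed subgroup.m_inv_closed)
  then show ?thesis unfolding virtually_cyclic_def using A assms(2) by metis
qed

text \<open>With C generated by a of finite index in A, the exponents k with a^k in B form a cyclic
  group, so the intersection of B and C is cyclic. Its cosets in B are separated by cosets of C in
  A. Used contrapositively, to pass from a nonelementary group to a larger one.\<close>

lemma virtually_cyclic_subgroup:
  assumes A: "subgroup A G" "virtually_cyclic G A" and B: "subgroup B G" "B \<subseteq> A"
  shows "virtually_cyclic G B"
proof -
  obtain a where a: "a \<in> A" "finite_index G A (generate G {a})"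
    using A(2) by (auto simp: virtually_cyclic_def)
  define C where "C = generate G {a}"
  have ac: "a \<in> carrier G" using a(1) subgroup.subset[OF A(1)] by blast
  have C: "C = {a [^] (k :: int) | k. True}" unfolding C_def using generate_pow[OF ac] by auto
  have Csub: "subgroup C G" unfolding C_def by (rule generate_is_subgroup) (use ac in auto)
  define T where "T = real_of_int ` {k. a [^] k \<in> B}"
  have "0 \<in> T" using subgroup.one_closed[OF B(1)] by (auto simp: T_def image_iff intro!: exI[of _ 0])
  moreover have "x - y \<in> T" if xy: "x \<in> T" "y \<in> T" for x y
  proof -
    obtain i j where ij: "x = of_int i" "y = of_int j" "a [^] i \<in> B" "a [^] j \<in> B" using xy by (auto simp: T_def)
    have "a [^] (i - j) = a [^] i \<otimes> inv (a [^] j)" by (rule int_pow_diff[OF ac])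
    also have "\<dots> \<in> B" using ij B(1) by (simp add: subgroup.m_closed subgroup.m_inv_closed)
    finally show ?thesis using ij by (auto simp: T_def image_iff intro!: exI[of _ "i - j"])
  qed
  moreover have "1 \<le> \<bar>x\<bar>" if "x \<in> T" "x \<noteq> 0" for x using that by (auto simp: T_def)
  ultimately obtain t where t: "t \<in> T" "T = {of_int k * t | k. True}"
    using discrete_subgroup_real_cyclic[of T 1] by force
  obtain m where m: "t = of_int m" "a [^] m \<in> B" using t(1) by (auto simp: T_def)
  define b where "b = a [^] m"
  have bc: "b \<in> carrier G" using ac by (simp add: b_def)
  have BC: "B \<inter> C \<subseteq> generate G {b}"
  proof
    fix x assume "x \<in> B \<inter> C"
    then obtain k where k: "x = a [^] (k :: int)" "x \<in> B" using C by auto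
    then have "real_of_int k \<in> T" by (auto simp: T_def)
    then obtain j :: int where "real_of_int k = of_int j * t" using t(2) by auto
    then have "k = m * j" unfolding m(1) by (simp flip: of_int_mult add: mult.commute)
    then have "x = b [^] j" by (simp add: k(1) b_def int_pow_pow[OF ac])
    then show "x \<in> generate G {b}" using generate_pow[OF bc] by auto
  qed
  have gb: "generate G {b} \<subseteq> B" using B(1) m(2) by (intro generate_subgroup_incl) (auto simp: b_def)
  have "finite_index G B (generate G {b})"
  proof (rule finite_rcosets_image[where f = id and S = B and c = "\<lambda>x. C #> x"])
    have "(\<lambda>x. C #> x) ` B \<subseteq> rcosets\<^bsub>G\<lparr>carrier := A\<rparr>\<^esub> C"
      using B(2) by (auto simp: RCOSETS_def r_coset_def)
    then show "finite ((\<lambda>x. C #> x) ` B)" using a(2) by (auto simp: finite_index_def C_def intro: finite_subset)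
    fix x y assume xy: "x \<in> B" "y \<in> B" "C #> x = C #> y"
    have c: "x \<in> carrier G" "y \<in> carrier G" using xy subgroup.subset[OF B(1)] by auto
    have "x \<in> C #> y" using xy(3) rcos_self[OF c(1) Csub] by simp
    then obtain k where k: "k \<in> C" "x = k \<otimes> y" by (auto simp: r_coset_def)
    then have xyk: "x \<otimes> inv y = k" using c(2) subgroup.subset[OF Csub] by (auto simp: m_assoc)
    have "x \<otimes> inv y \<in> B" using xy B(1) by (simp add: subgroup.m_closed subgroup.m_inv_closed)
    then have "x \<otimes> inv y \<in> B \<inter> C" using k(1) xyk by blast
    then show "id x \<otimes> inv id y \<in> generate G {b}" using BC by auto
  qed (use B gb bc in \<open>auto intro!: generate_is_subgroup\<close>)
  then show ?thesis unfolding virtually_cyclic_def using m(2) by (auto simp: b_def)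
qed

end

section \<open>Integral matrices\<close>

lemma finite_matrices_entries:
  assumes "finite (S :: complex set)"
  shows "finite {g :: complex^3^3. \<forall>i j. g $ i $ j \<in> S}"
proof -
  define f :: "complex \<times> complex \<times> complex \<Rightarrow> complex^3" where "f = (\<lambda>(a, b, c). vector [a, b, c])"
  define V where "V = f ` (S \<times> S \<times> S)"
  define h :: "(complex^3) \<times> (complex^3) \<times> (complex^3) \<Rightarrow> complex^3^3" where "h = (\<lambda>(a, b, c). vector [a, b, c])"
  have v: "x \<in> V" if "\<forall>i. x $ i \<in> S" for x
  proof -
    have "x = f (x $ 1, x $ 2, x $ 3)" by (simp add: f_def vec_eq_iff forall_3)
    then show ?thesis unfolding V_def using that by blast
  qed
  have "{g :: complex^3^3. \<forall>i j. g $ i $ j \<in> S} \<subseteq> h ` (V \<times> V \<times> V)"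
  proof
    fix g :: "complex^3^3" assume g: "g \<in> {g. \<forall>i j. g $ i $ j \<in> S}"
    have "g = h (g $ 1, g $ 2, g $ 3)" by (simp add: h_def vec_eq_iff forall_3)
    then show "g \<in> h ` (V \<times> V \<times> V)" using v g by blast
  qed
  moreover have "finite (h ` (V \<times> V \<times> V))" using assms by (simp add: V_def)
  ultimately show ?thesis by (rule finite_subset)
qed

context imag_quad
begin

definition integral_mat :: "complex^3^3 \<Rightarrow> bool" where
  "integral_mat g \<longleftrightarrow> (\<forall>i j. g $ i $ j \<in> OK)"

lemma integral_mult: "integral_mat A \<Longrightarrow> integral_mat B \<Longrightarrow> integral_mat (A ** B)"
  by (auto simp: integral_mat_def matrix_matrix_mult_def sum_3 intro!: OK_add OK_mult)

lemma integral_add: "integral_mat A \<Longrightarrow> integral_mat B \<Longrightarrow> integral_mat (A + B)"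
  by (auto simp: integral_mat_def intro!: OK_add)

lemma integral_diff: "integral_mat A \<Longrightarrow> integral_mat B \<Longrightarrow> integral_mat (A - B)"
  by (auto simp: integral_mat_def intro!: OK_diff)

lemma integral_mat_scalar: "c \<in> OK \<Longrightarrow> integral_mat (mat c)"
  by (auto simp: integral_mat_def mat_def)

lemma integral_hadj: "integral_mat A \<Longrightarrow> integral_mat (hadj A)"
  by (auto simp: integral_mat_def hadj_def forall_3 intro!: OK_uminus OK_cnj)

lemma Gamma_eq: "Gamma K = proj_PSUh ` {g \<in> carrier SUh. integral_mat g}"
  by (simp add: Gamma_def integral_mat_def)

lemma subgroup_integral: "subgroup {g \<in> carrier SUh. integral_mat g} SUh"
proof (rule SUh.subgroupI)
  show "{g \<in> carrier SUh. integral_mat g} \<noteq> {}" using SUh_one integral_mat_scalar[OF OK_1] by blast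
qed (auto simp: inv_SUh SUh_hadj integral_hadj SUh_mult integral_mult)

lemma subgroup_Gamma: "subgroup (Gamma K) PSUh"
  unfolding Gamma_eq by (rule subgroup_proj_image[OF subgroup_integral])

lemma cube_root_unity_OK: assumes "w \<in> K" "w ^ 3 = 1" shows "w \<in> OK"
proof -
  have "algebraic_int w"
    by (intro algebraic_int.intros[of "[:-1, 0, 0, 1:]"])
       (use assms(2) in \<open>auto simp: coeff_pCons power3_eq_cube mult.assoc split: nat.splits\<close>)
  then show ?thesis using assms(1) by (simp add: ring_of_integers_def)
qed

text \<open>An eigenvalue at an integral vector is a quotient of integers of K. This is how the cube
  root of unity between two lifts is shown to be integral, so that rescaling by it preserves
  integrality.\<close>

lemma integral_eigenvalue_OK:
  assumes g: "integral_mat g" "g *v z = w *s z" and z: "z \<noteq> 0" "\<And>i. z $ i \<in> OK" and w: "w ^ 3 = 1"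
  shows "w \<in> OK"
proof -
  obtain i where i: "z $ i \<noteq> 0" using z(1) by (auto simp: vec_eq_iff)
  have "(g *v z) $ i \<in> OK"
    using g(1) z(2) by (auto simp: matrix_vector_mult_def sum_3 integral_mat_def intro!: OK_add OK_mult)
  then have "(g *v z) $ i / z $ i \<in> K" using z(2) OK_K K_divide by blast
  then have "w \<in> K" using g(2) i by simp
  then show ?thesis using w by (rule cube_root_unity_OK)
qed

end

section \<open>The fixed point of a nonelementary subgroup\<close>

context imag_quad
begin

text \<open>Each lift is diagonal in the orthogonal basis v, z, w: the line of w is preserved as the
  common orthogonal of v and z. All eigenvalues have modulus 1 since none of the basis vectors is
  isotropic. This bounds the entries, and only finitely many integral matrices remain.\<close>

lemma orthogonal_fixed_points_finite:
  assumes v: "herm v > 0" and z: "herm z > 0" and orth: "hip v z = 0"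
    and F: "\<And>X. X \<in> F \<Longrightarrow> \<exists>g l m. g \<in> carrier SUh \<and> integral_mat g \<and> X = proj_PSUh g \<and> g *v v = l *s v \<and> g *v z = m *s z"
  shows "finite F"
proof -
  define w where "w = hcross z v"
  have hw: "herm w = - (herm z * herm v)" unfolding w_def by (rule herm_w[OF orth z v])
  \<comment> \<open>From the triangle inequality for the frame expansion of \<open>axis j 1\<close>:
    \<open>r i j\<close> bounds \<open>herm z * herm v\<close> times the modulus of an entry, and
    the double sum in \<open>B\<close> makes the bound uniform.\<close>
  define r where "r i j = herm z * cmod (hip (axis j 1) v) * cmod (v $ i)
      + cmod (hip (axis j 1) w) * cmod (w $ i) + herm v * cmod (hip (axis j 1) z) * cmod (z $ i)" for i j :: 3
  define B where "B = (\<Sum>i\<in>UNIV. \<Sum>j\<in>UNIV. r i j) / (herm z * herm v)"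
  have r0: "r i j \<ge> 0" for i j using v z by (simp add: r_def)
  have bound: "cmod (g $ i $ j) \<le> B"
    if g: "g \<in> carrier SUh" "g *v v = l *s v" "g *v z = m *s z" for g l m i j
  proof -
    have unit: "cmod k = 1" if "g *v x = k *s x" "herm x \<noteq> 0" for x k
    proof -
      have "herm (k *s x) = herm x" using SUh_hip[OF g(1), of x x] that(1) by (simp add: herm_eq_Re_hip)
      then have "(cmod k)\<^sup>2 = 1" using that(2) by (simp add: herm_scale)
      then show ?thesis using power_eq_imp_eq_base[of "cmod k" 2 1] by simp
    qed
    have l: "cmod l = 1" and m: "cmod m = 1" using unit g(2,3) v z by auto
    have perp: "hip (g *v w) x = 0" if "g *v x = k *s x" "cmod k = 1" "hip w x = 0" for x k
    proof -
      have "cnj k * hip (g *v w) x = hip w x" using SUh_hip[OF g(1), of w x] that(1) by (simp add: hip_scale_right)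
      then show ?thesis using that(2,3) by auto
    qed
    have "hip w v = 0" "hip w z = 0" unfolding w_def by (rule hip_hcross_self')+
    then have "hip (g *v w) v = 0" "hip (g *v w) z = 0"
      using perp[OF g(2) l] perp[OF g(3) m] by auto
    then have eq: "of_real (herm z * herm v) *s (g *v w) = - (hip (g *v w) w *s w)"
      using frame_expansion[OF orth z v, of "g *v w"] by (simp add: w_def)
    define n where "n = - hip (g *v w) w / of_real (herm z * herm v)"
    have "of_real (herm z * herm v) * n = - hip (g *v w) w" using v z by (simp add: n_def)
    then have "of_real (herm z * herm v) *s (n *s w) = - (hip (g *v w) w *s w)"
      by (simp only: vector_smult_assoc vector_smult_lneg)
    then have "of_real (herm z * herm v) *s (g *v w) = of_real (herm z * herm v) *s (n *s w)" using eq by simp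
    then have gw: "g *v w = n *s w" using v z by (simp only: vector_mul_lcancel) simp
    have n: "cmod n = 1" using unit[OF gw] hw v z by simp
    have "of_real (herm z * herm v) *s (g *v axis j 1) = g *v (of_real (herm z * herm v) *s axis j 1)"
      by (simp add: vector_scalar_commute)
    also have "\<dots> = (of_real (herm z) * hip (axis j 1) v) *s (l *s v) - hip (axis j 1) w *s (n *s w)
        + (of_real (herm v) * hip (axis j 1) z) *s (m *s z)"
      unfolding frame_expansion[OF orth z v] w_def[symmetric]
      by (simp only: matrix_vector_right_distrib matrix_vector_mult_diff_distrib vector_scalar_commute g(2,3) gw)
    finally have "of_real (herm z * herm v) * g $ i $ j = of_real (herm z) * hip (axis j 1) v * (l * v $ i)
        - hip (axis j 1) w * (n * w $ i) + of_real (herm v) * hip (axis j 1) z * (m * z $ i)"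
      using exhaust_3[of j] by (auto simp: vec_eq_iff matrix_vector_mult_def sum_3 axis_def mult.assoc)
    then have "herm z * herm v * cmod (g $ i $ j) = cmod (of_real (herm z) * hip (axis j 1) v * (l * v $ i)
        - hip (axis j 1) w * (n * w $ i) + of_real (herm v) * hip (axis j 1) z * (m * z $ i))"
      using v z by (metis abs_of_pos mult_pos_pos norm_mult norm_of_real)
    also have "\<dots> \<le> cmod (of_real (herm z) * hip (axis j 1) v * (l * v $ i))
        + cmod (hip (axis j 1) w * (n * w $ i)) + cmod (of_real (herm v) * hip (axis j 1) z * (m * z $ i))"
      by (meson add_right_mono norm_triangle_ineq norm_triangle_ineq4 order_trans)
    also have "\<dots> = r i j" using v z by (simp add: r_def norm_mult l m n)
    also have "\<dots> \<le> (\<Sum>j\<in>UNIV. r i j)" using r0 by (intro member_le_sum) auto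
    also have "\<dots> \<le> (\<Sum>i\<in>UNIV. \<Sum>j\<in>UNIV. r i j)"
      using r0 by (intro member_le_sum[of i UNIV "\<lambda>i. \<Sum>j\<in>UNIV. r i j"]) (auto intro: sum_nonneg)
    finally show ?thesis using v z by (simp add: B_def field_simps)
  qed
  have "F \<subseteq> proj_PSUh ` {g. \<forall>i j. g $ i $ j \<in> {x \<in> OK. cmod x \<le> B}}"
  proof
    fix X assume "X \<in> F"
    then obtain g l m where g: "g \<in> carrier SUh" "integral_mat g" "X = proj_PSUh g" "g *v v = l *s v" "g *v z = m *s z"
      using F by blast
    then show "X \<in> proj_PSUh ` {g. \<forall>i j. g $ i $ j \<in> {x \<in> OK. cmod x \<le> B}}"
      using bound[OF g(1,4,5)] by (auto simp: integral_mat_def)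
  qed
  then show ?thesis using finite_matrices_entries[OF OK_bounded_finite] by (meson finite_imageI finite_subset)
qed

end

section \<open>Unipotent one-parameter groups and their integral points\<close>

lemma matrix_add_distrib_right: "(A + B) ** C = A ** C + B ** C" for A :: "complex^3^3"
  by (simp add: vec_eq_iff matrix_matrix_mult_def sum_3 algebra_simps)

text \<open>The identity plus t times the square-zero matrix with column factor (p, q) and row
  factor (q, -p), which annihilates the vector (p, q).\<close>

definition shear :: "real \<Rightarrow> real \<Rightarrow> real \<Rightarrow> real^2^2" where
  "shear p q t = vector [vector [1 + t * (p * q), - (t * p\<^sup>2)], vector [t * q\<^sup>2, 1 - t * (p * q)]]"

lemma det_shear: "det (shear p q t) = 1"
  by (simp add: shear_def det_2 power2_eq_square algebra_simps)

lemma shear_add: "shear p q (s + t) = shear p q s ** shear p q t"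
  by (simp add: shear_def vec_eq_iff forall_2 matrix_matrix_mult_def sum_2 power2_eq_square algebra_simps)

lemma shear_0: "shear p q 0 = mat 1"
  by (simp add: shear_def vec_eq_iff forall_2 mat_def)

lemma fixes_vector_shear:
  assumes "det M = 1" "M $ 1 $ 1 * p + M $ 1 $ 2 * q = p" "M $ 2 $ 1 * p + M $ 2 $ 2 * q = q" "p \<noteq> 0 \<or> q \<noteq> 0"
  obtains t where "M = shear p q t"
proof (cases "p \<noteq> 0")
  case True
  define x y s r where "x = M $ 1 $ 1 - 1" and "y = M $ 1 $ 2" and "s = M $ 2 $ 1" and "r = M $ 2 $ 2 - 1"
  have 1: "x * p = - y * q" "s * p = - r * q"
    using assms(2,3) by (simp_all add: x_def y_def s_def r_def algebra_simps)
  \<comment> \<open>M - 1 annihilates a nonzero vector, so its determinant x r - y s vanishes.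
    Together with det M = 1 this makes its trace x + r vanish as well.\<close>
  have "(x * r - y * s) * p = (x * p) * r - y * (s * p)" by (simp add: algebra_simps)
  also have "\<dots> = 0" unfolding 1 by simp
  finally have "(x * r - y * s) * p = 0" .
  then have "x * r - y * s = 0" using True by simp
  moreover have "(x + 1) * (r + 1) - y * s = 1" using assms(1) by (simp add: det_2 x_def y_def s_def r_def)
  ultimately have r: "r = - x" by (simp add: algebra_simps)
  define t where "t = - y / p\<^sup>2"
  have x: "x = - y * q / p" and s: "s = x * q / p" using 1 r True by (simp_all add: field_simps)
  have "y = - (t * p\<^sup>2)" "x = t * (p * q)" "s = t * q\<^sup>2"
    using True unfolding s x t_def by (simp_all add: power2_eq_square)
  then have "M = shear p q t" using r
    by (simp add: shear_def vec_eq_iff forall_2 x_def y_def s_def r_def algebra_simps)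
  then show thesis by (rule that)
next
  case False
  then have "p = 0" "q \<noteq> 0" using assms(4) by auto
  then have "M $ 1 $ 2 = 0" "M $ 2 $ 2 = 1" using assms(2,3) by auto
  then have "M $ 1 $ 1 = 1" using assms(1) by (simp add: det_2)
  have "M = shear p q (M $ 2 $ 1 / q\<^sup>2)"
    using \<open>p = 0\<close> \<open>q \<noteq> 0\<close> \<open>M $ 1 $ 2 = 0\<close> \<open>M $ 2 $ 2 = 1\<close> \<open>M $ 1 $ 1 = 1\<close>
    by (simp add: shear_def vec_eq_iff forall_2)
  then show thesis by (rule that)
qed

text \<open>The dependence on t is affine with a fixed nonzero direction Q. This is what turns
  integrality of the entries into a lower bound for |t|.\<close>

lemma su11_shear:
  obtains Q where "\<And>t. su11 (shear p q t) = mat 1 + mat (of_real t) ** Q" "p \<noteq> 0 \<or> q \<noteq> 0 \<Longrightarrow> Q \<noteq> 0"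
proof -
  define Q :: "complex^3^3" where "Q = vector [vector [of_real (p * q), 0, - \<i> * of_real (p\<^sup>2)], vector [0, 0, 0],
    vector [- \<i> * of_real (q\<^sup>2), 0, - of_real (p * q)]]"
  have "su11 (shear p q t) = mat 1 + mat (of_real t) ** Q" for t
    unfolding matrix_mult_mat_scalar
    by (simp add: su11_def E_emb_def sl2_twist_def shear_def Q_def vec_eq_iff forall_3 mat_def algebra_simps)
  moreover have "Q \<noteq> 0" if "p \<noteq> 0 \<or> q \<noteq> 0" using that by (auto simp: Q_def vec_eq_iff forall_3)
  ultimately show thesis by (rule that)
qed

context imag_quad
begin

lemma common_fixed_vector_virtually_cyclic:
  assumes v: "herm v > 0" and nonpar: "\<And>k. z \<noteq> k *s v" and sub: "subgroup F PSUh"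
    and F: "\<And>X. X \<in> F \<Longrightarrow> \<exists>g. g \<in> carrier SUh \<and> integral_mat g \<and> X = proj_PSUh g \<and> g *v v = v \<and> g *v z = z"
  shows "virtually_cyclic PSUh F"
proof -
  obtain \<gamma> k where \<gamma>: "\<gamma> \<in> carrier SUh" "\<gamma> *v axis 2 1 = k *s v" "k \<noteq> 0"
    by (rule positive_vector_frame[OF v])
  define u where "u = hadj \<gamma> *v z"
  have zu: "z = \<gamma> *v u" by (simp add: u_def matrix_vector_mul_assoc SUh_mult_hadj[OF \<gamma>(1)])
  have u: "u $ 1 \<noteq> 0 \<or> u $ 3 \<noteq> 0"
  proof (rule ccontr)
    assume "\<not> (u $ 1 \<noteq> 0 \<or> u $ 3 \<noteq> 0)"
    then have "u = u $ 2 *s axis 2 1" by (simp add: vec_eq_iff forall_3 axis_def)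
    then have "z = u $ 2 *s (k *s v)" using zu \<gamma>(2) by (metis vector_scalar_commute)
    then have "z = (u $ 2 * k) *s v" by simp
    then show False using nonpar by blast
  qed
  \<comment> \<open>The factor i undoes the twist in \<open>sl2_twist\<close>: the real matrix M
    fixes the complex vector (a, b), hence its real and imaginary parts, and (p, q) is a nonzero one
    of these. It depends only on z and \<gamma>, so all of F lies in one unipotent group.\<close>
  define a b where "a = u $ 1" and "b = \<i> * u $ 3"
  have ab: "a \<noteq> 0 \<or> b \<noteq> 0" using u by (simp add: a_def b_def)
  obtain p q where pq: "p \<noteq> 0 \<or> q \<noteq> 0" "(p, q) = (Re a, Re b) \<or> (p, q) = (Im a, Im b)"
    using ab unfolding complex_eq_iff by force
  define h where "h t = conj_su11 \<gamma> (shear p q t)" for t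
  have hSU: "h t \<in> carrier SUh" for t unfolding h_def by (rule conj_su11_SUh[OF \<gamma> det_shear])
  have h_add: "h (s + t) = h s ** h t" for s t
    by (simp add: h_def shear_add conj_su11_mult[OF \<gamma>])
  have h_0: "h 0 = mat 1" by (simp add: h_def shear_0 conj_su11_one[OF \<gamma>])
  have h_neg: "h (- t) = hadj (h t)" for t
  proof -
    have "h (- t) ** h t = mat 1" by (simp add: h_0 flip: h_add)
    then have "h (- t) ** (h t ** hadj (h t)) = hadj (h t)" by (simp add: matrix_mul_assoc)
    then show ?thesis by (simp add: SUh_mult_hadj[OF hSU])
  qed
  define T where "T = {t. integral_mat (h t) \<and> proj_PSUh (h t) \<in> F}"
  have FT: "\<exists>t\<in>T. X = proj_PSUh (h t)" if X: "X \<in> F" for X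
  proof -
    obtain g where g: "g \<in> carrier SUh" "integral_mat g" "X = proj_PSUh g" "g *v v = v" "g *v z = z"
      using F[OF X] by blast
    obtain M where M: "det M = 1" "g = conj_su11 \<gamma> M" by (rule fixing_conj_su11[OF \<gamma> g(1,4)])
    have "su11 M *v u = hadj \<gamma> *v (g *v z)"
    proof -
      have "hadj \<gamma> *v (g *v z) = (hadj \<gamma> ** \<gamma>) *v (su11 M *v (hadj \<gamma> *v z))"
        by (simp add: M(2) conj_su11_def matrix_vector_mul_assoc matrix_mul_assoc)
      then show ?thesis by (simp add: SUh_hadj_mult[OF \<gamma>(1)] u_def)
    qed
    then have "su11 M *v u = u" by (simp add: g(5) u_def)
    then have "of_real (M $ 1 $ 1) * u $ 1 + \<i> * of_real (M $ 1 $ 2) * u $ 3 = u $ 1"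
      "- \<i> * of_real (M $ 2 $ 1) * u $ 1 + of_real (M $ 2 $ 2) * u $ 3 = u $ 3"
      by (simp_all add: su11_def E_emb_def sl2_twist_def vec_eq_iff forall_3 matrix_vector_mult_def sum_3)
    then have "of_real (M $ 1 $ 1) * a + of_real (M $ 1 $ 2) * b = a"
      "of_real (M $ 2 $ 1) * a + of_real (M $ 2 $ 2) * b = b"
      by (auto simp: a_def b_def complex_eq_iff)
    then have "M $ 1 $ 1 * p + M $ 1 $ 2 * q = p" "M $ 2 $ 1 * p + M $ 2 $ 2 * q = q"
      using pq(2) by (auto simp: complex_eq_iff)
    then obtain t where "M = shear p q t" using fixes_vector_shear[OF M(1) _ _ pq(1)] by blast
    then have "g = h t" using M(2) by (simp add: h_def)
    then show ?thesis using g X by (auto simp: T_def)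
  qed
  obtain Q where Q: "\<And>t. su11 (shear p q t) = mat 1 + mat (of_real t) ** Q" "p \<noteq> 0 \<or> q \<noteq> 0 \<Longrightarrow> Q \<noteq> 0"
    using su11_shear by blast
  define P where "P = \<gamma> ** Q ** hadj \<gamma>"
  have hP: "h t = mat 1 + mat (of_real t) ** P" for t
  proof -
    have "h t = \<gamma> ** hadj \<gamma> + \<gamma> ** (mat (of_real t) ** Q) ** hadj \<gamma>"
      by (simp add: h_def conj_su11_def Q(1) matrix_add_ldistrib matrix_add_distrib_right)
    also have "\<gamma> ** (mat (of_real t) ** Q) ** hadj \<gamma> = mat (of_real t) ** P"
      unfolding P_def by (simp add: matrix_mul_assoc mat_commute[of _ \<gamma>])
    finally show ?thesis by (simp add: SUh_mult_hadj[OF \<gamma>(1)])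
  qed
  have "P \<noteq> 0"
  proof
    assume "P = 0"
    then have "hadj \<gamma> ** P ** \<gamma> = 0" by (simp add: vec_eq_iff matrix_matrix_mult_def)
    moreover have "hadj \<gamma> ** P ** \<gamma> = (hadj \<gamma> ** \<gamma>) ** Q ** (hadj \<gamma> ** \<gamma>)"
      by (simp add: P_def matrix_mul_assoc)
    ultimately show False using Q(2)[OF pq(1)] by (simp add: SUh_hadj_mult[OF \<gamma>(1)])
  qed
  then obtain i j where Pij: "P $ i $ j \<noteq> 0" by (auto simp: vec_eq_iff)
  have "0 \<in> T" using subgroup.one_closed[OF sub] integral_mat_scalar[OF OK_1] by (simp add: T_def h_0 proj_one)
  moreover have "x - y \<in> T" if "x \<in> T" "y \<in> T" for x y
  proof -
    have e: "h (x - y) = h x ** hadj (h y)" using h_add[of x "- y"] by (simp add: h_neg)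
    have "integral_mat (h (x - y))" unfolding e using that by (intro integral_mult integral_hadj) (auto simp: T_def)
    moreover have "proj_PSUh (h (x - y)) = proj_PSUh (h x) \<otimes>\<^bsub>PSUh\<^esub> inv\<^bsub>PSUh\<^esub> (proj_PSUh (h y))"
      unfolding e by (simp add: proj_mult proj_inv hSU SUh_hadj)
    ultimately show ?thesis using that sub by (simp add: T_def subgroup.m_closed subgroup.m_inv_closed)
  qed
  moreover have "1 / cmod (P $ i $ j) \<le> \<bar>t\<bar>" if "t \<in> T" "t \<noteq> 0" for t
  proof -
    have "integral_mat (h t - mat 1)" using that by (intro integral_diff integral_mat_scalar) (auto simp: T_def)
    then have "of_real t * P $ i $ j \<in> OK"
      unfolding hP by (simp add: integral_mat_def matrix_mult_mat_scalar)
    moreover have "of_real t * P $ i $ j \<noteq> 0" using that(2) Pij by simp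
    ultimately have "1 \<le> cmod (of_real t * P $ i $ j)" by (rule OK_norm_ge_1)
    then show ?thesis using Pij by (simp add: norm_mult field_simps)
  qed
  ultimately obtain t where t: "t \<in> T" "T = {of_int k * t | k. True}"
    using discrete_subgroup_real_cyclic[of T "1 / cmod (P $ i $ j)"] Pij by force
  define X where "X = proj_PSUh (h t)"
  have XF: "X \<in> F" using t(1) by (simp add: T_def X_def)
  have Xc: "X \<in> carrier PSUh" using XF subgroup.subset[OF sub] by blast
  have gen: "subgroup (generate PSUh {X}) PSUh" by (rule PSUh.generate_is_subgroup) (use Xc in auto)
  have Xg: "X \<in> generate PSUh {X}" by (rule generate.incl) simp
  have nat: "proj_PSUh (h (of_nat n * t)) \<in> generate PSUh {X}" for n
  proof (induction n)
    case 0
    show ?case using subgroup.one_closed[OF gen] by (simp add: h_0 proj_one)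
  next
    case (Suc n)
    have "h (of_nat (Suc n) * t) = h t ** h (of_nat n * t)" by (simp add: distrib_right flip: h_add)
    then have "proj_PSUh (h (of_nat (Suc n) * t)) = X \<otimes>\<^bsub>PSUh\<^esub> proj_PSUh (h (of_nat n * t))"
      by (simp add: proj_mult hSU X_def)
    then show ?case using subgroup.m_closed[OF gen Xg Suc] by simp
  qed
  have int: "proj_PSUh (h (of_int k * t)) \<in> generate PSUh {X}" for k
  proof (cases "k \<ge> 0")
    case True
    then show ?thesis using nat[of "nat k"] by simp
  next
    case False
    then have "of_int k * t = - (of_nat (nat (- k)) * t)" by simp
    then have "proj_PSUh (h (of_int k * t)) = inv\<^bsub>PSUh\<^esub> (proj_PSUh (h (of_nat (nat (- k)) * t)))"
      by (simp only: h_neg proj_inv[OF hSU])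
    then show ?thesis using subgroup.m_inv_closed[OF gen nat] by simp
  qed
  have "F \<subseteq> generate PSUh {X}" using FT t(2) int by blast
  then show ?thesis by (rule PSUh.virtually_cyclic_generated[OF sub XF])
qed

lemma nonelementary_fixed_point:
  assumes v: "herm v > 0" and sub: "subgroup F PSUh" and F: "F \<subseteq> Gamma K \<inter> stab v"
    and ne: "\<not> virtually_cyclic PSUh F"
    and z: "\<And>i. z $ i \<in> OK" "herm z > 0" "\<And>X. X \<in> F \<Longrightarrow> PSUh_act X (vec.span {z}) = vec.span {z}"
  obtains k where "k \<noteq> 0" "z = k *s v"
proof (rule ccontr)
  assume *: "\<not> thesis"
  have z0: "z \<noteq> 0" using z(2) by (auto simp: herm_def)
  have nonpar: "z \<noteq> k *s v" for k
  proof
    assume zk: "z = k *s v"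
    then have "k \<noteq> 0" using z0 by auto
    then show False using * that zk by blast
  qed
  have ex: "\<exists>g g0 w l. g \<in> carrier SUh \<and> integral_mat g \<and> X = proj_PSUh g \<and> g0 \<in> carrier SUh \<and>
      X = proj_PSUh g0 \<and> g0 *v v = v \<and> w ^ 3 = 1 \<and> g = mat w ** g0 \<and> g *v z = l *s z" if X: "X \<in> F" for X
  proof -
    have "X \<in> Gamma K" "X \<in> stab v" using F X by auto
    then obtain g g0 where g: "g \<in> carrier SUh" "integral_mat g" "X = proj_PSUh g"
      and g0: "g0 \<in> carrier SUh" "X = proj_PSUh g0" "g0 *v v = v"
      by (auto simp: Gamma_eq stab_def)
    obtain w where w: "w ^ 3 = 1" "g = mat w ** g0" using proj_eqD[of g g0] g(3) g0(2) by metis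
    have "z \<in> vec.span {z}" by (rule vec.span_base) simp
    then have "g *v z \<in> PSUh_act X (vec.span {z})"
      unfolding PSUh_act_def g(3) using self_mem_proj[of g] by blast
    then have "g *v z \<in> vec.span {z}" using z(3)[OF X] by simp
    then obtain l where "g *v z = l *s z" by (auto simp: vec.span_singleton)
    then show ?thesis using g g0 w by blast
  qed
  have gv: "(mat w ** g0) *v v = w *s v" if "g0 *v v = v" for w g0
    using that by (simp add: mat_mult_vec flip: matrix_vector_mul_assoc)
  show False
  proof (cases "hip v z = 0")
    case True
    have "finite F"
    proof (rule orthogonal_fixed_points_finite[OF v z(2) True])
      fix X assume "X \<in> F"
      then show "\<exists>g l m. g \<in> carrier SUh \<and> integral_mat g \<and> X = proj_PSUh g \<and> g *v v = l *s v \<and> g *v z = m *s z"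
        using ex gv by metis
    qed
    then show False using PSUh.virtually_cyclic_finite[OF sub] ne by blast
  next
    case False
    have "virtually_cyclic PSUh F"
    proof (rule common_fixed_vector_virtually_cyclic[OF v nonpar sub])
      fix X assume "X \<in> F"
      then obtain g g0 w l where g: "g \<in> carrier SUh" "integral_mat g" "X = proj_PSUh g"
        and g0: "g0 \<in> carrier SUh" "X = proj_PSUh g0" "g0 *v v = v"
        and w: "w ^ 3 = 1" "g = mat w ** g0" and l: "g *v z = l *s z" using ex by blast
      \<comment> \<open>Invariance of the nonzero product of v and z forces the eigenvalues of the
        integral lift at v and z to agree. So w is an eigenvalue at the integral vector z and lies
        in \<open>OK\<close>, and dividing by it yields a lift that is integral and fixes both
        vectors.\<close>
      have "hip v z = w * cnj l * hip v z"
        using SUh_hip[OF g(1), of v z] l gv[OF g0(3), of w] by (simp add: w(2) hip_linear)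
      then have "w * cnj l = 1" using False by simp
      then have "cnj w * l = 1" by (metis complex_cnj_cnj complex_cnj_mult complex_cnj_one)
      have "l = w"
      proof -
        have "l = (w * cnj w) * l" using cube_root_unity_cnj[OF w(1)] by simp
        also have "\<dots> = w * (cnj w * l)" by simp
        finally show ?thesis using \<open>cnj w * l = 1\<close> by simp
      qed
      then have "w \<in> OK" using integral_eigenvalue_OK[OF g(2) _ z0 z(1) w(1)] l by simp
      have g0g: "g0 = mat (cnj w) ** g"
        using cube_root_unity_cnj[OF w(1)] by (simp add: w(2) matrix_mul_assoc mat_mult_mat mult.commute)
      then have "integral_mat g0" using g(2) \<open>w \<in> OK\<close> by (simp add: integral_mult integral_mat_scalar OK_cnj)
      moreover have "g0 *v z = z"
        using l \<open>l = w\<close> \<open>cnj w * l = 1\<close> by (simp add: g0g mat_mult_vec flip: matrix_vector_mul_assoc)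
      ultimately show "\<exists>g. g \<in> carrier SUh \<and> integral_mat g \<and> X = proj_PSUh g \<and> g *v v = v \<and> g *v z = z"
        using g0 by blast
    qed
    then show False using ne by blast
  qed
qed

end

section \<open>The quaternion algebra\<close>

text \<open>i goes to diag(r, -r) and j to s times the coordinate swap. With r real and s imaginary
  the diagonal is real and the rest imaginary, which is the shape demanded by
  \<open>E_emb_SUh\<close>.\<close>

fun quat_rep :: "complex \<Rightarrow> complex \<Rightarrow> quat \<Rightarrow> complex^2^2" where
  "quat_rep r s (x0, x1, x2, x3) =
     vector [vector [of_rat x0 + of_rat x1 * r, s * (of_rat x2 + of_rat x3 * r)],
       vector [s * (of_rat x2 - of_rat x3 * r), of_rat x0 - of_rat x1 * r]]"

lemma quat_rep_mult:
  assumes "r * r = of_int a" "s * s = of_int b"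
  shows "quat_rep r s (quat_mult a b x y) = quat_rep r s x ** quat_rep r s y"
proof (cases x; cases y)
  fix x0 x1 x2 x3 y0 y1 y2 y3 assume xy: "x = (x0, x1, x2, x3)" "y = (y0, y1, y2, y3)"
  show ?thesis unfolding xy
    by (simp add: vec_eq_iff forall_2 matrix_matrix_mult_def sum_2 of_rat_add of_rat_mult of_rat_diff
        of_rat_minus assms[symmetric] algebra_simps)
qed

lemma quat_algebra_morphism_rep:
  assumes "r * r = of_int a" "s * s = of_int b"
  shows "quat_algebra_morphism a b (quat_rep r s)"
  unfolding quat_algebra_morphism_def
proof (intro conjI allI)
  show "quat_rep r s (x + y) = quat_rep r s x + quat_rep r s y" for x y
    by (cases x; cases y) (simp add: vec_eq_iff forall_2 of_rat_add algebra_simps)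
  show "quat_rep r s (quat_scale q x) = (\<chi> i j. of_rat q * quat_rep r s x $ i $ j)" for q x
    by (cases x) (simp add: vec_eq_iff forall_2 of_rat_mult algebra_simps)
  show "quat_rep r s (quat_mult a b x y) = quat_rep r s x ** quat_rep r s y" for x y
    by (rule quat_rep_mult[OF assms])
  show "quat_rep r s (1, 0, 0, 0) = mat 1"
    by (simp add: vec_eq_iff forall_2 mat_def)
qed

lemma det_quat_rep:
  assumes "r * r = of_int a" "s * s = of_int b"
  shows "det (quat_rep r s x) = of_rat (quat_norm a b x)"
proof (cases x)
  fix x0 x1 x2 x3 assume x: "x = (x0, x1, x2, x3)"
  show ?thesis unfolding x
    by (simp add: det_2 of_rat_add of_rat_mult of_rat_diff power2_eq_square assms[symmetric] algebra_simps)
qed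

fun quat_conj :: "quat \<Rightarrow> quat" where
  "quat_conj (x0, x1, x2, x3) = (x0, - x1, - x2, - x3)"

lemma quat_mult_conj: "quat_mult a b x (quat_conj x) = (quat_norm a b x, 0, 0, 0)"
  and quat_conj_mult: "quat_mult a b (quat_conj x) x = (quat_norm a b x, 0, 0, 0)"
  by (cases x; simp add: power2_eq_square algebra_simps)+

lemma quat_norm_conj: "quat_norm a b (quat_conj x) = quat_norm a b x"
  by (cases x) simp

abbreviation int_quats :: "quat set" where
  "int_quats \<equiv> \<int> \<times> \<int> \<times> \<int> \<times> \<int>"

lemma quat_mult_int: "x \<in> int_quats \<Longrightarrow> y \<in> int_quats \<Longrightarrow> quat_mult a b x y \<in> int_quats"
  by (cases x; cases y) (auto intro!: Ints_add Ints_diff Ints_mult)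

lemma quat_conj_int: "x \<in> int_quats \<Longrightarrow> quat_conj x \<in> int_quats"
  by (cases x) auto

lemma quat_order_conj: "x \<in> quat_order_norm1 a b \<Longrightarrow> quat_conj x \<in> quat_order_norm1 a b"
  unfolding quat_order_norm1_def mem_Collect_eq quat_norm_conj using quat_conj_int by blast

lemma quat_norm_mult:
  fixes r s :: complex
  assumes "r * r = of_int a" "s * s = of_int b"
  shows "quat_norm a b (quat_mult a b x y) = quat_norm a b x * quat_norm a b y"
proof -
  have "of_rat (quat_norm a b (quat_mult a b x y)) = (of_rat (quat_norm a b x * quat_norm a b y) :: complex)"
    unfolding of_rat_mult det_quat_rep[OF assms, symmetric] by (simp add: quat_rep_mult[OF assms] det_mul)
  then show ?thesis by (simp only: of_rat_eq_iff)
qed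

text \<open>The quaternion acting on the plane of the frame vectors u, w, now with entries in K. The
  zero third row and column keep it linear in x; adding \<open>third_proj\<close> restores the fixed
  vector z.\<close>

fun quat_mat0 :: "complex \<Rightarrow> complex \<Rightarrow> quat \<Rightarrow> complex^3^3" where
  "quat_mat0 D s (x0, x1, x2, x3) = vector [
     vector [of_rat x0 - s * of_rat x2, D * (of_rat x1 + s * of_rat x3), 0],
     vector [of_rat x1 - s * of_rat x3, of_rat x0 + s * of_rat x2, 0],
     vector [0, 0, 0]]"

definition third_proj :: "complex^3^3" where
  "third_proj = vector [0, 0, vector [0, 0, 1]]"

text \<open>The u and w rows of \<open>frame_trans\<close> differ in scale by sqrt D, and this is
  what absorbs the sqrt D of \<open>quat_rep\<close> and leaves the entries of
  \<open>quat_mat0\<close>.\<close>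

lemma frame_trans_quat_rep:
  assumes D: "D > 0" and c: "c > 0"
  shows "frame_trans D c ** E_emb (quat_rep (of_real (sqrt D)) s x)
    = (quat_mat0 (of_real D) s x + third_proj) ** frame_trans D c"
proof (cases x)
  fix x0 x1 x2 x3 assume x: "x = (x0, x1, x2, x3)"
  define b where "b = complex_of_real (1 / sqrt (2 * D * c))"
  define r where "r = complex_of_real (sqrt D)"
  define d where "d = complex_of_real (1 / sqrt D)"
  have rr: "of_real D = r * r" using D by (simp add: r_def flip: of_real_mult)
  have "1 / sqrt (2 * c) = sqrt D * (1 / sqrt (2 * D * c))"
    using D c by (simp add: real_sqrt_mult)
  then have a: "complex_of_real (1 / sqrt (2 * c)) = r * b" unfolding r_def b_def by (simp only: of_real_mult)
  show ?thesis
    unfolding x frame_trans_def a b_def[symmetric] d_def[symmetric] r_def[symmetric] rr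
    by (simp add: E_emb_def third_proj_def vec_eq_iff forall_3 matrix_matrix_mult_def sum_3 algebra_simps)
qed

lemma quat_mat0_add: "quat_mat0 D s (x + y) = quat_mat0 D s x + quat_mat0 D s y"
  by (cases x; cases y) (simp add: vec_eq_iff forall_3 of_rat_add algebra_simps)

lemma quat_mat0_scale: "quat_mat0 D s (quat_scale q x) = mat (of_rat q) ** quat_mat0 D s x"
  unfolding matrix_mult_mat_scalar
  by (cases x) (simp add: vec_eq_iff forall_3 of_rat_mult algebra_simps)

lemma quat_mat0_one: "quat_mat0 D s (1, 0, 0, 0) + third_proj = mat 1"
  by (simp add: third_proj_def vec_eq_iff forall_3 mat_def)

lemma subgroup_conj_SUh:
  assumes S: "subgroup S SUh" and \<gamma>: "\<gamma> \<in> carrier SUh"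
  shows "subgroup ((\<lambda>g. hadj \<gamma> ** g ** \<gamma>) ` S) SUh"
proof (rule SUh.subgroupI)
  have sub: "S \<subseteq> carrier SUh" by (rule subgroup.subset[OF S])
  show "(\<lambda>g. hadj \<gamma> ** g ** \<gamma>) ` S \<subseteq> carrier SUh" using sub \<gamma> by (auto intro!: SUh_mult SUh_hadj)
  show "(\<lambda>g. hadj \<gamma> ** g ** \<gamma>) ` S \<noteq> {}" using subgroup.one_closed[OF S] by blast
  fix a assume "a \<in> (\<lambda>g. hadj \<gamma> ** g ** \<gamma>) ` S"
  then obtain g where g: "g \<in> S" "a = hadj \<gamma> ** g ** \<gamma>" by blast
  have gc: "g \<in> carrier SUh" using g(1) sub by blast
  have "a \<in> carrier SUh" using g(2) gc \<gamma> by (auto intro!: SUh_mult SUh_hadj)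
  then have "inv\<^bsub>SUh\<^esub> a = hadj \<gamma> ** hadj g ** \<gamma>"
    by (simp add: inv_SUh g(2) hadj_mult matrix_mul_assoc)
  moreover have "hadj g \<in> S" using subgroup.m_inv_closed[OF S g(1)] gc by (simp add: inv_SUh)
  ultimately show "inv\<^bsub>SUh\<^esub> a \<in> (\<lambda>g. hadj \<gamma> ** g ** \<gamma>) ` S" by blast
  fix b assume "b \<in> (\<lambda>g. hadj \<gamma> ** g ** \<gamma>) ` S"
  then obtain h where h: "h \<in> S" "b = hadj \<gamma> ** h ** \<gamma>" by blast
  have "a ** b = hadj \<gamma> ** g ** (\<gamma> ** hadj \<gamma>) ** h ** \<gamma>" by (simp add: g h matrix_mul_assoc)
  then have "a ** b = hadj \<gamma> ** (g ** h) ** \<gamma>" by (simp add: SUh_mult_hadj[OF \<gamma>] matrix_mul_assoc)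
  then show "a \<otimes>\<^bsub>SUh\<^esub> b \<in> (\<lambda>g. hadj \<gamma> ** g ** \<gamma>) ` S"
    using subgroup.m_closed[OF S g(1) h(1)] by auto
qed

lemma mat_left_commute: "mat c ** (A ** B) = A ** (mat c ** B)" for A B :: "complex^3^3"
  by (simp add: matrix_mul_assoc mat_commute[of c A])

lemma mat_cancel_left:
  assumes "c \<noteq> 0" "mat c ** A = mat c ** (B :: complex^3^3)" shows "A = B"
proof -
  have "mat (inverse c) ** (mat c ** A) = mat (inverse c) ** (mat c ** B)" using assms(2) by simp
  then show ?thesis using assms(1) by (simp add: matrix_mul_assoc mat_mult_mat)
qed

context imag_quad
begin

section \<open>Residue classes of integral matrices and the integral stabiliser of z\<close>

lemma OK_residues_finite:
  assumes "n > 0"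
  obtains \<kappa> :: "complex \<Rightarrow> int \<times> int" where "finite (range \<kappa>)"
    "\<And>x y. x \<in> OK \<Longrightarrow> y \<in> OK \<Longrightarrow> \<kappa> x = \<kappa> y \<Longrightarrow> \<exists>q\<in>OK. x - y = of_int n * q"
proof -
  obtain w where w: "w \<in> OK" "Im w \<noteq> 0" "OK = {of_int m * 1 + of_int n * w | m n. True}"
    by (rule OK_basis)
  have "\<forall>x. \<exists>a b. x \<in> OK \<longrightarrow> x = of_int a + of_int b * w"
    using w(3) by auto
  then obtain a b where ab: "\<And>x. x \<in> OK \<Longrightarrow> x = of_int (a x) + of_int (b x) * w" by metis
  define \<kappa> where "\<kappa> x = (a x mod n, b x mod n)" for x
  have "range \<kappa> \<subseteq> {0..<n} \<times> {0..<n}" using assms by (auto simp: \<kappa>_def)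
  then have "finite (range \<kappa>)" by (rule finite_subset) simp
  moreover have "\<exists>q\<in>OK. x - y = of_int n * q" if "x \<in> OK" "y \<in> OK" "\<kappa> x = \<kappa> y" for x y
  proof -
    have "n dvd a x - a y" "n dvd b x - b y" using that(3) by (auto simp: \<kappa>_def mod_eq_dvd_iff)
    then obtain p q where pq: "a x - a y = n * p" "b x - b y = n * q" by (auto elim!: dvdE)
    have "x - y = of_int (a x - a y) + of_int (b x - b y) * w"
      using ab[OF that(1)] ab[OF that(2)] by (simp add: algebra_simps)
    also have "\<dots> = of_int n * (of_int p + of_int q * w)" unfolding pq by (simp add: algebra_simps)
    finally show ?thesis using w(1) by (intro bexI[of _ "of_int p + of_int q * w"] OK_add OK_mult) auto
  qed
  ultimately show thesis by (rule that)
qed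

lemma integral_residues_finite:
  assumes "n > 0"
  obtains \<kappa> :: "complex^3^3 \<Rightarrow> (int \<times> int) list" where "finite (range \<kappa>)"
    "\<And>g h. integral_mat g \<Longrightarrow> integral_mat h \<Longrightarrow> \<kappa> g = \<kappa> h \<Longrightarrow>
      \<exists>Y. integral_mat Y \<and> g - h = mat (of_int n) ** Y"
proof -
  obtain \<kappa> :: "complex \<Rightarrow> int \<times> int" where \<kappa>: "finite (range \<kappa>)"
    "\<And>x y. x \<in> OK \<Longrightarrow> y \<in> OK \<Longrightarrow> \<kappa> x = \<kappa> y \<Longrightarrow> \<exists>q\<in>OK. x - y = of_int n * q"
    by (rule OK_residues_finite[OF assms]) blast
  define f where "f g = map \<kappa> [g $ 1 $ 1, g $ 1 $ 2, g $ 1 $ 3, g $ 2 $ 1, g $ 2 $ 2, g $ 2 $ 3, g $ 3 $ 1, g $ 3 $ 2, g $ 3 $ 3]"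
    for g :: "complex^3^3"
  have "range f \<subseteq> {xs. set xs \<subseteq> range \<kappa> \<and> length xs = 9}" by (auto simp: f_def)
  then have "finite (range f)" using finite_lists_length_eq[OF \<kappa>(1)] by (rule finite_subset)
  moreover have "\<exists>Y. integral_mat Y \<and> g - h = mat (of_int n) ** Y"
    if gh: "integral_mat g" "integral_mat h" "f g = f h" for g h
  proof -
    have "\<kappa> (g $ i $ j) = \<kappa> (h $ i $ j)" for i j
      using gh(3) exhaust_3[of i] exhaust_3[of j] by (auto simp: f_def)
    then have "\<exists>q\<in>OK. g $ i $ j - h $ i $ j = of_int n * q" for i j
      using \<kappa>(2) gh(1,2) by (simp add: integral_mat_def)
    then obtain q where q: "\<And>i j. q i j \<in> OK" "\<And>i j. g $ i $ j - h $ i $ j = of_int n * q i j" by metis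
    then have "g - h = mat (of_int n) ** (\<chi> i j. q i j)"
      unfolding matrix_mult_mat_scalar by (simp add: vec_eq_iff)
    then show ?thesis using q(1) by (intro exI[of _ "\<chi> i j. q i j"]) (simp add: integral_mat_def)
  qed
  ultimately show thesis by (rule that)
qed

definition fixing_group :: "complex^3 \<Rightarrow> (complex^3^3) set" where
  "fixing_group z = {g \<in> carrier SUh. integral_mat g \<and> g *v z = z}"

lemma subgroup_fixing_group: "subgroup (fixing_group z) SUh"
proof -
  have "fixing_group z = {g \<in> carrier SUh. integral_mat g} \<inter> {g \<in> carrier SUh. g *v z = z}"
    by (auto simp: fixing_group_def)
  then show ?thesis using SUh.subgroups_Inter_pair[OF subgroup_integral subgroup_fixing] by simp
qed

text \<open>An integral lift and a lift fixing z differ by a cube root of unity. It is the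
  eigenvalue of the integral lift at the integral vector z, so it is integral and the lift fixing z
  is integral too.\<close>

lemma Gamma_Int_stab:
  assumes z: "z \<noteq> 0" "\<And>i. z $ i \<in> OK"
  shows "Gamma K \<inter> stab z = proj_PSUh ` fixing_group z"
proof
  show "proj_PSUh ` fixing_group z \<subseteq> Gamma K \<inter> stab z"
    by (auto simp: Gamma_eq stab_def fixing_group_def)
  show "Gamma K \<inter> stab z \<subseteq> proj_PSUh ` fixing_group z"
  proof
    fix X assume "X \<in> Gamma K \<inter> stab z"
    then obtain g g0 where g: "g \<in> carrier SUh" "integral_mat g" "X = proj_PSUh g"
      and g0: "g0 \<in> carrier SUh" "X = proj_PSUh g0" "g0 *v z = z"
      by (auto simp: Gamma_eq stab_def)
    obtain w where w: "w ^ 3 = 1" "g = mat w ** g0" using proj_eqD[of g g0] g(3) g0(2) by metis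
    have "g *v z = w *s z" using g0(3) by (simp add: w(2) mat_mult_vec flip: matrix_vector_mul_assoc)
    then have "w \<in> OK" using integral_eigenvalue_OK[OF g(2) _ z w(1)] by blast
    moreover have "g0 = mat (cnj w) ** g"
      using cube_root_unity_cnj[OF w(1)] by (simp add: w(2) matrix_mul_assoc mat_mult_mat mult.commute)
    ultimately have "integral_mat g0" using g(2) by (simp add: integral_mult integral_mat_scalar OK_cnj)
    then show "X \<in> proj_PSUh ` fixing_group z" using g0 by (auto simp: fixing_group_def)
  qed
qed

end

section \<open>Commensurability\<close>

context imag_quad
begin

lemma pos_orth_OK: assumes "\<And>i. z $ i \<in> OK" shows "pos_orth z $ i \<in> OK"
  using exhaust_3[of i] assms by (auto simp: pos_orth_def intro!: OK_cnj OK_uminus)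

lemma hcross_OK:
  assumes "\<And>i. x $ i \<in> OK" "\<And>i. y $ i \<in> OK" shows "hcross x y $ i \<in> OK"
  using exhaust_3[of i] assms unfolding hcross_def
  by (auto simp del: complex_cnj_diff complex_cnj_mult intro!: OK_cnj OK_uminus OK_diff OK_mult)

lemma hip_OK:
  assumes "\<And>i. x $ i \<in> OK" "\<And>i. y $ i \<in> OK" shows "hip x y \<in> OK"
  unfolding hip_def using assms by (intro OK_add OK_diff OK_mult OK_uminus OK_cnj) auto

lemma frame_mat_integral:
  assumes "\<And>i. z $ i \<in> OK" "\<And>i. u $ i \<in> OK" shows "integral_mat (frame_mat z u)"
  using assms hcross_OK[OF assms] by (simp add: integral_mat_def frame_mat_def mat_cols_def forall_3)

lemma frame_dual_integral:
  assumes "\<And>i. z $ i \<in> OK" "\<And>i. u $ i \<in> OK" shows "integral_mat (frame_dual z u)"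
  using assms hcross_OK[OF assms] hip_OK[OF assms(1,1)] hip_OK[OF assms(2,2)]
  by (auto simp: integral_mat_def frame_dual_def hdual_def forall_3 intro!: OK_mult OK_cnj OK_uminus)

lemma quat_mat0_integral:
  assumes "D \<in> OK" "s \<in> OK" "x \<in> int_quats" shows "integral_mat (quat_mat0 D s x)"
  using assms by (cases x) (auto simp: integral_mat_def forall_3 elim!: Ints_cases intro!: OK_add OK_diff OK_mult)

lemma fixing_group_arises:
  assumes z: "\<And>i. z $ i \<in> OK" and D: "herm z = real D" "D > 0"
  shows "\<exists>H. conjugate_subgroups PSUh (proj_PSUh ` fixing_group z) H \<and>
    arises_from_quaternion_algebra (int D) (field_disc K) H"
proof -
  obtain s where s: "s \<in> OK" "Re s = 0" "s\<^sup>2 = of_int (field_disc K)" "field_disc K < 0"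
    "\<And>x. x \<in> OK \<Longrightarrow> \<exists>a b. of_int (2 * field_disc K) * x = of_int a + of_int b * s"
    by (rule sqrt_field_disc) blast
  define d where "d = field_disc K"
  define u where "u = pos_orth z"
  have u: "\<And>i. u $ i \<in> OK" unfolding u_def by (rule pos_orth_OK[OF z])
  have orth: "hip u z = 0" and upos: "herm u > 0" unfolding u_def by (rule pos_orth)+
  have zpos: "herm z > 0" using D by simp
  have "hip u u \<in> \<int>" by (rule OK_real_int[OF hip_OK[OF u u]]) (simp add: hip_self)
  then obtain c where c: "hip u u = of_int c" by (auto elim: Ints_cases)
  then have hu: "herm u = of_int c" by (metis hip_self of_real_eq_iff of_real_of_int_eq)
  \<comment> \<open>The product of the norms of z and u, which is the denominator of the inverse
    frame: \<open>U\<close> and \<open>V\<close> below satisfy U V = V U = n.\<close>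
  define n where "n = int D * c"
  have c0: "c > 0" using upos hu by simp
  have n: "n > 0" "of_real (herm z * herm u) = (of_int n :: complex)" using c0 D hu by (simp_all add: n_def)
  define U V T where "U = frame_mat z u" and "V = frame_dual z u" and "T = frame_trans (herm z) (herm u)"
  define \<gamma> where "\<gamma> = frame_iso z u"
  have Uint: "integral_mat U" and Vint: "integral_mat V"
    unfolding U_def V_def by (rule frame_mat_integral[OF z u] frame_dual_integral[OF z u])+
  have VU: "V ** U = mat (of_int n)" and UV: "U ** V = mat (of_int n)"
    unfolding U_def V_def n(2)[symmetric]
    by (rule frame_dual_frame_mat[OF orth zpos upos] frame_mat_frame_dual[OF orth zpos upos])+
  have \<gamma>: "\<gamma> \<in> carrier SUh" unfolding \<gamma>_def by (rule frame_iso_SUh[OF orth zpos upos])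
  have \<gamma>T: "\<gamma> = U ** T" by (simp add: \<gamma>_def U_def T_def frame_iso_def)
  define k where "k = complex_of_real (1 / sqrt (herm z))"
  have k: "k \<noteq> 0" using zpos by (simp add: k_def)
  have axis: "\<gamma> *v axis 2 1 = k *s z" unfolding \<gamma>_def k_def by (rule frame_iso_axis[OF orth zpos upos])
  \<comment> \<open>The square roots in \<open>T\<close> and \<gamma> cancel, leaving the integral
    matrix \<open>V\<close>; this lets both inclusions be checked on integral matrices.\<close>
  have nT: "mat (of_int n) ** (T ** hadj \<gamma>) = V"
  proof -
    have "V = V ** (\<gamma> ** hadj \<gamma>)" by (simp add: SUh_mult_hadj[OF \<gamma>])
    also have "\<dots> = (V ** U) ** (T ** hadj \<gamma>)" by (simp add: \<gamma>T matrix_mul_assoc)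
    finally show ?thesis by (simp add: VU)
  qed

  \<comment> \<open>The norm-one quaternions of the integral order as a subgroup of
    \<open>SUh\<close>\<close>
  define r where "r = complex_of_real (sqrt (herm z))"
  have rr: "r * r = of_int (int D)" and ss: "s * s = of_int d"
    using s(3) D by (simp_all add: r_def d_def power2_eq_square flip: of_real_mult)
  define \<tau> where "\<tau> = quat_rep r s"
  have mor: "quat_algebra_morphism (int D) d \<tau>" unfolding \<tau>_def by (rule quat_algebra_morphism_rep[OF rr ss])
  note \<tau>_mult = quat_rep_mult[OF rr ss, folded \<tau>_def]
  let ?A = "quat_order_norm1 (int D) d"
  have \<tau>1: "E_emb (\<tau> (1, 0, 0, 0)) = mat 1" using mor by (simp add: quat_algebra_morphism_def E_emb_one)
  have \<tau>SU: "E_emb (\<tau> x) \<in> carrier SUh" if "quat_norm (int D) d x = 1" for x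
  proof (rule E_emb_SUh)
    show "det (\<tau> x) = 1" unfolding \<tau>_def using that by (simp add: det_quat_rep[OF rr ss])
    obtain x0 x1 x2 x3 where x: "x = (x0, x1, x2, x3)" by (cases x)
    have re: "Im (of_rat q) = 0" for q by (simp flip: of_real_of_rat_complex)
    show "Im (\<tau> x $ 1 $ 1) = 0" "Im (\<tau> x $ 2 $ 2) = 0" "Re (\<tau> x $ 1 $ 2) = 0" "Re (\<tau> x $ 2 $ 1) = 0"
      by (simp_all add: x \<tau>_def re s(2) r_def)
  qed
  have conjinv: "hadj (E_emb (\<tau> x)) = E_emb (\<tau> (quat_conj x))" if x: "quat_norm (int D) d x = 1" for x
  proof -
    have "E_emb (\<tau> (quat_conj x)) ** E_emb (\<tau> x) = mat 1"
      unfolding E_emb_mult[symmetric] \<tau>_mult[symmetric] quat_conj_mult x by (rule \<tau>1)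
    then have "E_emb (\<tau> (quat_conj x)) ** (E_emb (\<tau> x) ** hadj (E_emb (\<tau> x))) = hadj (E_emb (\<tau> x))"
      by (simp add: matrix_mul_assoc)
    then show ?thesis by (simp add: SUh_mult_hadj[OF \<tau>SU[OF x]])
  qed
  have Amult: "quat_mult (int D) d x y \<in> ?A" if "x \<in> ?A" "y \<in> ?A" for x y
    using that quat_mult_int[of x y] quat_norm_mult[OF rr ss] by (auto simp: quat_order_norm1_def)
  have Anorm: "quat_norm (int D) d x = 1" if "x \<in> ?A" for x using that by (simp add: quat_order_norm1_def)
  let ?Q0 = "E_emb ` \<tau> ` ?A"
  have Q0: "subgroup ?Q0 SUh"
  proof (rule SUh.subgroupI)
    show "?Q0 \<subseteq> carrier SUh" using \<tau>SU Anorm by blast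
    have "(1, 0, 0, 0) \<in> ?A" by (simp add: quat_order_norm1_def)
    then show "?Q0 \<noteq> {}" by blast
  next
    fix a assume "a \<in> ?Q0"
    then obtain x where x: "x \<in> ?A" "a = E_emb (\<tau> x)" by blast
    then have "inv\<^bsub>SUh\<^esub> a = E_emb (\<tau> (quat_conj x))" using \<tau>SU conjinv Anorm by (simp add: inv_SUh)
    then show "inv\<^bsub>SUh\<^esub> a \<in> ?Q0" using quat_order_conj[OF x(1)] by blast
  next
    fix a b assume "a \<in> ?Q0" "b \<in> ?Q0"
    then obtain x y where "x \<in> ?A" "a = E_emb (\<tau> x)" "y \<in> ?A" "b = E_emb (\<tau> y)" by blast
    then have "a ** b = E_emb (\<tau> (quat_mult (int D) d x y))" "quat_mult (int D) d x y \<in> ?A"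
      using Amult by (simp_all add: \<tau>_mult E_emb_mult)
    then show "a \<otimes>\<^bsub>SUh\<^esub> b \<in> ?Q0" by auto
  qed
  define Q where "Q = proj_PSUh ` ?Q0"
  have Qsub: "subgroup Q PSUh" unfolding Q_def by (rule subgroup_proj_image[OF Q0])

  \<comment> \<open>The conjugate of the integral stabiliser of z\<close>
  let ?G = "fixing_group z"
  define H0 where "H0 = (\<lambda>g. hadj \<gamma> ** g ** \<gamma>) ` ?G"
  have H0: "subgroup H0 SUh" unfolding H0_def by (rule subgroup_conj_SUh[OF subgroup_fixing_group \<gamma>])
  define H where "H = proj_PSUh ` H0"
  have Hsub: "subgroup H PSUh" unfolding H_def by (rule subgroup_proj_image[OF H0])
  have HQsub: "subgroup (H \<inter> Q) PSUh" by (rule PSUh.subgroups_Inter_pair[OF Hsub Qsub])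

  have conj: "conjugate_subgroups PSUh (proj_PSUh ` ?G) H"
    unfolding conjugate_subgroups_def
  proof (intro bexI)
    show "proj_PSUh (hadj \<gamma>) \<in> carrier PSUh" using SUh_hadj[OF \<gamma>] by (auto simp: carrier_PSUh)
    have "proj_PSUh (hadj \<gamma> ** g ** \<gamma>) = proj_PSUh (hadj \<gamma>) \<otimes>\<^bsub>PSUh\<^esub> proj_PSUh g \<otimes>\<^bsub>PSUh\<^esub> inv\<^bsub>PSUh\<^esub> proj_PSUh (hadj \<gamma>)"
      if "g \<in> ?G" for g
      using that \<gamma> by (simp add: fixing_group_def proj_inv proj_mult SUh_mult SUh_hadj)
    then show "H = (\<lambda>y. proj_PSUh (hadj \<gamma>) \<otimes>\<^bsub>PSUh\<^esub> y \<otimes>\<^bsub>PSUh\<^esub> inv\<^bsub>PSUh\<^esub> proj_PSUh (hadj \<gamma>)) ` (proj_PSUh ` ?G)"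
      unfolding H_def H0_def image_image by (rule image_cong[OF refl])
  qed

  \<comment> \<open>Finite index in the quaternion group: congruence modulo n\<close>
  have fiQ: "finite_index PSUh Q (H \<inter> Q)"
  proof (rule PSUh.finite_rcosets_image[OF Qsub HQsub])
    show "Q = (\<lambda>x. proj_PSUh (E_emb (\<tau> x))) ` ?A" by (simp add: Q_def image_image)
    define \<kappa> :: "quat \<Rightarrow> int \<times> int \<times> int \<times> int" where
      "\<kappa> = (\<lambda>(a, b, c, e). (\<lfloor>a\<rfloor> mod n, \<lfloor>b\<rfloor> mod n, \<lfloor>c\<rfloor> mod n, \<lfloor>e\<rfloor> mod n))"
    have "\<kappa> ` ?A \<subseteq> {0..<n} \<times> {0..<n} \<times> {0..<n} \<times> {0..<n}" using n(1) by (auto simp: \<kappa>_def)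
    then show "finite (\<kappa> ` ?A)" by (rule finite_subset) simp
    fix x y assume x: "x \<in> ?A" and y: "y \<in> ?A" and eq: "\<kappa> x = \<kappa> y"
    have diff: "\<exists>q\<in>\<int>. a = b + of_int n * q" if ab: "a \<in> \<int>" "b \<in> \<int>" "\<lfloor>a\<rfloor> mod n = \<lfloor>b\<rfloor> mod n" for a b :: rat
    proof -
      obtain i j where ij: "a = of_int i" "b = of_int j" using ab(1,2) by (auto elim!: Ints_cases)
      then have "n dvd i - j" using ab(3) by (simp add: mod_eq_dvd_iff)
      then obtain q where "i - j = n * q" by (rule dvdE)
      then have "i = j + n * q" by simp
      then have "a = b + of_int n * of_int q" using ij by simp
      then show ?thesis by (intro bexI[of _ "of_int q"]) auto
    qed
    have "\<exists>q\<in>int_quats. x = y + quat_scale (of_int n) q"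
    proof -
      obtain x0 x1 x2 x3 where xx: "x = (x0, x1, x2, x3)" by (cases x)
      obtain y0 y1 y2 y3 where yy: "y = (y0, y1, y2, y3)" by (cases y)
      obtain q0 where q0: "q0 \<in> \<int>" "x0 = y0 + of_int n * q0"
        using diff[of x0 y0] x y eq by (auto simp: xx yy quat_order_norm1_def \<kappa>_def)
      obtain q1 where q1: "q1 \<in> \<int>" "x1 = y1 + of_int n * q1"
        using diff[of x1 y1] x y eq by (auto simp: xx yy quat_order_norm1_def \<kappa>_def)
      obtain q2 where q2: "q2 \<in> \<int>" "x2 = y2 + of_int n * q2"
        using diff[of x2 y2] x y eq by (auto simp: xx yy quat_order_norm1_def \<kappa>_def)
      obtain q3 where q3: "q3 \<in> \<int>" "x3 = y3 + of_int n * q3"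
        using diff[of x3 y3] x y eq by (auto simp: xx yy quat_order_norm1_def \<kappa>_def)
      show ?thesis using q0 q1 q2 q3 by (intro bexI[of _ "(q0, q1, q2, q3)"]) (auto simp: xx yy)
    qed
    then obtain q where q: "q \<in> int_quats" "x = y + quat_scale (of_int n) q" by blast
    \<comment> \<open>Since y has norm 1, its conjugate is its inverse; congruence of x and y modulo
      n thus makes their quotient t equal to 1 + n e with e in the order. It remains to see that t,
      moved to the stabiliser of z, becomes integral.\<close>
    define t where "t = quat_mult (int D) d x (quat_conj y)"
    define e where "e = quat_mult (int D) d q (quat_conj y)"
    have "t = quat_mult (int D) d y (quat_conj y) + quat_scale (of_int n) e"
      unfolding t_def e_def q(2) by (cases q; cases y) (simp add: algebra_simps)
    then have te: "t = (1, 0, 0, 0) + quat_scale (of_int n) e"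
      unfolding quat_mult_conj using Anorm[OF y] by simp
    have tA: "t \<in> ?A" unfolding t_def by (rule Amult[OF x quat_order_conj[OF y]])
    have eint: "e \<in> int_quats" unfolding e_def
      using quat_mult_int[OF q(1)] quat_order_conj[OF y] by (simp add: quat_order_norm1_def)
    have ft: "proj_PSUh (E_emb (\<tau> x)) \<otimes>\<^bsub>PSUh\<^esub> inv\<^bsub>PSUh\<^esub> proj_PSUh (E_emb (\<tau> y)) = proj_PSUh (E_emb (\<tau> t))"
      using \<tau>SU[OF Anorm[OF x]] \<tau>SU[OF Anorm[OF y]] conjinv[OF Anorm[OF y]] SUh_hadj[OF \<tau>SU[OF Anorm[OF y]]]
      by (simp add: proj_inv t_def \<tau>_mult E_emb_mult proj_mult)
    define g where "g = \<gamma> ** E_emb (\<tau> t) ** hadj \<gamma>"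
    have gSU: "g \<in> carrier SUh" unfolding g_def by (intro SUh_mult \<gamma> SUh_hadj \<tau>SU Anorm tA)
    have gz: "g *v z = z"
    proof -
      have "hadj \<gamma> *v (k *s z) = axis 2 1"
        unfolding axis[symmetric] by (simp add: matrix_vector_mul_assoc SUh_hadj_mult[OF \<gamma>])
      then have "g *v (k *s z) = k *s z"
        unfolding g_def by (simp add: matrix_vector_mul_assoc[symmetric] E_emb_axis axis)
      then have "k *s (g *v z) = k *s z" by (simp add: vector_scalar_commute)
      then show ?thesis using k by simp
    qed
    \<comment> \<open>In frame coordinates g is U (1 + n q(e)) V / n, where q(e) is the matrix of e.
      Because U V = n, the denominator disappears and g = 1 + U q(e) V.\<close>
    have "mat (of_int n) ** g = mat (of_int n) ** (mat 1 + U ** quat_mat0 (of_int (int D)) s e ** V)"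
    proof -
      have TE: "T ** E_emb (\<tau> t) = (quat_mat0 (of_int (int D)) s t + third_proj) ** T"
        using frame_trans_quat_rep[OF zpos upos, of s t] by (simp add: T_def \<tau>_def r_def D)
      have "g = U ** (T ** E_emb (\<tau> t)) ** hadj \<gamma>" by (simp add: g_def \<gamma>T matrix_mul_assoc)
      also have "\<dots> = U ** (quat_mat0 (of_int (int D)) s t + third_proj) ** (T ** hadj \<gamma>)"
        unfolding TE by (simp add: matrix_mul_assoc)
      finally have "mat (of_int n) ** g = U ** (quat_mat0 (of_int (int D)) s t + third_proj) ** (mat (of_int n) ** (T ** hadj \<gamma>))"
        by (simp only: mat_left_commute)
      also have "\<dots> = U ** (quat_mat0 (of_int (int D)) s t + third_proj) ** V" unfolding nT ..
      also have "quat_mat0 (of_int (int D)) s t + third_proj = mat 1 + mat (of_int n) ** quat_mat0 (of_int (int D)) s e"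
        unfolding te quat_mat0_add quat_mat0_scale using quat_mat0_one[of "of_int (int D)" s] by (simp add: algebra_simps)
      also have "U ** (mat 1 + mat (of_int n) ** quat_mat0 (of_int (int D)) s e) ** V
        = U ** V + U ** (mat (of_int n) ** quat_mat0 (of_int (int D)) s e) ** V"
        by (simp add: matrix_add_ldistrib matrix_add_distrib_right)
      also have "U ** (mat (of_int n) ** quat_mat0 (of_int (int D)) s e) ** V = mat (of_int n) ** (U ** quat_mat0 (of_int (int D)) s e ** V)"
        by (simp only: matrix_mul_assoc mat_commute[of _ U])
      finally show ?thesis by (simp only: UV matrix_add_ldistrib matrix_mul_rid)
    qed
    then have "g = mat 1 + U ** quat_mat0 (of_int (int D)) s e ** V"
      by (rule mat_cancel_left[rotated]) (use n(1) in simp)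
    then have "integral_mat g"
      by (simp only:) (intro integral_add integral_mult integral_mat_scalar quat_mat0_integral
          Uint Vint OK_int OK_1 s(1) eint)
    then have "g \<in> ?G" using gSU gz by (simp add: fixing_group_def)
    moreover have "hadj \<gamma> ** g ** \<gamma> = E_emb (\<tau> t)"
    proof -
      have "hadj \<gamma> ** g ** \<gamma> = (hadj \<gamma> ** \<gamma>) ** E_emb (\<tau> t) ** (hadj \<gamma> ** \<gamma>)"
        by (simp add: g_def matrix_mul_assoc)
      then show ?thesis by (simp add: SUh_hadj_mult[OF \<gamma>])
    qed
    ultimately have "E_emb (\<tau> t) \<in> H0" unfolding H0_def by (metis image_eqI)
    then show "proj_PSUh (E_emb (\<tau> x)) \<otimes>\<^bsub>PSUh\<^esub> inv\<^bsub>PSUh\<^esub> proj_PSUh (E_emb (\<tau> y)) \<in> H \<inter> Q"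
      unfolding ft H_def Q_def using tA by blast
  qed blast

  \<comment> \<open>Finite index in the integral stabiliser: congruence modulo 2 d n\<close>
  have fiH: "finite_index PSUh H (H \<inter> Q)"
  proof -
    \<comment> \<open>The factor n absorbs the denominator of the inverse frame and the factor 2 d
      brings integers of K into Z + Z s. As d is negative, the modulus actually used is - m, whose
      sign is moved into \<open>Y'\<close>.\<close>
    define m where "m = 2 * d * n"
    have m0: "- m > 0" using s(4) n(1) by (simp add: m_def d_def mult_neg_pos)
    obtain \<kappa> :: "complex^3^3 \<Rightarrow> (int \<times> int) list" where \<kappa>: "finite (range \<kappa>)"
      "\<And>g h. integral_mat g \<Longrightarrow> integral_mat h \<Longrightarrow> \<kappa> g = \<kappa> h \<Longrightarrow>
        \<exists>Y. integral_mat Y \<and> g - h = mat (of_int (- m)) ** Y"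
      by (rule integral_residues_finite[OF m0]) blast
    show ?thesis
    proof (rule PSUh.finite_rcosets_image[OF Hsub HQsub])
      show "H = (\<lambda>g. proj_PSUh (hadj \<gamma> ** g ** \<gamma>)) ` ?G" by (simp add: H_def H0_def image_image)
      show "finite (\<kappa> ` ?G)" using \<kappa>(1) by (rule finite_subset[rotated]) blast
      fix g h assume g: "g \<in> ?G" and h: "h \<in> ?G" and eq: "\<kappa> g = \<kappa> h"
      have gh: "g \<in> carrier SUh" "h \<in> carrier SUh" "integral_mat g" "integral_mat h"
        using g h by (auto simp: fixing_group_def)
      obtain Y where Y: "integral_mat Y" "g - h = mat (of_int (- m)) ** Y" using \<kappa>(2)[OF gh(3,4) eq] by blast
      define p where "p = g ** hadj h"
      have p: "p \<in> ?G"
        using subgroup.m_closed[OF subgroup_fixing_group g subgroup.m_inv_closed[OF subgroup_fixing_group h]] gh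
        by (simp add: p_def inv_SUh)
      have pSU: "p \<in> carrier SUh" "p *v z = z" using p by (auto simp: fixing_group_def)
      define Y' where "Y' = mat (- 1) ** Y ** hadj h"
      have Y': "integral_mat Y'"
        unfolding Y'_def by (intro integral_mult integral_mat_scalar integral_hadj Y gh OK_uminus OK_1)
      have pY: "p = mat 1 + mat (of_int m) ** Y'"
      proof -
        have "g = h + mat (of_int (- m)) ** Y" using Y(2) by (simp add: algebra_simps)
        also have "mat (of_int (- m)) = mat (of_int m) ** (mat (- 1) :: complex^3^3)" by (simp add: mat_mult_mat)
        finally have "p = h ** hadj h + mat (of_int m) ** mat (- 1) ** Y ** hadj h"
          by (simp add: p_def matrix_add_distrib_right)
        then show ?thesis by (simp add: SUh_mult_hadj[OF gh(2)] Y'_def matrix_mul_assoc)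
      qed
      obtain M where M: "det M = 1" "p = conj_su11 \<gamma> M" by (rule fixing_conj_su11[OF \<gamma> axis k pSU])
      have pM: "hadj \<gamma> ** p ** \<gamma> = su11 M"
      proof -
        have "hadj \<gamma> ** p ** \<gamma> = (hadj \<gamma> ** \<gamma>) ** su11 M ** (hadj \<gamma> ** \<gamma>)"
          by (simp add: M(2) conj_su11_def matrix_mul_assoc)
        then show ?thesis by (simp add: SUh_hadj_mult[OF \<gamma>])
      qed
      define W where "W = V ** Y' ** U"
      have Wint: "integral_mat W" unfolding W_def by (intro integral_mult Uint Vint Y')
      \<comment> \<open>Passing to frame coordinates conjugates p by U, at the cost of the
        denominator n; from the modulus 2 d n a congruence modulo 2 d survives.\<close>
      have TW: "T ** su11 M = (mat 1 + mat (of_int (2 * d)) ** W) ** T"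
      proof (rule mat_cancel_left)
        show "of_int n \<noteq> (0 :: complex)" using n(1) by simp
        have "mat (of_int n) ** (T ** su11 M) = (mat (of_int n) ** (T ** hadj \<gamma>)) ** p ** \<gamma>"
          unfolding pM[symmetric] by (simp only: matrix_mul_assoc)
        also have "\<dots> = V ** p ** U ** T" unfolding nT by (simp only: \<gamma>T matrix_mul_assoc)
        also have "V ** p ** U = V ** U + V ** (mat (of_int m) ** Y') ** U"
          unfolding pY by (simp add: matrix_add_ldistrib matrix_add_distrib_right)
        also have "V ** (mat (of_int m) ** Y') ** U = mat (of_int n) ** (mat (of_int (2 * d)) ** W)"
        proof -
          have mn: "mat (of_int m) = mat (of_int n) ** (mat (of_int (2 * d)) :: complex^3^3)"
            by (simp add: mat_mult_mat m_def mult_ac)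
          have "V ** (mat (of_int m) ** Y') ** U = mat (of_int m) ** W"
            unfolding W_def by (simp only: matrix_mul_assoc mat_commute[of _ V])
          then show ?thesis unfolding mn by (simp only: matrix_mul_assoc)
        qed
        also have "(V ** U + mat (of_int n) ** (mat (of_int (2 * d)) ** W)) ** T
            = mat (of_int n) ** ((mat 1 + mat (of_int (2 * d)) ** W) ** T)"
          unfolding VU by (simp add: matrix_add_ldistrib matrix_add_distrib_right matrix_mul_assoc)
        finally show "mat (of_int n) ** (T ** su11 M) = mat (of_int n) ** ((mat 1 + mat (of_int (2 * d)) ** W) ** T)" .
      qed
      \<comment> \<open>Two entries of the second row of X suffice: through \<open>T\<close> they
        express the entries (2,1) and (2,3) of \<open>T ** su11 M\<close>, whose real and imaginary
        parts are, up to sign and scale, the four entries of M.\<close>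
      obtain i j where ij: "of_int (2 * d) * W $ 2 $ 2 = of_int i + of_int j * s"
        using s(5)[of "W $ 2 $ 2"] Wint by (auto simp: integral_mat_def d_def)
      obtain i' j' where ij': "of_int (2 * d) * W $ 2 $ 1 = of_int i' + of_int j' * s"
        using s(5)[of "W $ 2 $ 1"] Wint by (auto simp: integral_mat_def d_def)
      define b where "b = complex_of_real (1 / sqrt (2 * herm z * herm u))"
      have b0: "b \<noteq> 0" using zpos upos by (simp add: b_def)
      have "1 / sqrt (2 * herm u) = sqrt (herm z) * (1 / sqrt (2 * herm z * herm u))"
        using zpos upos by (simp add: real_sqrt_mult)
      then have a: "complex_of_real (1 / sqrt (2 * herm u)) = r * b" unfolding r_def b_def by (simp only: of_real_mult)
      have Tb: "T $ 2 = vector [b, 0, b]" "T $ 1 = vector [r * b, 0, - (r * b)]" "T $ 3 $ 1 = 0" "T $ 3 $ 3 = 0"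
        unfolding T_def frame_trans_def a b_def[symmetric] by simp_all
      have su: "su11 M $ 1 $ 1 = of_real (M $ 1 $ 1)" "su11 M $ 1 $ 3 = \<i> * of_real (M $ 1 $ 2)"
        "su11 M $ 3 $ 1 = - \<i> * of_real (M $ 2 $ 1)" "su11 M $ 3 $ 3 = of_real (M $ 2 $ 2)"
        by (simp_all add: su11_def E_emb_def sl2_twist_def)
      define X where "X = mat 1 + mat (of_int (2 * d)) ** W"
      have TX: "T ** su11 M = X ** T" unfolding X_def by (rule TW)
      have e22: "X $ 2 $ 2 = 1 + (of_int i + of_int j * s)"
        and e21: "X $ 2 $ 1 = of_int i' + of_int j' * s"
        unfolding X_def matrix_mult_mat_scalar using ij ij' by (simp_all add: mat_def)
      have "b * (of_real (M $ 1 $ 1) - \<i> * of_real (M $ 2 $ 1)) = b * ((of_int i' + of_int j' * s) * r + (1 + (of_int i + of_int j * s)))"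
        using arg_cong[OF TX, of "\<lambda>A. A $ 2 $ 1"]
        by (simp add: matrix_matrix_mult_def sum_3 Tb su e22 e21 algebra_simps)
      then have 1: "of_real (M $ 1 $ 1) - \<i> * of_real (M $ 2 $ 1) = (of_int i' + of_int j' * s) * r + (1 + (of_int i + of_int j * s))"
        using b0 by simp
      have "b * (\<i> * of_real (M $ 1 $ 2) + of_real (M $ 2 $ 2)) = b * (- (of_int i' + of_int j' * s) * r + (1 + (of_int i + of_int j * s)))"
        using arg_cong[OF TX, of "\<lambda>A. A $ 2 $ 3"]
        by (simp add: matrix_matrix_mult_def sum_3 Tb su e22 e21 algebra_simps)
      then have 2: "\<i> * of_real (M $ 1 $ 2) + of_real (M $ 2 $ 2) = - (of_int i' + of_int j' * s) * r + (1 + (of_int i + of_int j * s))"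
        using b0 by simp
      \<comment> \<open>Read off from the second row of \<open>quat_mat0\<close>, which is x1 - s
        x3, x0 + s x2: this explains the sign of j' and the shift of i by the identity
        matrix.\<close>
      define x :: quat where "x = (of_int (1 + i), of_int i', of_int j, of_int (- j'))"
      have "sl2_twist M = \<tau> x"
        using 1 2 s(2)
        by (simp add: \<tau>_def x_def sl2_twist_def vec_eq_iff forall_2 complex_eq_iff r_def
            of_rat_add of_rat_minus algebra_simps)
      then have ex: "su11 M = E_emb (\<tau> x)" by (simp add: su11_def)
      have "of_rat (quat_norm (int D) d x) = (1 :: complex)"
        using \<open>sl2_twist M = \<tau> x\<close> det_sl2_twist[of M] M(1) det_quat_rep[OF rr ss, of x] by (simp add: \<tau>_def)
      then have "x \<in> ?A" by (simp add: quat_order_norm1_def x_def)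
      then have "proj_PSUh (su11 M) \<in> Q" unfolding ex Q_def by blast
      moreover have "proj_PSUh (su11 M) \<in> H" unfolding pM[symmetric] H_def H0_def using p by blast
      moreover have "proj_PSUh (hadj \<gamma> ** g ** \<gamma>) \<otimes>\<^bsub>PSUh\<^esub> inv\<^bsub>PSUh\<^esub> proj_PSUh (hadj \<gamma> ** h ** \<gamma>) = proj_PSUh (su11 M)"
      proof -
        have "hadj \<gamma> ** g ** \<gamma> ** hadj (hadj \<gamma> ** h ** \<gamma>) = hadj \<gamma> ** g ** (\<gamma> ** hadj \<gamma>) ** hadj h ** \<gamma>"
          by (simp add: hadj_mult matrix_mul_assoc)
        then have "hadj \<gamma> ** g ** \<gamma> ** hadj (hadj \<gamma> ** h ** \<gamma>) = su11 M"
          unfolding pM[symmetric] p_def by (simp add: SUh_mult_hadj[OF \<gamma>] matrix_mul_assoc)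
        moreover have "hadj \<gamma> ** g ** \<gamma> \<in> carrier SUh" "hadj \<gamma> ** h ** \<gamma> \<in> carrier SUh"
          using gh \<gamma> by (auto intro!: SUh_mult SUh_hadj)
        ultimately show ?thesis by (metis SUh_hadj proj_inv proj_mult)
      qed
      ultimately show "proj_PSUh (hadj \<gamma> ** g ** \<gamma>) \<otimes>\<^bsub>PSUh\<^esub> inv\<^bsub>PSUh\<^esub> proj_PSUh (hadj \<gamma> ** h ** \<gamma>) \<in> H \<inter> Q"
        by simp
    qed blast
  qed
  have "arises_from_quaternion_algebra (int D) d H"
    unfolding arises_from_quaternion_algebra_def commensurable_def
    using Hsub mor subgroup.subset[OF Q0] fiH fiQ unfolding Q_def by blast
  then show ?thesis using conj unfolding d_def by blast
qed

lemma maximal_nonelementary_arises: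
  assumes D: "D > 0" and F: "maximal_nonelementary_C_Fuchsian K F" and disc: "has_discriminant K F D"
  shows "\<exists>H. conjugate_subgroups PSUh F H \<and> arises_from_quaternion_algebra (int D) (field_disc K) H"
proof -
  have nF: "nonelementary_C_Fuchsian K F" and maxF: "\<And>F'. nonelementary_C_Fuchsian K F' \<Longrightarrow> F \<subseteq> F' \<Longrightarrow> F' = F"
    using F by (auto simp: maximal_nonelementary_C_Fuchsian_def)
  then have ne: "\<not> virtually_cyclic PSUh F" by (simp add: nonelementary_C_Fuchsian_def)
  obtain R L p where R: "embedded_PSL2R_or_SL2R R" and L: "complex_proj_line L" "p \<in> H2C" "p \<subseteq> L"
    and inv: "\<And>X. X \<in> R \<Longrightarrow> PSUh_act X L = L" and FR: "F = Gamma K \<inter> R"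
    using nF by (auto simp: nonelementary_C_Fuchsian_def C_Fuchsian_def)
  obtain v where v: "herm v > 0" "L = {y. hip y v = 0}" by (rule proj_line_polar[OF L])
  have Rv: "R \<subseteq> stab v" "subgroup R PSUh"
    using embedded_preserving_line[OF v(1) R] inv unfolding v(2) by blast+
  have Fsub: "subgroup F PSUh" unfolding FR by (rule PSUh.subgroups_Inter_pair[OF subgroup_Gamma Rv(2)])
  obtain z where z: "z \<noteq> 0" "\<And>i. z $ i \<in> OK" "\<And>X. X \<in> F \<Longrightarrow> PSUh_act X (vec.span {z}) = vec.span {z}"
    "herm z = real D"
    using disc by (auto simp: has_discriminant_def)
  have zpos: "herm z > 0" using z(4) D by simp
  obtain k where k: "k \<noteq> 0" "z = k *s v"
    using nonelementary_fixed_point[OF v(1) Fsub _ ne z(2) zpos z(3)] FR Rv(1) by blast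
  have st: "stab z = stab v" unfolding k(2) by (rule stab_scale[OF k(1)])
  define F' where "F' = Gamma K \<inter> stab v"
  have "C_Fuchsian K F'"
    unfolding C_Fuchsian_def F'_def
    using embedded_stab[OF v(1)] L stab_preserves_line[of _ v] v(2) by blast
  moreover have FF': "F \<subseteq> F'" using FR Rv(1) by (auto simp: F'_def)
  moreover have "subgroup F' PSUh"
    unfolding F'_def by (rule PSUh.subgroups_Inter_pair[OF subgroup_Gamma subgroup_stab])
  \<comment> \<open>Maximality of F applies to F' only if F' is nonelementary; a virtually cyclic F'
    would make its subgroup F virtually cyclic.\<close>
  ultimately have "nonelementary_C_Fuchsian K F'"
    unfolding nonelementary_C_Fuchsian_def using PSUh.virtually_cyclic_subgroup[OF _ _ Fsub FF'] ne by blast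
  then have "F = F'" using maxF FF' by blast
  also have "F' = proj_PSUh ` fixing_group z"
    unfolding F'_def st[symmetric] by (rule Gamma_Int_stab[OF z(1,2)])
  finally show ?thesis using fixing_group_arises[OF z(2,4) D] by simp
qed

end

theorem theorem1p3:
  fixes K :: "complex set" and D :: nat and F :: "(complex^3^3) set set"
  assumes "imaginary_quadratic_field K"
    and "D > 0"
    and "maximal_nonelementary_C_Fuchsian K F"
    and "has_discriminant K F D"
  shows "\<exists>H. conjugate_subgroups PSUh F H \<and>
           arises_from_quaternion_algebra (int D) (field_disc K) H"
  using imag_quad.maximal_nonelementary_arises[OF imag_quad.intro] assms by blast

end
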